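(* Every spherical reduced polygon $V\subset S^2$ is contained in a disk of radius $\Delta(V)$ centered at a boundary point of $V$.
   Context: $S^2$ is the unit sphere in $E^3$ with spherical (geodesic) distance. For non-antipodal $a,b$, the arc $ab$ is the shorter part of the great circle through $a,b$. A set $C\subset S^2$ is convex if it contains no pair of antipodes and $ab\subset C$ for all $a,b\in C$. A convex body is a closed convex set with non-empty interior. For a set $A$ contained in an open hemisphere, $\mathrm{conv}(A)$ is the smallest convex set containing $A$. A spherical (convex) polygon is a convex body that is the convex hull of finitely many points. A disk of radius $\rho$ is the set of points at distance at most $\rho$ from a point (its center). A hemisphere is a disk of radius $\frac{\pi}{2}$. A hemisphere $K$ supports $C$ if $C\subset K$ and $\mathrm{bd}(C)\cap\mathrm{bd}(K)\neq\emptyset$. If hemispheres $G,H$ are different and not opposite (centers not antipodal), $L=G\cap H$ is a lune, bounded by the semicircles $\mathrm{bd}(G)\cap H$ and $\mathrm{bd}(H)\cap G$. Its thickness $\Delta(L)$ is the spherical distance between the centers (midpoints) of these semicircles. For a hemisphere $K$ supporting $C$, $\mathrm{width}_K(C)$ is the minimum of $\Delta(K\cap K')$ over all hemispheres $K'$ supporting $C$ for which $K\cap K'$ is a lune. The thickness $\Delta(C)$ is the minimum of $\mathrm{width}_K(C)$ over all hemispheres $K$ supporting $C$. A convex body $R$ is reduced if $\Delta(Z)<\Delta(R)$ for every convex body $Z\subset R$ with $Z\neq R$. A reduced polygon is a spherical polygon that is a reduced convex body. *)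

theory Defs
  imports "HOL-Analysis.Analysis"
begin

abbreviation S2 :: "(real^3) set" where
  "S2 \<equiv> sphere 0 1"

definition sdist :: "real^3 \<Rightarrow> real^3 \<Rightarrow> real" where
  "sdist a b = arccos (a \<bullet> b)"

text \<open>Closedness, interior and boundary are always taken in the topology of the sphere.\<close>

abbreviation sinterior :: "(real^3) set \<Rightarrow> (real^3) set" where
  "sinterior A \<equiv> (top_of_set S2) interior_of A"

abbreviation sbd :: "(real^3) set \<Rightarrow> (real^3) set" where
  "sbd A \<equiv> (top_of_set S2) frontier_of A"

text \<open>Only meaningful for non-antipodal points of the sphere: the part of the great circle
  \<open>S2 \<inter> span {a, b}\<close> in the angle spanned by \<open>a\<close> and \<open>b\<close>, i.e. its shorter part between them.\<close>

definition sarc :: "real^3 \<Rightarrow> real^3 \<Rightarrow> (real^3) set" where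
  "sarc a b = {x \<in> S2. \<exists>u\<ge>0. \<exists>v\<ge>0. x = u *\<^sub>R a + v *\<^sub>R b}"

definition sconvex :: "(real^3) set \<Rightarrow> bool" where
  "sconvex C \<longleftrightarrow> C \<subseteq> S2 \<and> (\<forall>a\<in>C. - a \<notin> C) \<and> (\<forall>a\<in>C. \<forall>b\<in>C. sarc a b \<subseteq> C)"

definition sconvex_body :: "(real^3) set \<Rightarrow> bool" where
  "sconvex_body C \<longleftrightarrow> sconvex C \<and> closedin (top_of_set S2) C \<and> sinterior C \<noteq> {}"

definition sdisk :: "real^3 \<Rightarrow> real \<Rightarrow> (real^3) set" where
  "sdisk c \<rho> = {x \<in> S2. sdist c x \<le> \<rho>}"

definition open_hemisphere :: "real^3 \<Rightarrow> (real^3) set" where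
  "open_hemisphere c = {x \<in> S2. sdist c x < pi / 2}"

definition spolygon :: "(real^3) set \<Rightarrow> bool" where
  "spolygon V \<longleftrightarrow> sconvex_body V \<and>
     (\<exists>A. finite A \<and> (\<exists>c\<in>S2. A \<subseteq> open_hemisphere c) \<and> V = sconvex hull A)"

definition hemisphere :: "(real^3) set \<Rightarrow> bool" where
  "hemisphere K \<longleftrightarrow> (\<exists>c\<in>S2. K = sdisk c (pi / 2))"

definition supports :: "(real^3) set \<Rightarrow> (real^3) set \<Rightarrow> bool" where
  "supports K C \<longleftrightarrow> hemisphere K \<and> C \<subseteq> K \<and> sbd C \<inter> sbd K \<noteq> {}"

definition opposite :: "(real^3) set \<Rightarrow> (real^3) set \<Rightarrow> bool" where
  "opposite G H \<longleftrightarrow> (\<exists>c\<in>S2. G = sdisk c (pi / 2) \<and> H = sdisk (- c) (pi / 2))"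

text \<open>A lune is represented by the pair of hemispheres \<open>G\<close>, \<open>H\<close> whose intersection it is.\<close>

definition lune_pair :: "(real^3) set \<Rightarrow> (real^3) set \<Rightarrow> bool" where
  "lune_pair G H \<longleftrightarrow> hemisphere G \<and> hemisphere H \<and> G \<noteq> H \<and> \<not> opposite G H"

text \<open>The midpoint of the semicircle \<open>sbd G \<inter> H\<close>: its unique point equidistant from its two
  end-points, which are the corners of the lune, i.e. the elements of \<open>sbd G \<inter> sbd H\<close>.\<close>

definition semicircle_center :: "(real^3) set \<Rightarrow> (real^3) set \<Rightarrow> real^3" where
  "semicircle_center G H =
     (THE m. m \<in> sbd G \<inter> H \<and> (\<forall>p \<in> sbd G \<inter> sbd H. \<forall>q \<in> sbd G \<inter> sbd H. sdist m p = sdist m q))"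

definition lune_thickness :: "(real^3) set \<Rightarrow> (real^3) set \<Rightarrow> real" where
  "lune_thickness G H = sdist (semicircle_center G H) (semicircle_center H G)"

text \<open>For a convex body, the infima in the next two definitions are attained (by compactness of
  the set of centers of supporting hemispheres), so they are minima.\<close>

definition swidth :: "(real^3) set \<Rightarrow> (real^3) set \<Rightarrow> real" where
  "swidth K C = Inf {lune_thickness K K' | K'. supports K' C \<and> lune_pair K K'}"

definition thickness :: "(real^3) set \<Rightarrow> real" where
  "thickness C = Inf {swidth K C | K. supports K C}"

definition reduced :: "(real^3) set \<Rightarrow> bool" where
  "reduced R \<longleftrightarrow> sconvex_body R \<and>
     (\<forall>Z. sconvex_body Z \<and> Z \<subseteq> R \<and> Z \<noteq> R \<longrightarrow> thickness Z < thickness R)"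

definition reduced_polygon :: "(real^3) set \<Rightarrow> bool" where
  "reduced_polygon V \<longleftrightarrow> spolygon V \<and> reduced V"

end

theory Submission
  imports Defs
begin

text \<open>
  The unit vectors of the dual cone of a convex body \<open>V\<close> (the functionals that are nonnegative on
  \<open>V\<close>) are the centers of the hemispheres containing \<open>V\<close>, and the lune of two hemispheres with
  centers \<open>c\<close> and \<open>d\<close> has thickness \<open>\<pi>\<close> minus the distance of \<open>c\<close> and \<open>d\<close>. So the thickness of
  \<open>V\<close> is \<open>arccos \<kappa>\<close>, where \<open>- \<kappa>\<close> is the least inner product of two unit vectors of the dual cone
  (\<open>thickness_eq\<close>). For a pair \<open>c\<close>, \<open>d\<close> that attains this minimum, the midpoints
  \<open>(d + \<kappa> c) / s\<close> and \<open>(c + \<kappa> d) / s\<close> of the two sides of the lune, with \<open>s\<^sup>2 = 1 - \<kappa>\<^sup>2\<close>, belong to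
  \<open>V\<close>; they are the ends of a chord of length \<open>arccos \<kappa>\<close> that is perpendicular to both bounding
  circles.

  Suppose that \<open>V\<close> is a reduced polygon. Cutting off a small piece at a vertex has to decrease the
  thickness, and in the limit of smaller and smaller pieces a chord of this kind is found that
  starts at the vertex itself (\<open>reduced_vertex_chord\<close>). So each vertex \<open>v i\<close> has a foot \<open>t i\<close> on
  the boundary, at distance exactly the thickness. The case \<open>\<kappa> < 0\<close> is impossible, and for
  \<open>\<kappa> = 0\<close> the foot of any chord is itself the center of a hemisphere containing \<open>V\<close>. Let
  \<open>\<kappa> > 0\<close>.

  Any two of these chords cross or have a common end point. The reason is that \<open>V\<close> lies in the lune of each chord, so that
  an inner product with a lune center is at most the sine of the thickness; for two chords that do
  not cross, the linear relation between their four end points contradicts these bounds. Counting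
  the vertices on the two sides of a chord then shows that the number \<open>n = 2 k + 1\<close> of vertices is
  odd and that \<open>t i\<close> lies on the side from \<open>v (i + k)\<close> to \<open>v (i + k + 1)\<close>
  (\<open>opposite_side\<close>).

  The rest of the proof uses only the triangle inequality. If two diagonals of a convex
  quadrilateral cross, then two opposite sides are together at most as long as the diagonals
  (\<open>crossing_arcs_sdist\<close>). The arcs from \<open>t i\<close> to \<open>v j\<close> and from \<open>v (j + 1)\<close> to \<open>v (j + k + 1)\<close>
  cross for \<open>i \<le> j < i + k\<close>. With \<open>g j\<close> for the distance of \<open>v j\<close> and \<open>v (j + k)\<close> this gives
  \<open>|t i, v (j + 1)| \<le> |t i, v j| + a j\<close> where \<open>a j = g (j + 1) - g (j + k + 1)\<close>, and there is a
  symmetric inequality for \<open>j\<close> below \<open>i\<close>. The bound \<open>a j\<close> does not depend on \<open>i\<close>, and its sum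
  over a period is zero; hence \<open>a j = P (j + 1) - P j\<close> for a periodic function \<open>P\<close>. Adding up
  from \<open>v i\<close> gives \<open>|t i, v j| \<le> arccos \<kappa> + P j - P i\<close>. If \<open>i\<close> maximizes \<open>P\<close>, then all
  vertices, and with them \<open>V\<close>, are within \<open>arccos \<kappa>\<close> of the boundary point \<open>t i\<close>
  (\<open>foot_within_width\<close>).
\<close>

section \<open>Triple products and unit vectors\<close>

definition triple :: "real^3 \<Rightarrow> real^3 \<Rightarrow> real^3 \<Rightarrow> real" where
  "triple a b c = a \<bullet> cross3 b c"

lemma triple_expand:
  "triple a b c = a$1 * (b$2 * c$3 - b$3 * c$2) + a$2 * (b$3 * c$1 - b$1 * c$3)
                + a$3 * (b$1 * c$2 - b$2 * c$1)"
  by (simp add: triple_def cross3_simps)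

lemma inner_real3: "(a::real^3) \<bullet> b = a$1 * b$1 + a$2 * b$2 + a$3 * b$3"
  by (simp add: inner_vec_def sum_3)

lemma triple_rotate: "triple a b c = triple b c a"
  by (simp add: triple_expand algebra_simps)

lemma triple_swap: "triple b a c = - triple a b c"
  by (simp add: triple_expand algebra_simps)

lemma triple_swap': "triple a c b = - triple a b c"
  by (simp add: triple_expand algebra_simps)

lemma triple_same [simp]: "triple a a b = 0" "triple a b a = 0" "triple b a a = 0"
  by (simp_all add: triple_expand algebra_simps)

lemma triple_add:
  "triple (x + y) b c = triple x b c + triple y b c"
  "triple a (x + y) c = triple a x c + triple a y c"
  "triple a b (x + y) = triple a b x + triple a b y"
  by (simp_all add: triple_expand algebra_simps)

lemma triple_scale:
  "triple (r *\<^sub>R a) b c = r * triple a b c"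
  "triple a (r *\<^sub>R b) c = r * triple a b c"
  "triple a b (r *\<^sub>R c) = r * triple a b c"
  by (simp_all add: triple_expand algebra_simps)

lemma triple_minus:
  "triple (- a) b c = - triple a b c" "triple a (- b) c = - triple a b c"
  "triple a b (- c) = - triple a b c"
  by (simp_all add: triple_expand algebra_simps)

text \<open>
  Four vectors of \<open>\<real>\<^sup>3\<close> are linearly dependent, with triple products as coefficients. In this
  arrangement all coefficients are nonnegative when \<open>a\<close>, \<open>b\<close>, \<open>c\<close>, \<open>d\<close> are in convex position in
  this cyclic order, and both sides of the equation are then a multiple of the point where the
  diagonals \<open>a c\<close> and \<open>b d\<close> cross.
\<close>

lemma triple_dependency:
  "triple b c d *\<^sub>R a + triple a b d *\<^sub>R c = triple a c d *\<^sub>R b + triple a b c *\<^sub>R d"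
  by (simp add: vec_eq_iff forall_3 triple_expand algebra_simps)

text \<open>
  Both triple products are determinants, and the right-hand side is the determinant of the inner
  products of their rows. The identity transfers sign information: if enough inner products vanish, the sign of one triple product follows from that
  of the other.
\<close>

lemma triple_mult:
  "triple a b c * triple x y z =
     (a \<bullet> x) * ((b \<bullet> y) * (c \<bullet> z) - (b \<bullet> z) * (c \<bullet> y))
   - (a \<bullet> y) * ((b \<bullet> x) * (c \<bullet> z) - (b \<bullet> z) * (c \<bullet> x))
   + (a \<bullet> z) * ((b \<bullet> x) * (c \<bullet> y) - (b \<bullet> y) * (c \<bullet> x))"
  by (simp add: triple_expand inner_real3) algebra

lemma cramer_inner:
  "triple a b x *\<^sub>R u = (u \<bullet> a) *\<^sub>R cross3 b x + (u \<bullet> b) *\<^sub>R cross3 x a + (u \<bullet> x) *\<^sub>R cross3 a b"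
  by (simp add: triple_def cross3_simps forall_3)

lemma unit_inner_bounds:
  fixes a b :: "'a::real_inner"
  assumes "norm a = 1" "norm b = 1"
  shows "-1 \<le> a \<bullet> b" "a \<bullet> b \<le> 1"
  using Cauchy_Schwarz_ineq2[of a b] assms by auto

lemma unit_inner_eq_1:
  fixes a b :: "'a::real_inner"
  assumes "norm a = 1" "norm b = 1" "a \<bullet> b = 1"
  shows "a = b"
proof -
  have "(a - b) \<bullet> (a - b) = 0"
    using assms by (simp add: inner_diff inner_commute norm_eq_1)
  then show ?thesis by simp
qed

lemma unit_scale_eq:
  fixes x y :: "'a::real_normed_vector"
  assumes "norm x = 1" "norm y = 1" "x = r *\<^sub>R y" "0 \<le> r"
  shows "x = y"
  using assms by auto

section \<open>Crossing arcs\<close>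

text \<open>
  The components of \<open>a\<close> and \<open>b\<close> orthogonal to \<open>q\<close> have the sines of the two distances as norms,
  so the Cauchy-Schwarz inequality bounds the cosine of the sum of the distances from above by
  \<open>a \<bullet> b\<close>.
\<close>

lemma sdist_triangle:
  assumes "norm a = 1" "norm b = 1" "norm q = 1"
  shows "sdist a b \<le> sdist a q + sdist q b"
proof (cases "sdist a q + sdist q b \<ge> pi")
  case True
  then show ?thesis
    using arccos_ubound[of "a \<bullet> b"] unit_inner_bounds[OF assms(1,2)] by (auto simp: sdist_def)
next
  case False
  define x where "x = a \<bullet> q"
  define y where "y = q \<bullet> b"
  have x: "-1 \<le> x" "x \<le> 1" and y: "-1 \<le> y" "y \<le> 1"
    using unit_inner_bounds assms by (auto simp: x_def y_def)
  have nn: "a \<bullet> a = 1" "b \<bullet> b = 1" "q \<bullet> q = 1" using assms by (simp_all add: norm_eq_1)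
  define a' where "a' = a - x *\<^sub>R q"
  define b' where "b' = b - y *\<^sub>R q"
  have "a' \<bullet> b' = a \<bullet> b - x * y"
    by (simp add: a'_def b'_def inner_diff x_def y_def nn inner_commute algebra_simps)
  moreover have "norm a' = sqrt (1 - x\<^sup>2)" "norm b' = sqrt (1 - y\<^sup>2)"
    by (simp_all add: norm_eq_sqrt_inner a'_def b'_def inner_diff x_def y_def nn inner_commute
        power2_eq_square algebra_simps)
  ultimately have "- (sqrt (1 - x\<^sup>2) * sqrt (1 - y\<^sup>2)) \<le> a \<bullet> b - x * y"
    using Cauchy_Schwarz_ineq2[of a' b'] by auto
  then have "cos (arccos x + arccos y) \<le> a \<bullet> b"
    using x y by (simp add: cos_add cos_arccos sin_arccos)
  moreover have "0 \<le> arccos x + arccos y"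
    using arccos_lbound x y by (simp add: add_nonneg_nonneg)
  ultimately have "arccos (a \<bullet> b) \<le> arccos (cos (arccos x + arccos y))"
    using unit_inner_bounds[OF assms(1,2)] by (intro arccos_le_arccos) auto
  also have "\<dots> = arccos x + arccos y"
    using False \<open>0 \<le> _\<close> by (intro arccos_cos) (auto simp: sdist_def x_def y_def)
  finally show ?thesis by (simp add: sdist_def x_def y_def)
qed

text \<open>
  The addition theorems give the cosine of the sum of the two partial distances; its sine is
  nonnegative, which places the sum in the range of \<open>arccos\<close>.
\<close>

lemma sdist_arc_add:
  assumes "norm a = 1" "norm c = 1" "norm q = 1"
    and q: "q = \<alpha> *\<^sub>R a + \<gamma> *\<^sub>R c" and nonneg: "0 \<le> \<alpha>" "0 \<le> \<gamma>"
  shows "sdist a q + sdist q c = sdist a c"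
proof -
  define g where "g = a \<bullet> c"
  have nn: "a \<bullet> a = 1" "c \<bullet> c = 1" "q \<bullet> q = 1" using assms by (simp_all add: norm_eq_1)
  have g: "-1 \<le> g" "g \<le> 1" using unit_inner_bounds assms by (auto simp: g_def)
  have one: "\<alpha>\<^sup>2 + \<gamma>\<^sup>2 + 2 * \<alpha> * \<gamma> * g = 1"
    using nn(3) unfolding q
    by (simp add: inner_add nn g_def inner_commute power2_eq_square algebra_simps)
  define x where "x = a \<bullet> q"
  define y where "y = q \<bullet> c"
  have xe: "x = \<alpha> + \<gamma> * g" and ye: "y = \<alpha> * g + \<gamma>"
    unfolding x_def y_def q by (simp_all add: inner_add nn g_def inner_commute)
  have x: "-1 \<le> x" "x \<le> 1" and y: "-1 \<le> y" "y \<le> 1"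
    using unit_inner_bounds assms by (auto simp: x_def y_def)
  have g2: "1 - g\<^sup>2 \<ge> 0" using g by (simp add: abs_square_le_1 abs_le_iff)
  have "1 - x\<^sup>2 = \<gamma>\<^sup>2 * (1 - g\<^sup>2)" using one unfolding xe by algebra
  then have sx: "sqrt (1 - x\<^sup>2) = \<gamma> * sqrt (1 - g\<^sup>2)" using nonneg by (simp add: real_sqrt_mult)
  have "1 - y\<^sup>2 = \<alpha>\<^sup>2 * (1 - g\<^sup>2)" using one unfolding ye by algebra
  then have sy: "sqrt (1 - y\<^sup>2) = \<alpha> * sqrt (1 - g\<^sup>2)" using nonneg by (simp add: real_sqrt_mult)
  have sq: "sqrt (1 - g\<^sup>2) * sqrt (1 - g\<^sup>2) = 1 - g\<^sup>2" using g2 by simp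
  have "cos (arccos x + arccos y) = x * y - \<alpha> * \<gamma> * (sqrt (1 - g\<^sup>2) * sqrt (1 - g\<^sup>2))"
    using x y by (simp add: cos_add cos_arccos sin_arccos sx sy)
  also have "\<dots> = g" using one unfolding sq xe ye by algebra
  finally have cosg: "cos (arccos x + arccos y) = g" .
  have "sin (arccos x + arccos y) = (\<gamma> * y + x * \<alpha>) * sqrt (1 - g\<^sup>2)"
    using x y by (simp add: sin_add cos_arccos sin_arccos sx sy algebra_simps)
  also have "\<gamma> * y + x * \<alpha> = 1" using one unfolding xe ye by algebra
  finally have sing: "sin (arccos x + arccos y) = sqrt (1 - g\<^sup>2)" by simp
  have lo: "0 \<le> arccos x + arccos y"
    using arccos_lbound x y by (simp add: add_nonneg_nonneg)
  have hi: "arccos x + arccos y \<le> pi"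
  proof (rule ccontr)
    assume "\<not> ?thesis"
    then have gt: "arccos x + arccos y > pi" by simp
    have "arccos x \<le> pi" "arccos y \<le> pi" using arccos_ubound x y by auto
    moreover have "arccos x + arccos y \<noteq> 2 * pi"
    proof
      assume "arccos x + arccos y = 2 * pi"
      then have "arccos x = pi" "arccos y = pi"
        using \<open>arccos x \<le> pi\<close> \<open>arccos y \<le> pi\<close> by linarith+
      then have "x = -1" "y = -1" using x y by (metis cos_arccos cos_pi)+
      then have "\<gamma> * y + x * \<alpha> = - \<gamma> - \<alpha>" by simp
      then show False using \<open>\<gamma> * y + x * \<alpha> = 1\<close> nonneg by simp
    qed
    ultimately have "arccos x + arccos y < 2 * pi" by linarith
    then have "sin (arccos x + arccos y) < 0" using gt sin_lt_zero by blast
    then show False using sing g2 by (smt (verit) real_sqrt_ge_zero)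
  qed
  have "arccos g = arccos x + arccos y"
    using arccos_cos[OF lo hi] cosg by simp
  then show ?thesis by (simp add: sdist_def x_def y_def g_def)
qed

text \<open>
  Go from \<open>a\<close> to \<open>d\<close> and from \<open>b\<close> to \<open>c\<close> through the common point \<open>q\<close> of the arcs \<open>a c\<close> and
  \<open>b d\<close>. The functional \<open>h\<close> keeps the four points in an open hemisphere, so that the linear
  dependency between them does not degenerate to \<open>0 = 0\<close>.
\<close>

lemma crossing_arcs_sdist:
  assumes unit: "norm a = 1" "norm b = 1" "norm c = 1" "norm d = 1"
    and h: "h \<bullet> a > 0" "h \<bullet> b > 0" "h \<bullet> c > 0" "h \<bullet> d > 0"
    and tr: "triple b c d \<ge> 0" "triple a b d \<ge> 0" "triple a c d \<ge> 0" "triple a b c \<ge> 0"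
    and pos: "triple b c d > 0 \<or> triple a b d > 0"
  shows "sdist a d + sdist b c \<le> sdist a c + sdist b d"
proof -
  define p where "p = triple b c d *\<^sub>R a + triple a b d *\<^sub>R c"
  have p': "p = triple a c d *\<^sub>R b + triple a b c *\<^sub>R d"
    unfolding p_def by (rule triple_dependency)
  have "h \<bullet> p = triple b c d * (h \<bullet> a) + triple a b d * (h \<bullet> c)"
    by (simp add: p_def inner_add)
  also have "\<dots> > 0"
    using pos
  proof
    assume "triple b c d > 0"
    then show ?thesis using tr h by (intro add_pos_nonneg mult_pos_pos mult_nonneg_nonneg) auto
  next
    assume "triple a b d > 0"
    then show ?thesis using tr h by (intro add_nonneg_pos mult_pos_pos mult_nonneg_nonneg) auto
  qed
  finally have "p \<noteq> 0" by auto
  define q where "q = (1 / norm p) *\<^sub>R p"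
  have nq: "norm q = 1" using \<open>p \<noteq> 0\<close> by (simp add: q_def)
  have q1: "q = (triple b c d / norm p) *\<^sub>R a + (triple a b d / norm p) *\<^sub>R c"
    unfolding q_def p_def by (simp add: scaleR_add_right)
  have q2: "q = (triple a c d / norm p) *\<^sub>R b + (triple a b c / norm p) *\<^sub>R d"
    unfolding q_def by (subst (2) p') (simp add: scaleR_add_right)
  have "sdist a q + sdist q c = sdist a c"
    by (rule sdist_arc_add[OF unit(1,3) nq q1]) (use tr in auto)
  moreover have "sdist b q + sdist q d = sdist b d"
    by (rule sdist_arc_add[OF unit(2,4) nq q2]) (use tr in auto)
  moreover have "sdist a d \<le> sdist a q + sdist q d" "sdist b c \<le> sdist b q + sdist q c"
    using sdist_triangle unit nq by auto
  ultimately show ?thesis by linarith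
qed

section \<open>Hemispheres and lunes\<close>

definition dual_cone :: "(real^3) set \<Rightarrow> (real^3) set" where
  "dual_cone C = {c. \<forall>x\<in>C. 0 \<le> c \<bullet> x}"

lemma sinterior_iff:
  "x \<in> sinterior C \<longleftrightarrow> x \<in> S2 \<and> (\<exists>e>0. \<forall>y\<in>S2. dist y x < e \<longrightarrow> y \<in> C)"
proof
  assume "x \<in> sinterior C"
  then obtain U where U: "open U" "x \<in> S2 \<inter> U" "S2 \<inter> U \<subseteq> C"
    by (auto simp: interior_of_def openin_open)
  then obtain e where "0 < e" "\<forall>y. dist y x < e \<longrightarrow> y \<in> U" by (metis IntE open_dist)
  then show "x \<in> S2 \<and> (\<exists>e>0. \<forall>y\<in>S2. dist y x < e \<longrightarrow> y \<in> C)" using U by blast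
next
  assume "x \<in> S2 \<and> (\<exists>e>0. \<forall>y\<in>S2. dist y x < e \<longrightarrow> y \<in> C)"
  then obtain e where e: "x \<in> S2" "0 < e" "\<forall>y\<in>S2. dist y x < e \<longrightarrow> y \<in> C" by blast
  have "openin (top_of_set S2) (S2 \<inter> ball x e)" by blast
  moreover have "x \<in> S2 \<inter> ball x e" "S2 \<inter> ball x e \<subseteq> C"
    using e by (auto simp: dist_commute)
  ultimately show "x \<in> sinterior C" unfolding interior_of_def by blast
qed

lemma inner_sgn: "c \<bullet> sgn x = (c \<bullet> x) / norm x" for x :: "'a::real_inner"
  by (simp add: sgn_div_norm divide_inverse_commute)

text \<open>
  An interior point can be moved a little in the direction of \<open>- c\<close> without leaving \<open>C\<close>.
\<close>

lemma sinterior_dual_pos: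
  assumes "x \<in> sinterior C" "c \<in> dual_cone C" "c \<noteq> 0"
  shows "0 < c \<bullet> x"
proof (rule ccontr)
  assume neg: "\<not> 0 < c \<bullet> x"
  obtain e where x: "norm x = 1" and e: "0 < e" "\<forall>y\<in>S2. dist y x < e \<longrightarrow> y \<in> C"
    using assms(1) by (auto simp: sinterior_iff)
  have "((\<lambda>r. sgn (x - r *\<^sub>R c)) \<longlongrightarrow> sgn (x - 0 *\<^sub>R c)) (at_right 0)"
    using x by (intro tendsto_intros) auto
  then have "((\<lambda>r. sgn (x - r *\<^sub>R c)) \<longlongrightarrow> x) (at_right 0)" using x by (simp add: sgn_div_norm)
  then have "eventually (\<lambda>r. dist (sgn (x - r *\<^sub>R c)) x < e) (at_right 0)" using e(1) by (rule tendstoD)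
  moreover have "((\<lambda>r. x - r *\<^sub>R c) \<longlongrightarrow> x - 0 *\<^sub>R c) (at_right 0)" by (intro tendsto_intros)
  then have "eventually (\<lambda>r. x - r *\<^sub>R c \<noteq> 0) (at_right 0)"
    using x by (intro tendsto_imp_eventually_ne) auto
  ultimately have "eventually (\<lambda>r. 0 < r \<and> x - r *\<^sub>R c \<noteq> 0 \<and> dist (sgn (x - r *\<^sub>R c)) x < e) (at_right 0)"
    using eventually_at_right_less by (intro eventually_conj) auto
  from eventually_happens'[OF _ this] obtain r :: real
    where r: "0 < r" "x - r *\<^sub>R c \<noteq> 0" "dist (sgn (x - r *\<^sub>R c)) x < e" by auto
  then have "sgn (x - r *\<^sub>R c) \<in> C" using e(2) by (simp add: norm_sgn)
  then have "0 \<le> c \<bullet> (x - r *\<^sub>R c)"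
    using assms(2) r(2) by (auto simp: dual_cone_def inner_sgn zero_le_divide_iff)
  then have "r * (c \<bullet> c) \<le> c \<bullet> x" by (simp add: inner_diff_right)
  moreover have "0 < r * (c \<bullet> c)" using r(1) assms(3) by simp
  ultimately show False using neg by simp
qed

lemma sdisk_hemisphere:
  assumes "norm c = 1" shows "sdisk c (pi / 2) = {x \<in> S2. 0 \<le> c \<bullet> x}"
proof -
  have "arccos (c \<bullet> x) \<le> pi / 2 \<longleftrightarrow> 0 \<le> c \<bullet> x" if "norm x = 1" for x
    using arccos_le_mono[of "c \<bullet> x" 0] unit_inner_bounds[OF assms that] by (simp add: abs_le_iff)
  then show ?thesis by (auto simp: sdisk_def sdist_def)
qed

lemma frontier_closed_diff:
  assumes "closedin (top_of_set S2) C" shows "sbd C = C - sinterior C"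
  using assms by (simp add: frontier_of_def closure_of_closedin)

lemma sbd_hemisphere:
  assumes "norm c = 1" shows "sbd (sdisk c (pi / 2)) = {x \<in> S2. c \<bullet> x = 0}"
proof -
  let ?H = "sdisk c (pi / 2)"
  have H: "?H = S2 \<inter> {x. 0 \<le> c \<bullet> x}" unfolding sdisk_hemisphere[OF assms] by blast
  have "closedin (top_of_set S2) ?H"
    unfolding H by (intro closedin_closed_Int closed_halfspace_ge)
  then have bd: "sbd ?H = ?H - sinterior ?H" by (rule frontier_closed_diff)
  have dual: "c \<in> dual_cone ?H" by (simp add: dual_cone_def H)
  have "c \<noteq> 0" using assms by auto
  then have "0 < c \<bullet> x" if "x \<in> sinterior ?H" for x using sinterior_dual_pos[OF that dual] by simp
  moreover have "x \<in> sinterior ?H" if "x \<in> S2" "0 < c \<bullet> x" for x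
  proof -
    have "openin (top_of_set S2) (S2 \<inter> {x. 0 < c \<bullet> x})" using open_halfspace_gt by blast
    moreover have "S2 \<inter> {x. 0 < c \<bullet> x} \<subseteq> ?H" by (auto simp: H)
    ultimately show ?thesis using that unfolding interior_of_def by blast
  qed
  ultimately show ?thesis unfolding bd by (force simp: H)
qed

lemma sdisk_hemisphere_inj:
  assumes "norm c = 1" "norm d = 1" "sdisk c (pi / 2) = sdisk d (pi / 2)" shows "c = d"
proof (rule ccontr)
  assume "c \<noteq> d"
  define x where "x = sgn (c - d)"
  have "c \<bullet> d < 1"
    using unit_inner_eq_1[OF assms(1,2)] unit_inner_bounds[OF assms(1,2)] \<open>c \<noteq> d\<close> by force
  moreover have "c \<bullet> c = 1" "d \<bullet> d = 1" using assms by (simp_all add: norm_eq_1)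
  ultimately have "0 < c \<bullet> x" "d \<bullet> x < 0"
    using \<open>c \<noteq> d\<close>
    by (simp_all add: x_def inner_sgn inner_diff_right inner_commute[of d c] divide_neg_pos)
  moreover have "x \<in> S2" using \<open>c \<noteq> d\<close> by (simp add: x_def norm_sgn)
  ultimately have "x \<in> sdisk c (pi / 2)" "x \<notin> sdisk d (pi / 2)"
    by (simp_all add: sdisk_hemisphere[OF assms(1)] sdisk_hemisphere[OF assms(2)])
  then show False using assms(3) by simp
qed

text \<open>
  The corners of the lune are the two unit vectors orthogonal to \<open>c\<close> and \<open>d\<close>. A point equidistant
  from these two opposite points is orthogonal to both of them, hence in the plane of \<open>c\<close> and \<open>d\<close>.
\<close>

lemma semicircle_center_eq:
  assumes c: "norm c = 1" and d: "norm d = 1" and ne: "c \<noteq> d" "c \<noteq> - d"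
  shows "semicircle_center (sdisk c (pi / 2)) (sdisk d (pi / 2)) =
     (1 / sqrt (1 - (c \<bullet> d)\<^sup>2)) *\<^sub>R (d - (c \<bullet> d) *\<^sub>R c)"
proof -
  define g where "g = c \<bullet> d"
  define s where "s = sqrt (1 - g\<^sup>2)"
  have nn: "c \<bullet> c = 1" "d \<bullet> d = 1" using c d by (simp_all add: norm_eq_1)
  have "g \<noteq> 1" using unit_inner_eq_1[OF c d] ne by (auto simp: g_def)
  moreover have "g \<noteq> -1" using unit_inner_eq_1[of c "- d"] c d ne by (auto simp: g_def)
  ultimately have "-1 < g" "g < 1" using unit_inner_bounds[OF c d] by (auto simp: g_def)
  then have g2: "g\<^sup>2 < 1" by (simp add: abs_square_less_1 abs_less_iff)
  then have s: "0 < s" "s\<^sup>2 = 1 - g\<^sup>2" by (simp_all add: s_def)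
  define e where "e = (1 / s) *\<^sub>R (d - g *\<^sub>R c)"
  have ce: "c \<bullet> e = 0" by (simp add: e_def inner_diff_right nn g_def)
  have de: "d \<bullet> e = s"
    using s by (simp add: e_def inner_diff_right nn inner_commute[of d c] g_def[symmetric]
        power2_eq_square field_simps)
  have "e \<bullet> e = (1 / s) * (d \<bullet> e - g * (c \<bullet> e))"
    by (subst (1) e_def) (simp add: inner_diff_left)
  then have ne: "norm e = 1" using ce de s by (simp add: norm_eq_1)
  define w where "w = cross3 c d"
  have "(norm w)\<^sup>2 + g\<^sup>2 = 1" using norm_cross_dot[of c d] c d by (simp add: w_def g_def)
  then have ww: "w \<bullet> w = s\<^sup>2" using s by (simp add: power2_norm_eq_inner)
  then have wnz: "w \<noteq> 0" using s by auto
  have cw: "c \<bullet> w = 0" "d \<bullet> w = 0" by (simp_all add: w_def dot_cross_self)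
  have wc: "cross3 w c = d - g *\<^sub>R c" "triple c d w = w \<bullet> w"
  proof -
    have "cross3 (cross3 c d) c = (c \<bullet> c) *\<^sub>R d - (c \<bullet> d) *\<^sub>R c"
      by (simp add: cross3_simps forall_3)
    then show "cross3 w c = d - g *\<^sub>R c" by (simp add: w_def g_def nn)
    show "triple c d w = w \<bullet> w"
      by (simp add: w_def triple_rotate[of d _ c, symmetric] triple_rotate[of c d])
         (simp add: triple_def cross3_simps)
  qed
  define G where "G = sdisk c (pi / 2)"
  define H where "H = sdisk d (pi / 2)"
  have bd: "sbd G = {x \<in> S2. c \<bullet> x = 0}" "sbd H = {x \<in> S2. d \<bullet> x = 0}"
    and H: "x \<in> H \<longleftrightarrow> x \<in> S2 \<and> 0 \<le> d \<bullet> x" for x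
    unfolding G_def H_def
    by (rule sbd_hemisphere[OF c], rule sbd_hemisphere[OF d], simp add: sdisk_hemisphere[OF d])
  show ?thesis unfolding semicircle_center_def G_def[symmetric] H_def[symmetric] g_def[symmetric] s_def[symmetric] e_def[symmetric]
  proof (rule the_equality)
    have "e \<bullet> p = 0" if "c \<bullet> p = 0" "d \<bullet> p = 0" for p
      using that by (simp add: e_def inner_diff_left)
    then show "e \<in> sbd G \<inter> H \<and> (\<forall>p\<in>sbd G \<inter> sbd H. \<forall>q\<in>sbd G \<inter> sbd H. sdist e p = sdist e q)"
      unfolding bd using ne ce de s by (auto simp: sdist_def H)
  next
    fix m
    assume m: "m \<in> sbd G \<inter> H \<and> (\<forall>p\<in>sbd G \<inter> sbd H. \<forall>q\<in>sbd G \<inter> sbd H. sdist m p = sdist m q)"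
    then have m1: "norm m = 1" "c \<bullet> m = 0" "0 \<le> d \<bullet> m" unfolding bd by (auto simp: H)
    \<comment> \<open>the corners of the lune are \<open>sgn w\<close> and \<open>- sgn w\<close>\<close>
    have p: "sgn w \<in> sbd G \<inter> sbd H" "- sgn w \<in> sbd G \<inter> sbd H"
      unfolding bd using wnz cw by (auto simp: norm_sgn inner_sgn)
    then have "arccos (m \<bullet> sgn w) = arccos (m \<bullet> - sgn w)"
      using m unfolding sdist_def by blast
    moreover have "\<bar>m \<bullet> sgn w\<bar> \<le> 1"
      using unit_inner_bounds[of m "sgn w"] m1 wnz by (simp add: norm_sgn abs_le_iff)
    ultimately have "m \<bullet> sgn w = m \<bullet> - sgn w" by (metis arccos_eq_iff abs_minus_cancel inner_minus_right)
    then have mw: "m \<bullet> w = 0" using wnz by (simp add: inner_sgn)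
    have "triple c d w *\<^sub>R m = (m \<bullet> d) *\<^sub>R cross3 w c"
      using m1 mw by (subst cramer_inner) (simp add: inner_commute)
    then have "s\<^sup>2 *\<^sub>R m = (m \<bullet> d) *\<^sub>R (s *\<^sub>R e)" using s by (simp add: wc ww e_def)
    then have "(1 / s\<^sup>2) *\<^sub>R (s\<^sup>2 *\<^sub>R m) = ((m \<bullet> d) / s) *\<^sub>R e"
      using s(1) by (simp add: power2_eq_square)
    then have "m = ((m \<bullet> d) / s) *\<^sub>R e" using s(1) by simp
    then show "m = e"
      by (rule unit_scale_eq[OF m1(1) ne]) (use m1 s in \<open>simp add: inner_commute\<close>)
  qed
qed

lemma lune_thickness_eq:
  assumes c: "norm c = 1" and d: "norm d = 1" and ne: "c \<noteq> d" "c \<noteq> - d"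
  shows "lune_thickness (sdisk c (pi / 2)) (sdisk d (pi / 2)) = arccos (- (c \<bullet> d))"
proof -
  define g where "g = c \<bullet> d"
  have nn: "c \<bullet> c = 1" "d \<bullet> d = 1" using c d by (simp_all add: norm_eq_1)
  have "g \<noteq> 1" using unit_inner_eq_1[OF c d] ne by (auto simp: g_def)
  moreover have "g \<noteq> -1" using unit_inner_eq_1[of c "- d"] c d ne by (auto simp: g_def)
  ultimately have "-1 < g" "g < 1" using unit_inner_bounds[OF c d] by (auto simp: g_def)
  then have g2: "g\<^sup>2 < 1" by (simp add: abs_square_less_1 abs_less_iff)
  have ne': "d \<noteq> c" "d \<noteq> - c" using ne by auto
  have dot: "(d - g *\<^sub>R c) \<bullet> (c - g *\<^sub>R d) = - g * (1 - g\<^sup>2)"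
    by (simp add: inner_diff nn g_def[symmetric] inner_commute[of d c] power2_eq_square algebra_simps)
  have "((1 / r) *\<^sub>R (d - g *\<^sub>R c)) \<bullet> ((1 / r) *\<^sub>R (c - g *\<^sub>R d)) = - g * (1 - g\<^sup>2) / (r * r)" for r
    unfolding inner_scaleR_left inner_scaleR_right dot by simp
  from this[of "sqrt (1 - g\<^sup>2)"]
  have "((1 / sqrt (1 - g\<^sup>2)) *\<^sub>R (d - g *\<^sub>R c)) \<bullet> ((1 / sqrt (1 - g\<^sup>2)) *\<^sub>R (c - g *\<^sub>R d)) = - g"
    using g2 by simp
  then show ?thesis
    unfolding lune_thickness_def semicircle_center_eq[OF c d ne] semicircle_center_eq[OF d c ne']
    by (simp add: sdist_def g_def inner_commute[of d c])
qed

section \<open>The dual cone and the thickness\<close>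

lemma sconvex_bodyD:
  assumes "sconvex_body C"
  shows "C \<subseteq> S2" "closed C" "compact C" "C \<noteq> {}" "\<And>x. x \<in> C \<Longrightarrow> norm x = 1" "\<And>x. x \<in> C \<Longrightarrow> - x \<notin> C"
    "closedin (top_of_set S2) C" "sinterior C \<noteq> {}" "sconvex C"
proof -
  show *: "sconvex C" "closedin (top_of_set S2) C" "sinterior C \<noteq> {}"
    using assms by (auto simp: sconvex_body_def)
  show "C \<subseteq> S2" and "\<And>x. x \<in> C \<Longrightarrow> - x \<notin> C" using *(1) by (auto simp: sconvex_def)
  then show "\<And>x. x \<in> C \<Longrightarrow> norm x = 1" by auto
  show "closed C" using *(2) closed_sphere closedin_closed_trans by blast
  then show "compact C" using \<open>C \<subseteq> S2\<close>
    by (meson bounded_sphere bounded_subset compact_eq_bounded_closed)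
  show "C \<noteq> {}" using *(3) interior_of_subset by fast
qed

lemma sconvex_combine:
  assumes "sconvex C" "x \<in> C" "y \<in> C" "0 \<le> a" "0 \<le> b" "a *\<^sub>R x + b *\<^sub>R y \<noteq> 0"
  shows "sgn (a *\<^sub>R x + b *\<^sub>R y) \<in> C"
proof -
  let ?z = "a *\<^sub>R x + b *\<^sub>R y"
  have "sgn ?z = (a / norm ?z) *\<^sub>R x + (b / norm ?z) *\<^sub>R y"
    by (simp add: sgn_div_norm scaleR_add_right divide_inverse_commute)
  moreover have "norm (sgn ?z) = 1" using assms by (simp add: norm_sgn)
  ultimately have "sgn ?z \<in> sarc x y" using assms(4,5) unfolding sarc_def
    by (intro CollectI conjI exI[of _ "a / norm ?z"] exI[of _ "b / norm ?z"]) auto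
  then show ?thesis using assms(1-3) unfolding sconvex_def by blast
qed

lemma convex_conic_hull_sconvex:
  assumes "sconvex C" "C \<noteq> {}"
  shows "convex (conic hull C)"
proof (rule convexI)
  fix x y :: "real^3" and u v :: real
  assume "x \<in> conic hull C" "y \<in> conic hull C" and uv: "0 \<le> u" "0 \<le> v" "u + v = 1"
  then obtain a b x' y' where x: "x = a *\<^sub>R x'" "0 \<le> a" "x' \<in> C" and y: "y = b *\<^sub>R y'" "0 \<le> b" "y' \<in> C"
    by (auto simp: conic_hull_explicit)
  define z where "z = (u * a) *\<^sub>R x' + (v * b) *\<^sub>R y'"
  have "\<exists>r w. z = r *\<^sub>R w \<and> 0 \<le> r \<and> w \<in> C"
  proof (cases "z = 0")
    case True
    then show ?thesis using x by (intro exI[of _ 0] exI[of _ x']) auto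
  next
    case False
    then have "sgn z \<in> C" unfolding z_def
      by (intro sconvex_combine[OF assms(1) x(3) y(3)]) (use x y uv in auto)
    then show ?thesis using False
      by (intro exI[of _ "norm z"] exI[of _ "sgn z"]) (simp add: sgn_div_norm)
  qed
  then show "u *\<^sub>R x + v *\<^sub>R y \<in> conic hull C" by (auto simp: conic_hull_explicit z_def x y)
qed

text \<open>
  The bipolar theorem: a point outside the closed convex cone spanned by \<open>C\<close> is separated from it
  by a functional that is nonnegative on \<open>C\<close>.
\<close>

lemma dual_dual:
  assumes C: "sconvex_body C" and x: "norm x = 1" and dual: "\<And>c. c \<in> dual_cone C \<Longrightarrow> 0 \<le> c \<bullet> x"
  shows "x \<in> C"
proof (rule ccontr)
  assume "x \<notin> C"
  note D = sconvex_bodyD[OF C]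
  have "0 \<notin> C" using D(5) by force
  then have cl: "closed (conic hull C)" using D(3) closed_conic_hull by blast
  have cv: "convex (conic hull C)" using convex_conic_hull_sconvex D by blast
  have "x \<notin> conic hull C"
  proof
    assume "x \<in> conic hull C"
    then obtain r y where ry: "x = r *\<^sub>R y" "0 \<le> r" "y \<in> C" by (auto simp: conic_hull_explicit)
    then show False using \<open>x \<notin> C\<close> unit_scale_eq[OF x D(5)[OF ry(3)] ry(1,2)] by simp
  qed
  then obtain a b where ab: "a \<bullet> x < b" "\<And>k. k \<in> conic hull C \<Longrightarrow> b < a \<bullet> k"
    using separating_hyperplane_closed_point[OF cv cl] by blast
  have mem: "r *\<^sub>R y \<in> conic hull C" if "0 \<le> r" "y \<in> C" for r y
    using that by (auto simp: conic_hull_explicit)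
  obtain y0 where "y0 \<in> C" using D(4) by blast
  then have "b < 0" using ab(2)[OF mem[of 0 y0]] by simp
  have "a \<in> dual_cone C"
  proof (unfold dual_cone_def, intro CollectI ballI, rule ccontr)
    fix y assume y: "y \<in> C" "\<not> 0 \<le> a \<bullet> y"
    then have "b < (b / (a \<bullet> y)) * (a \<bullet> y)"
      using ab(2)[OF mem[of "b / (a \<bullet> y)" y]] \<open>b < 0\<close> by (simp add: divide_nonpos_neg)
    then show False using y(2) by simp
  qed
  then show False using dual[of a] ab(1) \<open>b < 0\<close> by simp
qed

text \<open>
  The number \<open>\<kappa>\<close> is minus the cosine of the diameter of the set of unit vectors of the dual cone,
  and \<open>c\<close>, \<open>d\<close> are two points at this distance. Minimality is stated in homogeneous form, so that
  it can be tested on functionals that are not normalized.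
\<close>

definition farthest_pair :: "(real^3) set \<Rightarrow> real \<Rightarrow> real^3 \<Rightarrow> real^3 \<Rightarrow> bool" where
  "farthest_pair C \<kappa> c d \<longleftrightarrow> c \<in> dual_cone C \<and> d \<in> dual_cone C \<and> norm c = 1 \<and> norm d = 1
     \<and> c \<bullet> d = - \<kappa> \<and> (\<forall>c'\<in>dual_cone C. \<forall>d'\<in>dual_cone C. - \<kappa> * (norm c' * norm d') \<le> c' \<bullet> d')"

lemma farthest_pair_commute: "farthest_pair C \<kappa> c d \<Longrightarrow> farthest_pair C \<kappa> d c"
  by (auto simp: farthest_pair_def inner_commute)

lemma dual_cone_scale: "c \<in> dual_cone C \<Longrightarrow> 0 \<le> r \<Longrightarrow> r *\<^sub>R c \<in> dual_cone C"
  by (auto simp: dual_cone_def)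

lemma dual_cone_add: "c \<in> dual_cone C \<Longrightarrow> d \<in> dual_cone C \<Longrightarrow> c + d \<in> dual_cone C"
  by (auto simp: dual_cone_def inner_add_left)

lemma closed_dual_cone: "closed (dual_cone C)"
proof -
  have "dual_cone C = (\<Inter>x\<in>C. {c. 0 \<le> x \<bullet> c})" by (auto simp: dual_cone_def inner_commute)
  then show ?thesis by (simp add: closed_INT closed_halfspace_ge)
qed

text \<open>
  If all functionals of the dual cone were multiples of one unit vector \<open>c\<close>, then \<open>C\<close> would
  contain every unit vector orthogonal to \<open>c\<close>, in particular two antipodes.
\<close>

lemma dual_cone_two_points:
  assumes C: "sconvex_body C"
  obtains c d where "c \<in> dual_cone C" "d \<in> dual_cone C" "norm c = 1" "norm d = 1" "c \<noteq> d"
proof -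
  have *: "\<exists>d\<in>dual_cone C. norm d = 1 \<and> d \<noteq> c" if c: "norm c = 1" for c
  proof (rule ccontr)
    assume no: "\<not> ?thesis"
    obtain y where y: "y \<noteq> 0" "orthogonal c y" using orthogonal_to_vector_exists[of c] by auto
    define x where "x = sgn y"
    have x: "norm x = 1" "c \<bullet> x = 0" using y by (auto simp: x_def norm_sgn inner_sgn orthogonal_def)
    have z: "d \<bullet> x = 0" if "d \<in> dual_cone C" for d
    proof (cases "d = 0")
      case False
      then have "sgn d = c" using no dual_cone_scale[OF that, of "inverse (norm d)"]
        by (metis inverse_nonnegative_iff_nonnegative norm_ge_zero norm_sgn sgn_div_norm)
      then have "sgn d \<bullet> x = 0" using x by simp
      then show ?thesis using False by (simp add: sgn_div_norm)
    qed simp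
    then have "x \<in> C" "- x \<in> C" using dual_dual[OF C] x by auto
    then show False using sconvex_bodyD(6)[OF C] by blast
  qed
  obtain e :: "real^3" where "norm e = 1" using vector_choose_size[of 1] by auto
  then show ?thesis using *[of e] * that by blast
qed

lemma farthest_pair_exists:
  assumes C: "sconvex_body C"
  obtains \<kappa> c d where "farthest_pair C \<kappa> c d" "-1 < \<kappa>" "\<kappa> < 1"
proof -
  define D where "D = dual_cone C \<inter> S2"
  obtain a b where ab: "a \<in> D" "b \<in> D" "a \<noteq> b" "norm a = 1" "norm b = 1"
    using dual_cone_two_points[OF C] unfolding D_def by (metis IntI mem_sphere_0)
  have "compact D" unfolding D_def by (intro closed_Int_compact closed_dual_cone compact_sphere)
  then have "compact (D \<times> D)" by (simp add: compact_Times)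
  moreover have "D \<times> D \<noteq> {}" using ab by auto
  moreover have "continuous_on (D \<times> D) (\<lambda>p. fst p \<bullet> snd p)" by (intro continuous_intros)
  ultimately obtain p where p: "p \<in> D \<times> D" "\<And>q. q \<in> D \<times> D \<Longrightarrow> fst p \<bullet> snd p \<le> fst q \<bullet> snd q"
    using continuous_attains_inf by (metis (no_types, lifting))
  obtain c d where cd: "p = (c, d)" by force
  have le: "c \<bullet> d \<le> c' \<bullet> d'" if "c' \<in> D" "d' \<in> D" for c' d' using p(2)[of "(c', d')"] that cd by simp
  have cD: "c \<in> dual_cone C" "d \<in> dual_cone C" "norm c = 1" "norm d = 1" using p(1) cd by (auto simp: D_def)
  have far: "farthest_pair C (- (c \<bullet> d)) c d"
    unfolding farthest_pair_def
  proof (intro conjI ballI cD)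
    fix c' d' assume c': "c' \<in> dual_cone C" "d' \<in> dual_cone C"
    show "- (- (c \<bullet> d)) * (norm c' * norm d') \<le> c' \<bullet> d'"
    proof (cases "c' = 0 \<or> d' = 0")
      case False
      then have "sgn c' \<in> D" "sgn d' \<in> D"
        using dual_cone_scale[OF c'(1), of "inverse (norm c')"] dual_cone_scale[OF c'(2), of "inverse (norm d')"]
        by (auto simp: D_def norm_sgn sgn_div_norm)
      then have "c \<bullet> d \<le> sgn c' \<bullet> sgn d'" by (rule le)
      also have "\<dots> = c' \<bullet> d' / (norm c' * norm d')" by (simp add: sgn_div_norm field_simps)
      finally show ?thesis using False by (simp add: le_divide_eq)
    qed auto
  qed simp
  have "a \<bullet> b < 1" using unit_inner_eq_1[OF ab(4,5)] unit_inner_bounds[OF ab(4,5)] ab(3) by force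
  then have "c \<bullet> d < 1" using le[OF ab(1,2)] by simp
  moreover have "c \<bullet> d \<noteq> -1"
  proof
    assume "c \<bullet> d = -1"
    then have "c = - d" using unit_inner_eq_1[of c "- d"] cD by simp
    moreover obtain x where "x \<in> sinterior C" using sconvex_bodyD(8)[OF C] by blast
    ultimately show False
      using sinterior_dual_pos[of x C c] sinterior_dual_pos[of x C d] cD by force
  qed
  moreover have "-1 \<le> c \<bullet> d" using unit_inner_bounds cD by blast
  ultimately show ?thesis by (intro that[OF far]) auto
qed

text \<open>
  The derivative of the distance from \<open>d\<close> vanishes or is negative when \<open>c\<close> is moved in the
  direction of another functional \<open>x\<close> of the dual cone. The sign of \<open>\<kappa>\<close> decides whether a lower or
  an upper bound on the norm of \<open>c + e x\<close> is needed; the upper bound is only exact to first order.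
\<close>

lemma farthest_pair_first_order:
  assumes far: "farthest_pair C \<kappa> c d" and x: "x \<in> dual_cone C"
  shows "0 \<le> (d + \<kappa> *\<^sub>R c) \<bullet> x"
proof -
  have cd: "c \<in> dual_cone C" "d \<in> dual_cone C" "norm c = 1" "norm d = 1" "c \<bullet> d = - \<kappa>"
    and least: "\<And>c' d'. c' \<in> dual_cone C \<Longrightarrow> d' \<in> dual_cone C \<Longrightarrow> - \<kappa> * (norm c' * norm d') \<le> c' \<bullet> d'"
    using far by (auto simp: farthest_pair_def)
  have cc: "c \<bullet> c = 1" using cd by (simp add: norm_eq_1)
  have key: "- \<kappa> * norm (c + e *\<^sub>R x) \<le> - \<kappa> + e * (x \<bullet> d)" if "0 \<le> e" for e
    using least[of "c + e *\<^sub>R x" d] cd x that by (simp add: dual_cone_add dual_cone_scale inner_add_left)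
  have lin: "1 + e * (c \<bullet> x) \<le> norm (c + e *\<^sub>R x)" for e
    using norm_cauchy_schwarz[of c "c + e *\<^sub>R x"] cd cc by (simp add: inner_add_right)
  have quad: "norm (c + e *\<^sub>R x) \<le> 1 + e * (c \<bullet> x) + e\<^sup>2 * (x \<bullet> x) / 2" for e
  proof -
    have "(norm (c + e *\<^sub>R x))\<^sup>2 = 1 + 2 * (e * (c \<bullet> x)) + e\<^sup>2 * (x \<bullet> x)"
      unfolding power2_norm_eq_inner by (simp add: inner_add cc inner_commute power2_eq_square)
    moreover have "2 * norm (c + e *\<^sub>R x) \<le> (norm (c + e *\<^sub>R x))\<^sup>2 + 1"
      using sum_squares_bound[of "norm (c + e *\<^sub>R x)" 1] by simp
    ultimately show ?thesis by simp
  qed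
  show ?thesis
  proof (cases "\<kappa> \<le> 0")
    case True
    have "- \<kappa> * (1 + 1 * (c \<bullet> x)) \<le> - \<kappa> * norm (c + 1 *\<^sub>R x)"
      using True lin[of 1] by (intro mult_left_mono) auto
    then show ?thesis using key[of 1] by (simp add: inner_add_left inner_commute algebra_simps)
  next
    case False
    define q where "q = x \<bullet> d + \<kappa> * (c \<bullet> x)"
    have qe: "0 \<le> q + \<kappa> * (x \<bullet> x) / 2 * e" if "0 < e" for e
    proof -
      have "- \<kappa> * (1 + e * (c \<bullet> x) + e\<^sup>2 * (x \<bullet> x) / 2) \<le> - \<kappa> * norm (c + e *\<^sub>R x)"
        using False quad[of e] by (intro mult_left_mono_neg) auto
      also have "\<dots> \<le> - \<kappa> + e * (x \<bullet> d)" using key that by simp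
      finally have "0 \<le> e * (q + \<kappa> * (x \<bullet> x) / 2 * e)"
        by (simp add: q_def algebra_simps power2_eq_square)
      then show ?thesis using that by (simp add: zero_le_mult_iff)
    qed
    have "((\<lambda>e. q + \<kappa> * (x \<bullet> x) / 2 * e) \<longlongrightarrow> q + \<kappa> * (x \<bullet> x) / 2 * 0) (at_right 0)"
      by (intro tendsto_intros)
    then have "0 \<le> q + \<kappa> * (x \<bullet> x) / 2 * 0"
      by (rule tendsto_lowerbound)
        (use qe in \<open>auto intro!: eventually_mono[OF eventually_at_right_less]\<close>)
    then show ?thesis by (simp add: q_def inner_add_left inner_commute[of x d])
  qed
qed

text \<open>
  The point \<open>t\<close> is the midpoint of the side of the lune that lies on the great circle with pole
  \<open>c\<close>. By the first order condition it satisfies all inequalities that define \<open>C\<close>.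
\<close>

lemma farthest_pair_foot:
  assumes C: "sconvex_body C" and far: "farthest_pair C \<kappa> c d" and \<kappa>: "-1 < \<kappa>" "\<kappa> < 1"
  defines "t \<equiv> (1 / sqrt (1 - \<kappa>\<^sup>2)) *\<^sub>R (d + \<kappa> *\<^sub>R c)"
  shows "t \<in> C" "c \<bullet> t = 0"
proof -
  have k2: "\<kappa>\<^sup>2 < 1" using \<kappa> by (simp add: abs_square_less_1 abs_less_iff)
  have cd: "c \<bullet> c = 1" "d \<bullet> d = 1" "c \<bullet> d = - \<kappa>" using far by (auto simp: farthest_pair_def norm_eq_1)
  show "c \<bullet> t = 0" by (simp add: t_def inner_add_right cd)
  have "(d + \<kappa> *\<^sub>R c) \<bullet> (d + \<kappa> *\<^sub>R c) = 1 - \<kappa>\<^sup>2"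
    by (simp add: inner_add cd inner_commute[of d c] power2_eq_square)
  then have "norm (d + \<kappa> *\<^sub>R c) = sqrt (1 - \<kappa>\<^sup>2)" by (simp add: norm_eq_sqrt_inner)
  then have "norm t = 1" using k2 by (simp add: t_def)
  moreover have "0 \<le> c' \<bullet> t" if "c' \<in> dual_cone C" for c'
    using farthest_pair_first_order[OF far that] k2 by (simp add: t_def inner_commute)
  ultimately show "t \<in> C" by (rule dual_dual[OF C])
qed

lemma dual_zero_in_sbd:
  assumes C: "sconvex_body C" and c: "c \<in> dual_cone C" "c \<noteq> 0" and x: "x \<in> C" "c \<bullet> x = 0"
  shows "x \<in> sbd C"
  using sinterior_dual_pos[OF _ c, of x] x frontier_closed_diff[OF sconvex_bodyD(7)[OF C]] by auto

lemma supports_iff: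
  assumes C: "sconvex_body C" and c: "norm c = 1"
  shows "supports (sdisk c (pi / 2)) C \<longleftrightarrow> c \<in> dual_cone C \<and> (\<exists>x\<in>C. c \<bullet> x = 0)"
proof -
  have hem: "hemisphere (sdisk c (pi / 2))" using c by (auto simp: hemisphere_def)
  have sub: "C \<subseteq> sdisk c (pi / 2) \<longleftrightarrow> c \<in> dual_cone C"
    using sconvex_bodyD(1)[OF C] unfolding sdisk_hemisphere[OF c] dual_cone_def by auto
  have "sbd C \<subseteq> C" using frontier_closed_diff[OF sconvex_bodyD(7)[OF C]] by auto
  moreover have "c \<noteq> 0" using c by auto
  ultimately have "sbd C \<inter> sbd (sdisk c (pi / 2)) \<noteq> {} \<longleftrightarrow> (\<exists>x\<in>C. c \<bullet> x = 0)" if "c \<in> dual_cone C"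
    using dual_zero_in_sbd[OF C that] sconvex_bodyD(1)[OF C] unfolding sbd_hemisphere[OF c] by blast
  then show ?thesis unfolding supports_def using hem sub by blast
qed

text \<open>
  A supporting hemisphere and the corresponding lune are determined by centers in the dual cone,
  so \<open>farthest_pair\<close> bounds the thickness of every lune from below. The two hemispheres of a
  farthest pair do support \<open>C\<close>, because of the feet of the pair, and so the bound is attained.
\<close>

lemma thickness_eq:
  assumes C: "sconvex_body C" and far: "farthest_pair C \<kappa> c d" and \<kappa>: "-1 < \<kappa>" "\<kappa> < 1"
  shows "thickness C = arccos \<kappa>"
proof -
  let ?H = "\<lambda>c. sdisk c (pi / 2)"
  have cd: "c \<in> dual_cone C" "d \<in> dual_cone C" "norm c = 1" "norm d = 1" "c \<bullet> d = - \<kappa>"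
    using far by (auto simp: farthest_pair_def)
  have dd: "d \<bullet> d = 1" "(- d) \<bullet> d = -1" using cd by (simp_all add: norm_eq_1)
  have ne: "c \<noteq> d" "c \<noteq> - d" using cd(5) \<kappa> dd by auto
  have sup: "supports (?H c) C" "supports (?H d) C"
    unfolding supports_iff[OF C cd(3)] supports_iff[OF C cd(4)]
    using cd farthest_pair_foot[OF C far \<kappa>] farthest_pair_foot[OF C farthest_pair_commute[OF far] \<kappa>]
    by blast+
  have lune: "lune_pair (?H a) (?H b)" if "norm a = 1" "norm b = 1" "a \<noteq> b" "a \<noteq> - b" for a b
  proof -
    have "\<not> opposite (?H a) (?H b)"
    proof
      assume "opposite (?H a) (?H b)"
      then obtain e where "norm e = 1" "?H a = ?H e" "?H b = ?H (- e)" by (auto simp: opposite_def)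
      then have "a = e" "b = - e" using sdisk_hemisphere_inj that by auto
      then show False using that by simp
    qed
    then show ?thesis using that sdisk_hemisphere_inj[of a b] by (auto simp: lune_pair_def hemisphere_def)
  qed
  have lower: "arccos \<kappa> \<le> lune_thickness K K'" if K: "supports K C" "supports K' C" "lune_pair K K'" for K K'
  proof -
    obtain a b where "a \<in> S2" "b \<in> S2" and K': "K = ?H a" "K' = ?H b"
      using K(3) unfolding lune_pair_def hemisphere_def by blast
    then have ab: "norm a = 1" "norm b = 1" "K = ?H a" "K' = ?H b" by simp_all
    have "a \<noteq> b" "a \<noteq> - b" using K(3) ab by (auto simp: lune_pair_def opposite_def)
    then have l: "lune_thickness K K' = arccos (- (a \<bullet> b))" using lune_thickness_eq ab by simp
    have "a \<in> dual_cone C" "b \<in> dual_cone C" using K(1,2) supports_iff[OF C] ab by auto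
    then have "- \<kappa> * (norm a * norm b) \<le> a \<bullet> b" using far by (auto simp: farthest_pair_def)
    then have "- (a \<bullet> b) \<le> \<kappa>" using ab by simp
    then show ?thesis unfolding l
      using unit_inner_bounds[OF ab(1,2)] \<kappa> by (intro arccos_le_arccos) auto
  qed
  \<comment> \<open>no infimum is taken over an empty set\<close>
  have other: "\<exists>K'. supports K' C \<and> lune_pair K K'" if K: "supports K C" for K
  proof -
    obtain a where "a \<in> S2" and K': "K = ?H a"
      using K unfolding supports_def hemisphere_def by blast
    then have a: "norm a = 1" "K = ?H a" by simp_all
    then have aD: "a \<in> dual_cone C" using K supports_iff[OF C] by auto
    obtain o' where "o' \<in> sinterior C" using sconvex_bodyD(8)[OF C] by blast
    then have "0 < a \<bullet> o'" "0 < c \<bullet> o'" "0 < d \<bullet> o'"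
      using sinterior_dual_pos[of o' C] aD cd a(1) by force+
    then have "a \<noteq> - c" "a \<noteq> - d" by auto
    then show ?thesis using lune[OF a(1) cd(3)] lune[OF a(1) cd(4)] sup ne a(2) by metis
  qed
  have sw: "arccos \<kappa> \<le> swidth K C" if "supports K C" for K
    unfolding swidth_def using other[OF that] lower[OF that] by (intro cInf_greatest) auto
  have "arccos \<kappa> \<le> thickness C"
    unfolding thickness_def using sup(1) sw by (intro cInf_greatest) auto
  moreover have "thickness C \<le> swidth (?H c) C"
    unfolding thickness_def using sup(1) sw by (intro cInf_lower) (auto intro!: bdd_belowI[of _ "arccos \<kappa>"])
  moreover have "swidth (?H c) C \<le> lune_thickness (?H c) (?H d)"
    unfolding swidth_def using sup lune[OF cd(3,4) ne] lower
    by (intro cInf_lower) (auto intro!: bdd_belowI[of _ "arccos \<kappa>"])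
  moreover have "lune_thickness (?H c) (?H d) = arccos \<kappa>"
    using lune_thickness_eq[OF cd(3,4) ne] cd(5) by simp
  ultimately show ?thesis by simp
qed

section \<open>Vertices of reduced bodies\<close>

lemma spherical_cut_body:
  assumes C: "sconvex_body C" and x: "x \<in> sinterior C" "0 < z \<bullet> x"
  shows "sconvex_body (C \<inter> {x. 0 \<le> z \<bullet> x})"
proof -
  note D = sconvex_bodyD[OF C]
  let ?Z = "C \<inter> {x. 0 \<le> z \<bullet> x}"
  have "sarc a b \<subseteq> ?Z" if "a \<in> ?Z" "b \<in> ?Z" for a b
  proof -
    have "sarc a b \<subseteq> C" using that D(9) by (auto simp: sconvex_def)
    moreover have "sarc a b \<subseteq> {x. 0 \<le> z \<bullet> x}"
      using that by (auto simp: sarc_def inner_add_right)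
    ultimately show ?thesis by blast
  qed
  then have 1: "sconvex ?Z" using D(1,6) unfolding sconvex_def by blast
  have 2: "closedin (top_of_set S2) ?Z"
    using D(1,2) by (intro closed_subset closed_Int closed_halfspace_ge) auto
  have "openin (top_of_set S2) (sinterior C \<inter> {x. 0 < z \<bullet> x})"
    by (intro openin_Int_open openin_interior_of open_halfspace_gt)
  moreover have "sinterior C \<inter> {x. 0 < z \<bullet> x} \<subseteq> ?Z"
    using interior_of_subset[of "top_of_set S2" C] by auto
  ultimately have "sinterior C \<inter> {x. 0 < z \<bullet> x} \<subseteq> sinterior ?Z" by (simp add: interior_of_maximal)
  then show ?thesis using 1 2 x by (auto simp: sconvex_body_def)
qed

text \<open>
  Otherwise \<open>t\<close> could be moved, within the part of \<open>C\<close> that is not cut off, towards a point where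
  \<open>c\<close> is negative.
\<close>

lemma cut_pair_touches_cut:
  assumes C: "sconvex_body C" and Z: "Z = C \<inter> {x. 0 \<le> z \<bullet> x}"
    and c: "c \<in> dual_cone Z" "c \<notin> dual_cone C" and t: "t \<in> Z" "c \<bullet> t = 0"
  shows "z \<bullet> t = 0"
proof (rule ccontr)
  assume "z \<bullet> t \<noteq> 0"
  then have zt: "0 < z \<bullet> t" using t Z by auto
  obtain x where x: "x \<in> C" "c \<bullet> x < 0" using c(2) by (auto simp: dual_cone_def not_le)
  have tC: "t \<in> C" using t Z by auto
  define e where "e = (z \<bullet> t) / (\<bar>z \<bullet> x\<bar> + 1)"
  have e: "0 < e" using zt by (simp add: e_def)
  define y where "y = 1 *\<^sub>R t + e *\<^sub>R x"
  have cy: "c \<bullet> y < 0" using x t e by (simp add: y_def inner_add_right mult_pos_neg)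
  have "e * \<bar>z \<bullet> x\<bar> \<le> z \<bullet> t"
    using zt by (simp add: e_def divide_le_eq mult_left_mono)
  moreover have "- (e * \<bar>z \<bullet> x\<bar>) \<le> e * (z \<bullet> x)"
    using e by (metis abs_ge_minus_self abs_mult abs_of_pos minus_le_iff)
  ultimately have zy: "0 \<le> z \<bullet> y" by (simp add: y_def inner_add_right)
  have "y \<noteq> 0" using cy by auto
  then have "sgn y \<in> C" unfolding y_def
    by (intro sconvex_combine sconvex_bodyD(9)[OF C] tC x) (use e in auto)
  then have "sgn y \<in> Z" using zy by (simp add: Z inner_sgn)
  then have "0 \<le> c \<bullet> sgn y" using c(1) by (auto simp: dual_cone_def)
  then show False using cy \<open>y \<noteq> 0\<close> by (simp add: inner_sgn zero_le_divide_iff)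
qed

text \<open>
  After the cut the diameter of the dual cone is larger, so one of the functionals of a new
  farthest pair is not nonnegative on all of \<open>C\<close>. The foot of the pair on the corresponding great
  circle therefore lies on the cut.
\<close>

lemma reduced_cut_pair:
  assumes R: "reduced C" and far: "farthest_pair C \<kappa> c0 d0" and \<kappa>: "-1 < \<kappa>" "\<kappa> < 1"
    and x: "x \<in> sinterior C" "0 < z \<bullet> x" and v: "v \<in> C" "z \<bullet> v < 0"
  obtains c d r where "\<kappa> < r" "r < 1" "norm c = 1" "norm d = 1" "c \<bullet> d = - r"
    "c \<in> dual_cone (C \<inter> {x. 0 \<le> z \<bullet> x})" "d \<in> dual_cone (C \<inter> {x. 0 \<le> z \<bullet> x})"
    "(1 / sqrt (1 - r\<^sup>2)) *\<^sub>R (d + r *\<^sub>R c) \<in> C" "z \<bullet> (d + r *\<^sub>R c) = 0"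
proof -
  define Z where "Z = C \<inter> {x. 0 \<le> z \<bullet> x}"
  have C: "sconvex_body C" using R by (simp add: reduced_def)
  have Z: "sconvex_body Z" unfolding Z_def by (rule spherical_cut_body[OF C x])
  have "v \<notin> Z" using v by (simp add: Z_def)
  then have sub: "Z \<subseteq> C" "Z \<noteq> C" using v(1) unfolding Z_def by blast+
  obtain r a b where r: "farthest_pair Z r a b" "-1 < r" "r < 1"
    using farthest_pair_exists[OF Z] by blast
  have "thickness Z < thickness C" using R Z sub by (auto simp: reduced_def)
  then have "arccos r < arccos \<kappa>"
    using thickness_eq[OF Z r] thickness_eq[OF C far \<kappa>] by simp
  then have "\<kappa> < r" using arccos_less_mono[of \<kappa> r] arccos_less_mono[of r \<kappa>] r \<kappa> by (simp add: abs_le_iff)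
  have "a \<notin> dual_cone C \<or> b \<notin> dual_cone C"
  proof (rule ccontr)
    assume "\<not> ?thesis"
    then have "- \<kappa> * (norm a * norm b) \<le> a \<bullet> b" using far by (auto simp: farthest_pair_def)
    then show False using r(1) \<open>\<kappa> < r\<close> by (simp add: farthest_pair_def)
  qed
  then obtain c d where cd: "farthest_pair Z r c d" "c \<notin> dual_cone C"
    using r(1) farthest_pair_commute by blast
  define t where "t = (1 / sqrt (1 - r\<^sup>2)) *\<^sub>R (d + r *\<^sub>R c)"
  have t: "t \<in> Z" "c \<bullet> t = 0" unfolding t_def using farthest_pair_foot[OF Z cd(1) r(2,3)] by auto
  have cdD: "c \<in> dual_cone Z" "d \<in> dual_cone Z" "norm c = 1" "norm d = 1" "c \<bullet> d = - r"
    using cd(1) by (auto simp: farthest_pair_def)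
  have "z \<bullet> t = 0" using cut_pair_touches_cut[OF C Z_def cdD(1) cd(2) t] .
  moreover have "r\<^sup>2 < 1" using r by (simp add: abs_square_less_1 abs_less_iff)
  ultimately have "z \<bullet> (d + r *\<^sub>R c) = 0" by (simp add: t_def)
  then show ?thesis using that \<open>\<kappa> < r\<close> r(3) cdD t sub unfolding Z_def t_def by blast
qed

text \<open>
  The functional \<open>h\<close> exposes the point \<open>v\<close>. The cuts \<open>z k \<bullet> x \<ge> 0\<close> remove \<open>v\<close>, and \<open>z k\<close> tends to
  \<open>h\<close>. In the limit the farthest pairs of the cut bodies yield a farthest pair of \<open>C\<close>, and their
  feet on the cuts tend to a point of \<open>C\<close> where \<open>h\<close> vanishes, which can only be \<open>v\<close>.
\<close>

lemma reduced_vertex_chord: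
  assumes R: "reduced C" and far: "farthest_pair C \<kappa> c0 d0" and \<kappa>: "-1 < \<kappa>" "\<kappa> < 1"
    and v: "v \<in> C" and h: "h \<bullet> v = 0" "\<And>x. x \<in> C \<Longrightarrow> x \<noteq> v \<Longrightarrow> 0 < h \<bullet> x"
  obtains c d where "farthest_pair C \<kappa> c d" "sqrt (1 - \<kappa>\<^sup>2) *\<^sub>R v = d + \<kappa> *\<^sub>R c"
proof -
  have C: "sconvex_body C" using R by (simp add: reduced_def)
  note D = sconvex_bodyD[OF C]
  obtain o' where o: "o' \<in> sinterior C" using D(8) by blast
  have vv: "v \<bullet> v = 1" using D(5)[OF v] by (simp add: norm_eq_1)
  have hD: "h \<in> dual_cone C" using h by (force simp: dual_cone_def)
  have "\<exists>x\<in>C. x \<noteq> v"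
  proof (rule ccontr)
    assume "\<not> ?thesis"
    then have "C = {v}" using v by blast
    obtain y where y: "y \<noteq> 0" "orthogonal v y" using orthogonal_to_vector_exists[of v] by auto
    then have "y \<in> dual_cone C" "o' = v"
      using \<open>C = {v}\<close> o interior_of_subset[of "top_of_set S2" C]
      by (auto simp: dual_cone_def orthogonal_def inner_commute)
    then show False using sinterior_dual_pos[OF o, of y] y by (auto simp: orthogonal_def inner_commute)
  qed
  then have "h \<noteq> 0" using h(2) by auto
  then have ho: "0 < h \<bullet> o'" using sinterior_dual_pos[OF o hD] by simp
  \<comment> \<open>the multiple of \<open>v\<close> is small enough to keep the interior point \<open>o'\<close> on the positive side\<close>
  define z where "z k = h - (h \<bullet> o' / (real k + 2)) *\<^sub>R v" for k :: nat
  have zlim: "z \<longlonglongrightarrow> h"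
  proof -
    have "(\<lambda>k. h \<bullet> o' / (real k + 2)) \<longlonglongrightarrow> 0"
      using LIMSEQ_ignore_initial_segment[OF lim_const_over_n[of "h \<bullet> o'"], of 2]
      by (simp add: add.commute)
    then have "(\<lambda>k. h - (h \<bullet> o' / (real k + 2)) *\<^sub>R v) \<longlonglongrightarrow> h - 0 *\<^sub>R v" by (intro tendsto_intros)
    then show ?thesis unfolding z_def[abs_def] by simp
  qed
  have zv: "z k \<bullet> v < 0" for k using ho h vv by (simp add: z_def inner_diff_left)
  have zo: "0 < z k \<bullet> o'" for k
  proof -
    have o1: "norm o' = 1" using o D(5) interior_of_subset by fast
    have "(h \<bullet> o' / (real k + 2)) * (v \<bullet> o') \<le> (h \<bullet> o' / (real k + 2)) * 1"
      using ho unit_inner_bounds[OF D(5)[OF v] o1] by (intro mult_left_mono) auto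
    also have "\<dots> < h \<bullet> o'" using ho by (simp add: divide_less_eq)
    finally show ?thesis by (simp add: z_def inner_diff_left)
  qed
  have "\<exists>c d r. \<kappa> < r \<and> r < 1 \<and> norm c = 1 \<and> norm d = 1 \<and> c \<bullet> d = - r \<and>
    c \<in> dual_cone (C \<inter> {x. 0 \<le> z k \<bullet> x}) \<and> d \<in> dual_cone (C \<inter> {x. 0 \<le> z k \<bullet> x}) \<and>
    (1 / sqrt (1 - r\<^sup>2)) *\<^sub>R (d + r *\<^sub>R c) \<in> C \<and> z k \<bullet> (d + r *\<^sub>R c) = 0" for k
    using reduced_cut_pair[OF R far \<kappa> o zo v zv] by metis
  then obtain c d r where k: "\<And>k. \<kappa> < r k" "\<And>k. r k < 1" "\<And>k. norm (c k) = 1" "\<And>k. norm (d k) = 1"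
    "\<And>k. c k \<bullet> d k = - r k"
    "\<And>k. c k \<in> dual_cone (C \<inter> {x. 0 \<le> z k \<bullet> x})" "\<And>k. d k \<in> dual_cone (C \<inter> {x. 0 \<le> z k \<bullet> x})"
    "\<And>k. (1 / sqrt (1 - (r k)\<^sup>2)) *\<^sub>R (d k + r k *\<^sub>R c k) \<in> C" "\<And>k. z k \<bullet> (d k + r k *\<^sub>R c k) = 0"
    by metis
  have "compact (S2 \<times> S2)" by (intro compact_Times compact_sphere)
  moreover have "\<And>k. (c k, d k) \<in> S2 \<times> S2" using k by simp
  ultimately obtain l \<phi> where l: "l \<in> S2 \<times> S2" "strict_mono (\<phi> :: nat \<Rightarrow> nat)"
     "((\<lambda>k. (c k, d k)) \<circ> \<phi>) \<longlonglongrightarrow> l"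
    using seq_compactE[OF compact_imp_seq_compact, of "S2 \<times> S2" "\<lambda>k. (c k, d k)"] by blast
  obtain c' d' where l': "l = (c', d')" by force
  have clim: "(\<lambda>k. c (\<phi> k)) \<longlonglongrightarrow> c'" and dlim: "(\<lambda>k. d (\<phi> k)) \<longlonglongrightarrow> d'"
    using tendsto_fst[OF l(3)] tendsto_snd[OF l(3)] by (simp_all add: l' o_def)
  have zlim': "(\<lambda>k. z (\<phi> k)) \<longlonglongrightarrow> h" using LIMSEQ_subseq_LIMSEQ[OF zlim l(2)] by (simp add: o_def)
  \<comment> \<open>a point other than \<open>v\<close> survives all but finitely many cuts; \<open>v\<close> itself is a limit of such points\<close>
  have dual_lim: "a' \<in> dual_cone C"
    if a: "(\<lambda>k. a k) \<longlonglongrightarrow> a'" "\<And>k. a k \<in> dual_cone (C \<inter> {x. 0 \<le> z (\<phi> k) \<bullet> x})" for a a'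
  proof -
    have off: "0 \<le> a' \<bullet> x" if x: "x \<in> C" "x \<noteq> v" for x
    proof -
      have "(\<lambda>k. z (\<phi> k) \<bullet> x) \<longlonglongrightarrow> h \<bullet> x" using zlim' by (intro tendsto_intros)
      then have "eventually (\<lambda>k. 0 < z (\<phi> k) \<bullet> x) sequentially"
        using h(2)[OF x] by (rule order_tendstoD(1))
      then have "eventually (\<lambda>k. 0 \<le> a k \<bullet> x) sequentially"
        by eventually_elim (use a(2) x in \<open>auto simp: dual_cone_def\<close>)
      moreover have "(\<lambda>k. a k \<bullet> x) \<longlonglongrightarrow> a' \<bullet> x" using a(1) by (intro tendsto_intros)
      ultimately show ?thesis by (intro tendsto_lowerbound[where F = sequentially]) auto
    qed
    have "0 \<le> a' \<bullet> v"
    proof -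
      have oC: "o' \<in> C" using o interior_of_subset by fast
      have "0 \<le> a' \<bullet> v + e * (a' \<bullet> o')" if "0 < e" for e
      proof -
        define y where "y = 1 *\<^sub>R v + e *\<^sub>R o'"
        have "h \<bullet> y = e * (h \<bullet> o')" by (simp add: y_def inner_add_right h)
        then have hy: "0 < h \<bullet> y" using that ho by simp
        then have "y \<noteq> 0" by auto
        then have "sgn y \<in> C" unfolding y_def
          by (intro sconvex_combine D(9) v oC) (use that in auto)
        moreover have "sgn y \<noteq> v" using hy \<open>y \<noteq> 0\<close> h(1) by (auto simp: inner_sgn)
        ultimately have "0 \<le> a' \<bullet> sgn y" by (rule off)
        then have "0 \<le> a' \<bullet> y" using \<open>y \<noteq> 0\<close> by (simp add: inner_sgn zero_le_divide_iff)
        then show ?thesis by (simp add: y_def inner_add_right)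
      qed
      moreover have "((\<lambda>e. a' \<bullet> v + e * (a' \<bullet> o')) \<longlongrightarrow> a' \<bullet> v + 0 * (a' \<bullet> o')) (at_right 0)"
        by (intro tendsto_intros)
      ultimately have "0 \<le> a' \<bullet> v + 0 * (a' \<bullet> o')"
        by (intro tendsto_lowerbound[where F = "at_right (0::real)"])
          (auto intro!: eventually_mono[OF eventually_at_right_less])
      then show ?thesis by simp
    qed
    then show ?thesis using off by (auto simp: dual_cone_def)
  qed
  have cD: "c' \<in> dual_cone C" "d' \<in> dual_cone C"
    using dual_lim[OF clim] dual_lim[OF dlim] k(6,7) by auto
  have cd1: "norm c' = 1" "norm d' = 1" using l(1) l' by auto
  have rlim: "(\<lambda>k. r (\<phi> k)) \<longlonglongrightarrow> - (c' \<bullet> d')"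
  proof -
    have "(\<lambda>k. - (c (\<phi> k) \<bullet> d (\<phi> k))) \<longlonglongrightarrow> - (c' \<bullet> d')" using clim dlim by (intro tendsto_intros)
    then show ?thesis by (simp add: k(5))
  qed
  have "\<kappa> \<le> - (c' \<bullet> d')" using k(1) by (intro LIMSEQ_le_const[OF rlim]) (auto intro: less_imp_le)
  moreover have "- \<kappa> * (norm c' * norm d') \<le> c' \<bullet> d'" using far cD by (auto simp: farthest_pair_def)
  ultimately have cd': "c' \<bullet> d' = - \<kappa>" using cd1 by simp
  have far': "farthest_pair C \<kappa> c' d'" using far cD cd1 cd' by (auto simp: farthest_pair_def)
  have "(\<lambda>k. z (\<phi> k) \<bullet> (d (\<phi> k) + r (\<phi> k) *\<^sub>R c (\<phi> k))) \<longlonglongrightarrow> h \<bullet> (d' + (- (c' \<bullet> d')) *\<^sub>R c')"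
    using clim dlim rlim zlim' by (intro tendsto_intros)
  then have "h \<bullet> (d' + \<kappa> *\<^sub>R c') = 0" by (simp add: k(9) cd' LIMSEQ_const_iff)
  moreover define t where "t = (1 / sqrt (1 - \<kappa>\<^sup>2)) *\<^sub>R (d' + \<kappa> *\<^sub>R c')"
  ultimately have "h \<bullet> t = 0" by simp
  moreover have "t \<in> C" unfolding t_def by (rule farthest_pair_foot[OF C far' \<kappa>])
  ultimately have "t = v" using h(2)[of t] by force
  moreover have "\<kappa>\<^sup>2 < 1" using \<kappa> by (simp add: abs_square_less_1 abs_less_iff)
  ultimately have "sqrt (1 - \<kappa>\<^sup>2) *\<^sub>R v = d' + \<kappa> *\<^sub>R c'" by (auto simp: t_def)
  then show ?thesis using far' that by blast
qed

section \<open>Polygons with cyclically ordered vertices\<close>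

lemma periodic_int_mult:
  fixes f :: "int \<Rightarrow> 'a"
  assumes "\<And>j. f (j + n) = f j"
  shows "f (j + m * n) = f j"
proof -
  have per: "f (j + int m * n) = f j" for j m
  proof (induction m)
    case (Suc m)
    have "f (j + int (Suc m) * n) = f ((j + int m * n) + n)" by (simp add: algebra_simps)
    then show ?case using Suc assms by simp
  qed simp
  show ?thesis
  proof (cases "0 \<le> m")
    case True then show ?thesis using per[of j "nat m"] by simp
  next
    case False
    then show ?thesis using per[of "j + m * n" "nat (- m)"] by simp
  qed
qed

text \<open>
  The vertices of a convex polygon in cyclic order, as a function of period \<open>n\<close> on the integers.
  Convex position and orientation are expressed by the signs of the triple products. With integer
  indices, a cyclic interval is an ordinary interval of length less than \<open>n\<close>.
\<close>

locale cyclic_polygon =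
  fixes n :: int and v :: "int \<Rightarrow> real^3"
  assumes n3: "3 \<le> n"
    and v_period: "v (j + n) = v j"
    and v_unit: "norm (v j) = 1"
    and v_pos: "\<lbrakk>i < j; j < k; k < i + n\<rbrakk> \<Longrightarrow> 0 < triple (v i) (v j) (v k)"
begin

lemma v_period': "v (j - n) = v j"
  using v_period[of "j - n"] by simp

lemma v_nonneg: "\<lbrakk>i \<le> j; j \<le> k; k \<le> i + n\<rbrakk> \<Longrightarrow> 0 \<le> triple (v i) (v j) (v k)"
  using v_pos[of i j k] v_period[of i]
  by (metis order_le_less triple_same)

lemma v_window: "\<exists>m. i \<le> m \<and> m < i + n \<and> v j = v m"
proof -
  define m where "m = i + (j - i) mod n"
  have "m = j + (- ((j - i) div n)) * n"
    unfolding m_def by (simp add: minus_div_mult_eq_mod[symmetric])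
  then have "v j = v m" using periodic_int_mult[of v, OF v_period] by metis
  moreover have "i \<le> m" "m < i + n" using n3 by (auto simp: m_def)
  ultimately show ?thesis by blast
qed

lemma v_distinct: "\<lbrakk>i < j; j < i + n\<rbrakk> \<Longrightarrow> v i \<noteq> v j"
proof
  assume ij: "i < j" "j < i + n" and e: "v i = v j"
  show False
  proof (cases "j = i + 1")
    case True
    then show False using v_pos[of i j "j+1"] ij n3 e by simp
  next
    case False
    then show False using v_pos[of i "i+1" j] ij n3 e by simp
  qed
qed

lemma range_v: "range v = v ` {i..<i + n}"
  using v_window by force

lemma finite_range_v: "finite (range v)"
  by (subst range_v[of 0]) simp

text \<open>
  If \<open>v i\<close> and \<open>v j\<close> are not adjacent, then \<open>v (i + 1)\<close> and \<open>v (j + 1)\<close> lie strictly on different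
  sides of their plane, in which \<open>u\<close> vanishes.
\<close>

lemma zeros_adjacent:
  assumes "u \<noteq> 0" "\<And>j. 0 \<le> u \<bullet> v j" "i < j" "j < i + n" "u \<bullet> v i = 0" "u \<bullet> v j = 0"
  shows "j = i + 1 \<or> j = i + n - 1"
proof (rule ccontr)
  assume "\<not> ?thesis"
  then have ij: "i + 1 < j" "j + 1 < i + n" using assms by auto
  define T1 where "T1 = triple (v i) (v j) (v (i+1))"
  define T2 where "T2 = triple (v i) (v j) (v (j+1))"
  have T1: "T1 < 0" using v_pos[of i "i+1" j] triple_swap'[of "v i" "v j" "v (i+1)"] ij by (simp add: T1_def)
  have T2: "T2 > 0" using v_pos[of i j "j+1"] ij by (simp add: T2_def)
  have "(triple (v j) (v (i+1)) (v (j+1)) *\<^sub>R v i + T2 *\<^sub>R v (i+1)) \<bullet> u =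
        (triple (v i) (v (i+1)) (v (j+1)) *\<^sub>R v j + T1 *\<^sub>R v (j+1)) \<bullet> u"
    unfolding T1_def T2_def by (simp only: triple_dependency)
  then have "T2 * (u \<bullet> v (i+1)) = T1 * (u \<bullet> v (j+1))"
    using assms by (simp add: inner_add_left inner_add_right inner_commute)
  then have "T2 * (u \<bullet> v (i+1)) \<le> 0"
    using T1 assms(2)[of "j+1"] by (simp add: mult_nonpos_nonneg)
  then have "u \<bullet> v (i+1) = 0" using T2 assms(2)[of "i+1"] by (simp add: mult_le_0_iff)
  then have "T1 *\<^sub>R u = 0" unfolding T1_def using assms by (subst cramer_inner) simp
  then show False using T1 assms(1) by simp
qed

lemma zeros_at_most_two:
  assumes "u \<noteq> 0" "i < j" "j < k" "k < i + n" "u \<bullet> v i = 0" "u \<bullet> v j = 0"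
  shows "u \<bullet> v k \<noteq> 0"
proof
  assume "u \<bullet> v k = 0"
  then have "triple (v i) (v j) (v k) *\<^sub>R u = 0" using assms by (subst cramer_inner) simp
  then show False using v_pos[of i j k] assms by simp
qed

lemma pos_off_side:
  assumes "u \<noteq> 0" "\<And>j. 0 \<le> u \<bullet> v j" "u \<bullet> v i = 0" "u \<bullet> v (i+1) = 0" "v j \<noteq> v i" "v j \<noteq> v (i+1)"
  shows "0 < u \<bullet> v j"
proof -
  obtain m where m: "i \<le> m" "m < i + n" "v j = v m" using v_window by blast
  then have "i + 1 < m" using assms by (smt (verit) )
  then have "u \<bullet> v m \<noteq> 0" using zeros_at_most_two[of u i "i+1" m] m assms by auto
  then show ?thesis using assms(2)[of m] m by simp
qed

end

definition nonneg_combs :: "(real^3) set \<Rightarrow> (real^3) set" where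
  "nonneg_combs E = {z. \<exists>f. (\<forall>x\<in>E. 0 \<le> f x) \<and> z = (\<Sum>x\<in>E. f x *\<^sub>R x)}"

lemma convex_cone_hull_finite:
  assumes "finite E" shows "convex_cone hull E = nonneg_combs E"
proof (rule hull_unique)
  show "E \<subseteq> nonneg_combs E"
  proof
    fix y assume "y \<in> E"
    then have "y = (\<Sum>x\<in>E. (if x = y then 1 else 0) *\<^sub>R x)"
      using assms by (simp add: if_distrib[of "\<lambda>r. r *\<^sub>R _"] cong: if_cong)
    then show "y \<in> nonneg_combs E" unfolding nonneg_combs_def
      by (intro CollectI exI[of _ "\<lambda>x. if x = y then 1 else 0"]) auto
  qed
  show "convex_cone (nonneg_combs E)"
    unfolding convex_cone_iff
  proof (intro conjI ballI allI impI)
    show "0 \<in> nonneg_combs E" by (auto simp: nonneg_combs_def intro!: exI[of _ "\<lambda>_. 0"])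
  next
    fix x y assume "x \<in> nonneg_combs E" "y \<in> nonneg_combs E"
    then obtain f g where "\<forall>x\<in>E. 0 \<le> f x" "x = (\<Sum>x\<in>E. f x *\<^sub>R x)" "\<forall>x\<in>E. 0 \<le> g x" "y = (\<Sum>x\<in>E. g x *\<^sub>R x)"
      by (auto simp: nonneg_combs_def)
    then show "x + y \<in> nonneg_combs E" unfolding nonneg_combs_def
      by (intro CollectI exI[of _ "\<lambda>x. f x + g x"]) (auto simp: scaleR_add_left sum.distrib)
  next
    fix x and r :: real assume "x \<in> nonneg_combs E" "0 \<le> r"
    then obtain f where "\<forall>x\<in>E. 0 \<le> f x" "x = (\<Sum>x\<in>E. f x *\<^sub>R x)"
      by (auto simp: nonneg_combs_def)
    then show "r *\<^sub>R x \<in> nonneg_combs E" using \<open>0 \<le> r\<close> unfolding nonneg_combs_def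
      by (intro CollectI exI[of _ "\<lambda>x. r * f x"]) (auto simp: scaleR_sum_right)
  qed
next
  fix T assume T: "E \<subseteq> T" "convex_cone T"
  show "nonneg_combs E \<subseteq> T"
  proof
    fix z assume "z \<in> nonneg_combs E"
    then obtain f where f: "\<forall>x\<in>E. 0 \<le> f x" "z = (\<Sum>x\<in>E. f x *\<^sub>R x)" by (auto simp: nonneg_combs_def)
    have "(\<Sum>x\<in>F. f x *\<^sub>R x) \<in> T" if "F \<subseteq> E" for F
      using finite_subset[OF that assms] that
    proof (induction F)
      case empty
      then show ?case using T(2) convex_cone_contains_0 by simp
    next
      case (insert x F)
      then show ?case using T f by (auto intro!: convex_cone_add convex_cone_scaleR)
    qed
    then show "z \<in> T" using f by simp
  qed
qed

text \<open>
  Points of the cone are reached from the generators by adding one generator at a time, and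
  normalizing after each step keeps them in every convex set that contains the generators.
\<close>

lemma sconvex_hull_finite:
  assumes fin: "finite B" and h: "\<And>x. x \<in> B \<Longrightarrow> 0 < h \<bullet> x" and unit: "B \<subseteq> S2"
  shows "sconvex hull B = S2 \<inter> convex_cone hull B"
proof (rule hull_unique)
  show "B \<subseteq> S2 \<inter> convex_cone hull B" using unit hull_subset[of B convex_cone] by blast
  have hz: "0 < h \<bullet> z" if z: "z \<in> convex_cone hull B" "z \<noteq> 0" for z
  proof -
    obtain f where f: "\<forall>x\<in>B. 0 \<le> f x" "z = (\<Sum>x\<in>B. f x *\<^sub>R x)"
      using z by (auto simp: convex_cone_hull_finite[OF fin] nonneg_combs_def)
    obtain x where x: "x \<in> B" "f x \<noteq> 0" using z(2) f(2) by (metis (mono_tags, lifting) scaleR_eq_0_iff sum.neutral)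
    have "0 < (\<Sum>x\<in>B. f x * (h \<bullet> x))"
      using f(1) h x by (intro sum_pos2[OF fin x(1)]) (auto simp: less_le intro!: mult_nonneg_nonneg)
    then show ?thesis by (simp add: f(2) inner_sum_right)
  qed
  show "sconvex (S2 \<inter> convex_cone hull B)"
    unfolding sconvex_def
  proof (intro conjI ballI)
    fix a assume a: "a \<in> S2 \<inter> convex_cone hull B"
    then have "a \<noteq> 0" by auto
    then have "0 < h \<bullet> a" using a hz by blast
    then show "- a \<notin> S2 \<inter> convex_cone hull B" using hz[of "- a"] \<open>a \<noteq> 0\<close> by auto
    fix b assume b: "b \<in> S2 \<inter> convex_cone hull B"
    have "u *\<^sub>R a + w *\<^sub>R b \<in> convex_cone hull B" if "0 \<le> u" "0 \<le> w" for u w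
      using a b that by (intro convex_cone_add convex_cone_scaleR convex_cone_convex_cone_hull) auto
    then show "sarc a b \<subseteq> S2 \<inter> convex_cone hull B" by (auto simp: sarc_def)
  qed simp
next
  fix T assume T: "B \<subseteq> T" "sconvex T"
  show "S2 \<inter> convex_cone hull B \<subseteq> T"
  proof
    fix z assume z: "z \<in> S2 \<inter> convex_cone hull B"
    then obtain f where f: "\<forall>x\<in>B. 0 \<le> f x" "z = (\<Sum>x\<in>B. f x *\<^sub>R x)"
      by (auto simp: convex_cone_hull_finite[OF fin] nonneg_combs_def)
    have "(\<Sum>x\<in>F. f x *\<^sub>R x) \<noteq> 0 \<Longrightarrow> sgn (\<Sum>x\<in>F. f x *\<^sub>R x) \<in> T" if "F \<subseteq> B" for F
      using finite_subset[OF that fin] that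
    proof (induction F)
      case (insert x F)
      define y where "y = (\<Sum>x\<in>F. f x *\<^sub>R x)"
      have x: "x \<in> T" "0 \<le> f x" "norm x = 1" using insert T f unit by auto
      have s: "(\<Sum>x\<in>insert x F. f x *\<^sub>R x) = f x *\<^sub>R x + y" using insert by (simp add: y_def)
      show ?case
      proof (cases "y = 0")
        case True
        then have "0 < f x" using insert.prems x(2) unfolding s by (auto simp: less_le)
        then show ?thesis using True x unfolding s by (simp add: sgn_scaleR sgn_div_norm)
      next
        case False
        then have "sgn y \<in> T" using insert unfolding y_def by auto
        moreover have "y = norm y *\<^sub>R sgn y" using False by (simp add: sgn_div_norm)
        ultimately show ?thesis
          using sconvex_combine[OF T(2) x(1) _ x(2), of "sgn y" "norm y"] insert.prems unfolding s by simp
      qed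
    qed simp
    from this[of B] have "z \<noteq> 0 \<Longrightarrow> sgn z \<in> T" using f by simp
    moreover have "norm z = 1" "z \<noteq> 0" using z by auto
    ultimately show "z \<in> T" by (simp add: sgn_div_norm)
  qed
qed

text \<open>
  The vertices are a minimal set of generators. A generator \<open>v\<close> is not in the cone of the other
  ones. To separate it strictly, the generators are scaled into the affine plane \<open>h \<bullet> x = 1\<close>,
  where the other ones span a compact convex set. Adding a multiple of \<open>h\<close> to the separating
  functional makes it vanish at \<open>v\<close>.
\<close>

lemma spolygon_vertices:
  assumes V: "spolygon V"
  obtains E h where "finite E" "E \<subseteq> V" "V = S2 \<inter> nonneg_combs E" "\<And>x. x \<in> E \<Longrightarrow> 0 < h \<bullet> x"
    "\<And>v. v \<in> E \<Longrightarrow> \<exists>u. u \<bullet> v = 0 \<and> (\<forall>x\<in>E - {v}. 0 < u \<bullet> x)"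
proof -
  obtain A h where A: "finite A" "h \<in> S2" "A \<subseteq> open_hemisphere h" "V = sconvex hull A"
    using V by (auto simp: spolygon_def)
  have unit: "A \<subseteq> S2" using A(3) by (auto simp: open_hemisphere_def)
  have h: "0 < h \<bullet> x" if "x \<in> A" for x
  proof -
    have "arccos (h \<bullet> x) < pi / 2" "norm x = 1" using A(3) that by (auto simp: open_hemisphere_def sdist_def)
    then show ?thesis
      using unit_inner_bounds[of h x] A(2) arccos_less_mono[of "h \<bullet> x" 0] by (simp add: abs_le_iff)
  qed
  have VA: "V = S2 \<inter> convex_cone hull A" using sconvex_hull_finite[OF A(1) h unit] A(4) by simp
  define P where "P E \<longleftrightarrow> E \<subseteq> A \<and> V = S2 \<inter> convex_cone hull E" for E
  have "P A" using VA by (simp add: P_def)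
  then obtain E where E: "P E" "\<And>F. P F \<Longrightarrow> card E \<le> card F"
    using ex_has_least_nat[of P A card] by blast
  have fin: "finite E" using E(1) A(1) finite_subset by (auto simp: P_def)
  have hE: "0 < h \<bullet> x" if "x \<in> E" for x using that E(1) h by (auto simp: P_def)
  have "E \<subseteq> V" using E(1) unit hull_subset[of E convex_cone] unfolding P_def by blast
  have irred: "v \<notin> convex_cone hull (E - {v})" if v: "v \<in> E" for v
  proof
    assume "v \<in> convex_cone hull (E - {v})"
    then have "convex_cone hull (insert v (E - {v})) = convex_cone hull (E - {v})" by (rule hull_redundant)
    then have "P (E - {v})" using E(1) v by (auto simp: P_def insert_absorb)
    then have "card E \<le> card (E - {v})" by (rule E(2))
    then show False using card_Diff1_less[OF fin v] by simp
  qed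
  have expo: "\<exists>u. u \<bullet> v = 0 \<and> (\<forall>x\<in>E - {v}. 0 < u \<bullet> x)" if v: "v \<in> E" for v
  proof -
    define g where "g x = (1 / (h \<bullet> x)) *\<^sub>R x" for x
    define K where "K = convex hull (g ` (E - {v}))"
    have "K \<subseteq> convex_cone hull (E - {v})" unfolding K_def
    proof (rule hull_minimal)
      show "g ` (E - {v}) \<subseteq> convex_cone hull (E - {v})"
        using hE hull_subset[of "E - {v}" convex_cone] convex_cone_convex_cone_hull
        by (auto simp: g_def less_imp_le intro!: convex_cone_scaleR)
      show "convex (convex_cone hull (E - {v}))"
        by (rule convex_convex_cone_hull)
    qed
    moreover have "g v \<notin> convex_cone hull (E - {v})"
    proof
      assume "g v \<in> convex_cone hull (E - {v})"
      then have "(h \<bullet> v) *\<^sub>R g v \<in> convex_cone hull (E - {v})"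
        using hE[OF v] by (intro convex_cone_scaleR convex_cone_convex_cone_hull) auto
      then show False using irred[OF v] hE[OF v] by (simp add: g_def)
    qed
    ultimately have "g v \<notin> K" by blast
    moreover have "compact K" "convex K"
      unfolding K_def using fin by (auto intro!: finite_imp_compact_convex_hull)
    ultimately obtain a b where ab: "a \<bullet> g v < b" "\<And>x. x \<in> K \<Longrightarrow> b < a \<bullet> x"
      using separating_hyperplane_closed_point[of K "g v"] compact_imp_closed by blast
    define a' where "a' = a - b *\<^sub>R h"
    have a'g: "a' \<bullet> x = (h \<bullet> x) * (a \<bullet> g x - b)" if "x \<in> E" for x
      using hE[OF that] by (simp add: a'_def g_def inner_diff_left algebra_simps)
    have "a' \<bullet> v < 0" using a'g[OF v] ab(1) hE[OF v] by (simp add: mult_pos_neg)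
    have a'x: "0 < a' \<bullet> x" if "x \<in> E - {v}" for x
    proof -
      have "g x \<in> K" using that unfolding K_def by (intro hull_inc) auto
      then show ?thesis using a'g[of x] ab(2)[of "g x"] hE[of x] that by simp
    qed
    \<comment> \<open>the multiple of \<open>h\<close> that cancels the value at \<open>v\<close>\<close>
    define r where "r = - (a' \<bullet> v) / (h \<bullet> v)"
    have r: "0 < r" unfolding r_def using \<open>a' \<bullet> v < 0\<close> hE[OF v] by (simp add: divide_neg_pos)
    have "(a' + r *\<^sub>R h) \<bullet> v = 0" using hE[OF v] by (simp add: r_def inner_add_left inner_diff_left)
    moreover have "0 < (a' + r *\<^sub>R h) \<bullet> x" if "x \<in> E - {v}" for x
      using a'x[OF that] r hE[of x] that by (simp add: inner_add_left add_pos_pos)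
    ultimately show ?thesis by blast
  qed
  have "V = S2 \<inter> nonneg_combs E" using E(1) convex_cone_hull_finite[OF fin] by (simp add: P_def)
  then show ?thesis using that fin \<open>E \<subseteq> V\<close> hE expo by blast
qed

text \<open>
  No three vertices are in a plane through the origin, since each of them is exposed. Seen from a
  fixed vertex \<open>v0\<close> the others lie in an open half plane, so they are linearly ordered by their
  slope \<open>key\<close> there. The remaining triple products are positive because the middle one of three
  vertices is exposed.
\<close>

lemma cyclic_labelling:
  fixes E :: "(real^3) set"
  assumes fin: "finite E" and unit: "\<And>x. x \<in> E \<Longrightarrow> norm x = 1" and h: "\<And>x. x \<in> E \<Longrightarrow> 0 < h \<bullet> x"
    and expo: "\<And>v. v \<in> E \<Longrightarrow> \<exists>u. u \<bullet> v = 0 \<and> (\<forall>x\<in>E - {v}. 0 < u \<bullet> x)"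
    and card: "3 \<le> card E"
  obtains v where "cyclic_polygon (int (card E)) v" "range v = E"
proof -
  obtain u where u: "\<And>v. v \<in> E \<Longrightarrow> u v \<bullet> v = 0" "\<And>v x. v \<in> E \<Longrightarrow> x \<in> E \<Longrightarrow> x \<noteq> v \<Longrightarrow> 0 < u v \<bullet> x"
    using expo by (metis DiffI singletonD)
  have indep: "triple a b c \<noteq> 0" if E: "a \<in> E" "b \<in> E" "c \<in> E" and ne: "a \<noteq> b" "b \<noteq> c" "a \<noteq> c" for a b c
  proof
    assume 0: "triple a b c = 0"
    define x where "x = cross3 a b"
    define p q r where "p = triple b c x" and "q = triple a b x" and "r = triple a c x"
    have eq: "p *\<^sub>R a + q *\<^sub>R c = r *\<^sub>R b"
      using triple_dependency[of b c x a] 0 by (simp add: p_def q_def r_def)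
    have dot: "p * (w \<bullet> a) + q * (w \<bullet> c) = r * (w \<bullet> b)" for w
      using arg_cong[OF eq, of "inner w"] by (simp add: inner_add_right)
    have 1: "q * (u a \<bullet> c) = r * (u a \<bullet> b)" using dot[of "u a"] u(1)[OF E(1)] by simp
    have 2: "p * (u c \<bullet> a) = r * (u c \<bullet> b)" using dot[of "u c"] u(1)[OF E(3)] by simp
    have 3: "p * (u b \<bullet> a) + q * (u b \<bullet> c) = 0" using dot[of "u b"] u(1)[OF E(2)] by simp
    have pos: "0 < u a \<bullet> c" "0 < u a \<bullet> b" "0 < u c \<bullet> a" "0 < u c \<bullet> b" "0 < u b \<bullet> a" "0 < u b \<bullet> c"
      using u(2) E ne by auto
    have "q = 0"
    proof (rule ccontr)
      assume "q \<noteq> 0"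
      then consider "0 < q" | "q < 0" by linarith
      then show False
      proof cases
        case 1
        then have "0 < r * (u a \<bullet> b)" using \<open>q * (u a \<bullet> c) = r * (u a \<bullet> b)\<close> pos by (metis mult_pos_pos)
        then have "0 < r" using pos by (simp add: zero_less_mult_iff)
        then have "0 < p * (u c \<bullet> a)" using 2 pos by simp
        then have "0 < p" using pos by (simp add: zero_less_mult_iff)
        then show False using 3 1 pos by (smt (verit) mult_pos_pos)
      next
        case 2
        then have "r * (u a \<bullet> b) < 0" using 1 pos by (metis mult_neg_pos)
        then have "r < 0" using pos by (simp add: mult_less_0_iff)
        then have "p * (u c \<bullet> a) < 0" using \<open>p * (u c \<bullet> a) = r * (u c \<bullet> b)\<close> pos by (simp add: mult_neg_pos)
        then have "p < 0" using pos by (simp add: mult_less_0_iff)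
        then show False using 3 2 pos by (smt (verit) mult_neg_pos)
      qed
    qed
    moreover have "triple a b x = x \<bullet> x"
      using triple_rotate[of x a b] triple_def[of x a b, folded x_def] by simp
    ultimately have "x \<bullet> x = 0" by (simp add: q_def)
    then have "x = 0" by simp
    then have "(a \<bullet> b)\<^sup>2 = 1" using norm_cross_dot[of a b] unit E by (simp add: x_def)
    then have "a \<bullet> b = 1 \<or> a \<bullet> - b = 1" by (simp add: power2_eq_1_iff)
    then have "a = - b" using unit_inner_eq_1[of a b] unit_inner_eq_1[of a "- b"] unit E ne by auto
    then show False using h[OF E(1)] h[OF E(2)] by simp
  qed
  obtain v0 where v0: "v0 \<in> E" using card by fastforce
  \<comment> \<open>\<open>u v0\<close> and \<open>q\<close> are coordinates of the plane orthogonal to \<open>v0\<close>\<close>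
  define q where "q = cross3 v0 (u v0)"
  define key where "key x = (x \<bullet> q) / (x \<bullet> u v0)" for x
  obtain w where w: "w \<in> E" "w \<noteq> v0"
  proof -
    have "\<not> E \<subseteq> {v0}" using card card_mono[of "{v0}" E] by auto
    then show ?thesis using that by blast
  qed
  have "0 < u v0 \<bullet> w" using u(2) v0 w by simp
  then have unz: "u v0 \<noteq> 0" by auto
  have qq: "0 < q \<bullet> q"
  proof -
    have "(norm q)\<^sup>2 = (norm (u v0))\<^sup>2"
      using norm_cross_dot[of v0 "u v0"] u(1)[OF v0] unit[OF v0] by (simp add: q_def inner_commute)
    then show ?thesis using unz by (auto simp: inner_gt_zero_iff)
  qed
  have key_iff: "0 < triple v0 a b \<longleftrightarrow> key a < key b" if ab: "a \<in> E" "b \<in> E" "a \<noteq> v0" "b \<noteq> v0" for a b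
  proof -
    have pos: "0 < a \<bullet> u v0" "0 < b \<bullet> u v0" using u(2) v0 ab by (simp_all add: inner_commute)
    have "triple v0 (u v0) q = q \<bullet> q"
      by (simp add: q_def triple_def cross3_simps)
    then have "triple v0 a b * (q \<bullet> q) = triple v0 a b * triple v0 (u v0) q" by simp
    also have "\<dots> = (a \<bullet> u v0) * (b \<bullet> q) - (a \<bullet> q) * (b \<bullet> u v0)"
      using u(1)[OF v0] unit[OF v0]
      by (simp add: triple_mult inner_commute[of v0 "u v0"] norm_eq_1) (simp add: q_def dot_cross_self)
    also have "\<dots> = (a \<bullet> u v0) * (b \<bullet> u v0) * (key b - key a)" using pos by (simp add: key_def field_simps)
    finally have "triple v0 a b * (q \<bullet> q) = (a \<bullet> u v0) * (b \<bullet> u v0) * (key b - key a)" .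
    moreover have "0 < triple v0 a b \<longleftrightarrow> 0 < triple v0 a b * (q \<bullet> q)"
      using qq by (metis zero_less_mult_pos2 mult_pos_pos)
    moreover have "0 < (a \<bullet> u v0) * (b \<bullet> u v0) * (key b - key a) \<longleftrightarrow> key a < key b"
      using mult_pos_pos[OF pos] by (metis diff_gt_0_iff_gt mult_pos_pos zero_less_mult_pos)
    ultimately show ?thesis by simp
  qed
  obtain xs where xs: "set xs = E - {v0}" "distinct xs" using fin finite_distinct_list[of "E - {v0}"] by auto
  define ys where "ys = sort_key key xs"
  have ys: "set ys = E - {v0}" "distinct ys" "sorted (map key ys)" by (simp_all add: ys_def xs)
  have len: "length ys = card E - 1"
    using distinct_card[OF ys(2)] ys(1) fin v0 by simp
  have tri0: "0 < triple v0 (ys ! i) (ys ! j)" if ij: "i < j" "j < length ys" for i j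
  proof -
    let ?a = "ys ! i" and ?b = "ys ! j"
    have m: "?a \<in> E" "?b \<in> E" "?a \<noteq> v0" "?b \<noteq> v0" using ys(1) ij nth_mem[of i ys] nth_mem[of j ys] by auto
    have "?a \<noteq> ?b" using ys(2) ij by (simp add: nth_eq_iff_index_eq)
    have "key ?a \<le> key ?b" using ys(3) ij sorted_nth_mono[of "map key ys" i j] by simp
    moreover have "\<not> 0 < triple v0 ?b ?a" using key_iff[of ?b ?a] m \<open>key ?a \<le> key ?b\<close> by simp
    then have "\<not> triple v0 ?a ?b < 0" using triple_swap'[of v0 ?b ?a] by simp
    ultimately show ?thesis using indep[OF v0 m(1,2)] m \<open>?a \<noteq> ?b\<close> by force
  qed
  define l where "l = v0 # ys"
  have l: "set l = E" "length l = card E" "distinct l" using ys len v0 card by (auto simp: l_def)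
  have tri: "0 < triple (l ! i) (l ! j) (l ! k)" if ijk: "i < j" "j < k" "k < length l" for i j k
  proof (cases i)
    case 0
    then show ?thesis using tri0[of "j - 1" "k - 1"] ijk by (simp add: l_def nth_Cons')
  next
    case (Suc i')
    obtain j' where j': "j = Suc j'" using ijk by (cases j) auto
    obtain k' where k': "k = Suc k'" using ijk by (cases k) auto
    note jk = j' k'
    let ?a = "l ! i" and ?b = "l ! j" and ?c = "l ! k"
    have pos: "0 < triple v0 ?a ?b" "0 < triple v0 ?b ?c"
      using tri0[of i' j'] tri0[of j' k'] ijk Suc jk by (simp_all add: l_def)
    have m: "?a \<in> E" "?b \<in> E" "?c \<in> E"
      using l(1) nth_mem[of i l] nth_mem[of j l] nth_mem[of k l] ijk by auto
    have ne: "?a \<noteq> ?b" "?c \<noteq> ?b" "v0 \<noteq> ?b"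
      using pos by auto
    have "u ?b \<bullet> (triple ?a ?b ?c *\<^sub>R v0 + triple v0 ?a ?c *\<^sub>R ?b)
        = u ?b \<bullet> (triple v0 ?b ?c *\<^sub>R ?a + triple v0 ?a ?b *\<^sub>R ?c)"
      by (simp only: triple_dependency)
    then have "triple ?a ?b ?c * (u ?b \<bullet> v0) = triple v0 ?b ?c * (u ?b \<bullet> ?a) + triple v0 ?a ?b * (u ?b \<bullet> ?c)"
      using u(1)[OF m(2)] by (simp add: inner_add_right)
    moreover have "0 < triple v0 ?b ?c * (u ?b \<bullet> ?a) + triple v0 ?a ?b * (u ?b \<bullet> ?c)"
      using pos u(2)[OF m(2)] m ne by (intro add_pos_pos mult_pos_pos) auto
    moreover have "0 < u ?b \<bullet> v0" using u(2)[OF m(2) v0] ne by auto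
    ultimately show ?thesis by (metis zero_less_mult_pos2)
  qed
  define n where "n = int (card E)"
  define v where "v j = l ! nat (j mod n)" for j
  have n: "3 \<le> n" "nat n = length l" using card l by (simp_all add: n_def)
  have vl: "v j = l ! nat j" if "0 \<le> j" "j < n" for j using that by (simp add: v_def)
  have vp: "v (j + n) = v j" for j by (simp add: v_def)
  have tri_int: "0 < triple (v a) (v b) (v c)" if "0 \<le> a" "a < b" "b < c" "c < n" for a b c
    using tri[of "nat a" "nat b" "nat c"] that n by (simp add: vl nat_less_iff)
  have "cyclic_polygon n v"
  proof
    show "3 \<le> n" by (rule n)
    show "v (j + n) = v j" for j by (rule vp)
    show "norm (v j) = 1" for j
    proof -
      have "nat (j mod n) < length l"
        using n(1) pos_mod_bound[of n j] pos_mod_sign[of n j] unfolding n(2)[symmetric] by linarith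
      then show ?thesis using unit l(1) nth_mem unfolding v_def by blast
    qed
    fix i j k :: int
    assume ijk: "i < j" "j < k" "k < i + n"
    define e where "e = i - i mod n"
    have ve: "v x = v (x - e)" for x
    proof -
      have "x - e = x + (- (i div n)) * n" by (simp add: e_def minus_mod_eq_mult_div)
      then show ?thesis unfolding v_def by (metis mod_mult_self1)
    qed
    have i0: "0 \<le> i - e" "i - e < n" using n by (simp_all add: e_def)
    consider "k - e < n" | "j - e < n" "n \<le> k - e" | "n \<le> j - e" by linarith
    then have "0 < triple (v (i - e)) (v (j - e)) (v (k - e))"
    proof cases
      case 1
      then show ?thesis using tri_int[of "i - e" "j - e" "k - e"] ijk i0 by simp
    next
      case 2
      have "0 < triple (v (k - e - n)) (v (i - e)) (v (j - e))"
        using tri_int[of "k - e - n" "i - e" "j - e"] ijk i0 2 by simp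
      then show ?thesis using vp[of "k - e - n"] by (simp add: triple_rotate[of "v (k - e - n)"])
    next
      case 3
      have "0 < triple (v (j - e - n)) (v (k - e - n)) (v (i - e))"
        using tri_int[of "j - e - n" "k - e - n" "i - e"] ijk i0 3 by simp
      then show ?thesis using vp[of "k - e - n"] vp[of "j - e - n"]
        by (simp add: triple_rotate[of "v (i - e)"])
    qed
    then show "0 < triple (v i) (v j) (v k)" using ve by metis
  qed
  moreover have "range v = E"
  proof
    show "range v \<subseteq> E"
    proof
      fix x assume "x \<in> range v"
      then obtain j where "x = l ! nat (j mod n)" by (auto simp: v_def)
      moreover have "nat (j mod n) < length l"
        using n(1) pos_mod_bound[of n j] pos_mod_sign[of n j] unfolding n(2)[symmetric] by linarith
      ultimately show "x \<in> E" using l(1) nth_mem by blast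
    qed
    show "E \<subseteq> range v"
    proof
      fix x assume "x \<in> E"
      then obtain i where "i < length l" "x = l ! i" using l(1) by (metis in_set_conv_nth)
      then have "x = v (int i)" using vl[of "int i"] n by simp
      then show "x \<in> range v" by blast
    qed
  qed
  ultimately show ?thesis using that n_def by blast
qed

section \<open>Chords across a polygon\<close>

lemma rotated_pair_nonneg:
  fixes X :: "'a::real_inner set"
  assumes fin: "finite X"
    and cpos: "\<And>x. x \<in> X \<Longrightarrow> 0 < c \<bullet> x \<or> c \<bullet> x = 0 \<and> 0 \<le> N \<bullet> x"
    and dpos: "\<And>x. x \<in> X \<Longrightarrow> 0 < d \<bullet> x \<or> d \<bullet> x = 0 \<and> N \<bullet> x \<le> 0"
  shows "\<exists>\<theta>>0. \<forall>x\<in>X. 0 \<le> (c + \<theta> *\<^sub>R N) \<bullet> x \<and> 0 \<le> (d - \<theta> *\<^sub>R N) \<bullet> x"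
proof -
  have *: "eventually (\<lambda>\<theta>. 0 \<le> a + \<theta> * b) (at_right 0)"
    if "0 < a \<or> a = 0 \<and> 0 \<le> b" for a b :: real
  proof (cases "0 < a")
    case True
    have "((\<lambda>\<theta>. a + \<theta> * b) \<longlongrightarrow> a + 0 * b) (at_right 0)" by (intro tendsto_intros)
    then have "eventually (\<lambda>\<theta>. 0 < a + \<theta> * b) (at_right 0)"
      using True by (intro order_tendstoD(1)[where y = "a + 0 * b"]) auto
    then show ?thesis by (rule eventually_mono) simp
  next
    case False
    then show ?thesis using that eventually_at_right_less[of 0] by (auto elim!: eventually_mono)
  qed
  have "eventually (\<lambda>\<theta>. \<forall>x\<in>X. 0 \<le> (c \<bullet> x) + \<theta> * (N \<bullet> x) \<and> 0 \<le> (d \<bullet> x) + \<theta> * (- (N \<bullet> x))) (at_right 0)"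
    using cpos dpos by (intro eventually_ball_finite fin ballI eventually_conj *) auto
  then have "eventually (\<lambda>\<theta>. 0 < \<theta> \<and> (\<forall>x\<in>X. 0 \<le> (c \<bullet> x) + \<theta> * (N \<bullet> x) \<and> 0 \<le> (d \<bullet> x) + \<theta> * (- (N \<bullet> x))))
      (at_right (0::real))"
    using eventually_at_right_less by (rule eventually_conj[rotated])
  from eventually_happens'[OF _ this] obtain \<theta> :: real where "0 < \<theta>"
     "\<forall>x\<in>X. 0 \<le> (c \<bullet> x) + \<theta> * (N \<bullet> x) \<and> 0 \<le> (d \<bullet> x) + \<theta> * (- (N \<bullet> x))"
    by auto
  then show ?thesis by (auto simp: inner_add_left inner_diff_left)
qed

text \<open>
  If \<open>c\<close> and \<open>d\<close> could be rotated in opposite directions orthogonal to their plane without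
  becoming negative on \<open>X\<close>, then a rotation by a small angle would increase their distance: the
  inner product changes from \<open>- \<kappa>\<close> to \<open>- \<kappa> - \<theta>\<^sup>2\<close>, while the product of the norms is only
  \<open>1 + \<theta>\<^sup>2\<close>, and \<open>\<kappa> < 1\<close>.
\<close>

lemma no_opposite_rotation:
  fixes X :: "'a::real_inner set"
  assumes fin: "finite X"
    and cpos: "\<And>x. x \<in> X \<Longrightarrow> 0 < c \<bullet> x \<or> c \<bullet> x = 0 \<and> 0 \<le> N \<bullet> x"
    and dpos: "\<And>x. x \<in> X \<Longrightarrow> 0 < d \<bullet> x \<or> d \<bullet> x = 0 \<and> N \<bullet> x \<le> 0"
    and cd: "norm c = 1" "norm d = 1" "c \<bullet> d = - \<kappa>" "\<kappa> < 1"
    and N: "norm N = 1" "N \<bullet> c = 0" "N \<bullet> d = 0"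
    and least: "\<And>c' d'. (\<And>x. x \<in> X \<Longrightarrow> 0 \<le> c' \<bullet> x) \<Longrightarrow> (\<And>x. x \<in> X \<Longrightarrow> 0 \<le> d' \<bullet> x)
                   \<Longrightarrow> - \<kappa> * (norm c' * norm d') \<le> c' \<bullet> d'"
  shows False
proof -
  obtain \<theta> where \<theta>: "0 < \<theta>" "\<forall>x\<in>X. 0 \<le> (c + \<theta> *\<^sub>R N) \<bullet> x \<and> 0 \<le> (d - \<theta> *\<^sub>R N) \<bullet> x"
    using rotated_pair_nonneg[OF fin cpos dpos] by metis
  have nn: "c \<bullet> c = 1" "d \<bullet> d = 1" "N \<bullet> N = 1" using cd N by (simp_all add: norm_eq_1)
  have "norm (c + \<theta> *\<^sub>R N) = sqrt (1 + \<theta>\<^sup>2)" "norm (d - \<theta> *\<^sub>R N) = sqrt (1 + \<theta>\<^sup>2)"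
    using N nn
    by (simp_all add: norm_eq_sqrt_inner inner_add inner_diff inner_commute power2_eq_square)
  then have "norm (c + \<theta> *\<^sub>R N) * norm (d - \<theta> *\<^sub>R N) = 1 + \<theta>\<^sup>2" by simp
  moreover have "(c + \<theta> *\<^sub>R N) \<bullet> (d - \<theta> *\<^sub>R N) = - \<kappa> - \<theta>\<^sup>2"
    using N nn cd by (simp add: inner_add inner_diff inner_commute power2_eq_square)
  ultimately have "- \<kappa> * (1 + \<theta>\<^sup>2) \<le> - \<kappa> - \<theta>\<^sup>2"
    using least[of "c + \<theta> *\<^sub>R N" "d - \<theta> *\<^sub>R N"] \<theta> by simp
  then have "(1 - \<kappa>) * \<theta>\<^sup>2 \<le> 0" by (simp add: algebra_simps)
  then show False using \<theta>(1) cd(4) by (simp add: mult_le_0_iff)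
qed

text \<open>
  Each vertex \<open>v i\<close> is the end of a chord with foot \<open>t i\<close>, given by a farthest pair \<open>c i\<close>, \<open>d i\<close> of
  the dual cone. The great circle with pole \<open>c i\<close> passes through \<open>v i\<close>, the one with pole \<open>d i\<close>
  through \<open>t i\<close>. The constants \<open>\<kappa>\<close> and \<open>s\<close> are the cosine and the sine of the length of the
  chords.
\<close>

locale chorded_polygon = cyclic_polygon +
  fixes \<kappa> s :: real and c d t :: "int \<Rightarrow> real^3"
  assumes \<kappa>: "0 < \<kappa>" "\<kappa> < 1" and s: "0 < s" "s\<^sup>2 = 1 - \<kappa>\<^sup>2"
    and per: "c (j + n) = c j" "d (j + n) = d j" "t (j + n) = t j"
    and c_unit: "norm (c i) = 1" and d_unit: "norm (d i) = 1" and cd: "c i \<bullet> d i = - \<kappa>"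
    and v_eq: "s *\<^sub>R v i = d i + \<kappa> *\<^sub>R c i" and t_eq: "s *\<^sub>R t i = c i + \<kappa> *\<^sub>R d i"
    and c_nonneg: "0 \<le> c i \<bullet> v j" and d_nonneg: "0 \<le> d i \<bullet> v j"
    and t_cone: "\<exists>f. (\<forall>x\<in>range v. 0 \<le> f x) \<and> t i = (\<Sum>x\<in>range v. f x *\<^sub>R x)"
    and least: "\<And>c' d'. (\<And>j. 0 \<le> c' \<bullet> v j) \<Longrightarrow> (\<And>j. 0 \<le> d' \<bullet> v j)
                   \<Longrightarrow> - \<kappa> * (norm c' * norm d') \<le> c' \<bullet> d'"
begin

lemma unit_sq: "v i \<bullet> v i = 1" "c i \<bullet> c i = 1" "d i \<bullet> d i = 1"
  using v_unit c_unit d_unit by (simp_all add: norm_eq_1)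

lemma c_v: "c i \<bullet> v i = 0"
proof -
  have "s * (c i \<bullet> v i) = c i \<bullet> (s *\<^sub>R v i)" by simp
  also have "\<dots> = 0" unfolding v_eq by (simp add: inner_add cd unit_sq)
  finally show ?thesis using s by simp
qed

lemma d_t: "d i \<bullet> t i = 0"
proof -
  have "s * (d i \<bullet> t i) = d i \<bullet> (s *\<^sub>R t i)" by simp
  also have "\<dots> = 0" unfolding t_eq by (simp add: inner_add cd unit_sq inner_commute[of "d i" "c i"])
  finally show ?thesis using s by simp
qed

lemma d_v: "d i \<bullet> v i = s"
proof -
  have "s * (d i \<bullet> v i) = d i \<bullet> (s *\<^sub>R v i)" by simp
  also have "\<dots> = s * s" unfolding v_eq
    using s by (simp add: inner_add cd unit_sq inner_commute[of "d i" "c i"] power2_eq_square)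
  finally show ?thesis using s by simp
qed

lemma c_t: "c i \<bullet> t i = s"
proof -
  have "s * (c i \<bullet> t i) = c i \<bullet> (s *\<^sub>R t i)" by simp
  also have "\<dots> = s * s" unfolding t_eq
    using s by (simp add: inner_add cd unit_sq power2_eq_square)
  finally show ?thesis using s by simp
qed

lemma t_via_c: "t i = \<kappa> *\<^sub>R v i + s *\<^sub>R c i"
proof -
  have "s *\<^sub>R t i = c i + \<kappa> *\<^sub>R (s *\<^sub>R v i - \<kappa> *\<^sub>R c i)" by (simp add: t_eq v_eq)
  also have "\<dots> = s *\<^sub>R (\<kappa> *\<^sub>R v i) + (1 - \<kappa>\<^sup>2) *\<^sub>R c i" by (simp add: algebra_simps power2_eq_square)
  also have "\<dots> = s *\<^sub>R (\<kappa> *\<^sub>R v i + s *\<^sub>R c i)"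
    unfolding s(2)[symmetric] by (simp add: algebra_simps power2_eq_square)
  finally show ?thesis using s(1) by (metis less_irrefl scaleR_cancel_left)
qed

lemma v_via_d: "v i = \<kappa> *\<^sub>R t i + s *\<^sub>R d i"
proof -
  have "s *\<^sub>R v i = d i + \<kappa> *\<^sub>R (s *\<^sub>R t i - \<kappa> *\<^sub>R d i)" by (simp add: t_eq v_eq)
  also have "\<dots> = s *\<^sub>R (\<kappa> *\<^sub>R t i) + (1 - \<kappa>\<^sup>2) *\<^sub>R d i" by (simp add: algebra_simps power2_eq_square)
  also have "\<dots> = s *\<^sub>R (\<kappa> *\<^sub>R t i + s *\<^sub>R d i)"
    unfolding s(2)[symmetric] by (simp add: algebra_simps power2_eq_square)
  finally show ?thesis using s(1) by (metis less_irrefl scaleR_cancel_left)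
qed

lemma d_via_v: "d i = s *\<^sub>R v i - \<kappa> *\<^sub>R c i"
  by (simp add: v_eq)

lemma c_via_t: "c i = s *\<^sub>R t i - \<kappa> *\<^sub>R d i"
  by (simp add: t_eq)

lemma t_v: "t i \<bullet> v i = \<kappa>"
  by (subst t_via_c) (simp add: inner_add_left unit_sq c_v)

lemma t_unit: "norm (t i) = 1"
proof -
  have "t i \<bullet> t i = \<kappa>\<^sup>2 + s\<^sup>2"
    by (subst (1 2) t_via_c)
      (simp add: inner_add unit_sq c_v inner_commute[of "v i" "c i"] power2_eq_square)
  then show ?thesis using s by (simp add: norm_eq_1)
qed

text \<open>
  On the polygon, the functional \<open>d i\<close> is at most \<open>s\<close>, and it attains this value only at \<open>v i\<close>.
\<close>

lemma inner_d_le: "0 \<le> x \<bullet> c i \<Longrightarrow> x \<bullet> d i \<le> s * (x \<bullet> v i)"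
  using \<kappa> by (subst d_via_v) (simp add: inner_diff_right)

lemma inner_c_le: "0 \<le> x \<bullet> d i \<Longrightarrow> x \<bullet> c i \<le> s * (x \<bullet> t i)"
  using \<kappa> by (subst c_via_t) (simp add: inner_diff_right)

text \<open>
  The direction in which \<open>c i\<close> and \<open>d i\<close> are rotated is the normal of the plane of the chord; its
  sign on a vertex tells on which side of the chord the vertex is.
\<close>

lemma chord_normal:
  fixes \<sigma> :: real and i :: int assumes "\<bar>\<sigma>\<bar> = 1"
  defines "N \<equiv> (\<sigma> / s) *\<^sub>R cross3 (v i) (t i)"
  shows "norm N = 1" "N \<bullet> c i = 0" "N \<bullet> d i = 0" "N \<bullet> x = \<sigma> / s * triple (v i) (t i) x"
proof -
  have "(norm (cross3 (v i) (t i)))\<^sup>2 + \<kappa>\<^sup>2 = 1"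
    using norm_cross_dot[of "v i" "t i"] v_unit t_unit t_v by (simp add: inner_commute)
  then have "(norm (cross3 (v i) (t i)))\<^sup>2 = s\<^sup>2" using s by simp
  then have "norm (cross3 (v i) (t i)) = s" using s(1) by (simp add: power2_eq_iff_nonneg)
  then show "norm N = 1" using assms s(1) by (simp add: N_def)
  show Nx: "N \<bullet> x = \<sigma> / s * triple (v i) (t i) x" for x
    by (simp add: N_def triple_rotate[of "v i" "t i" x] triple_rotate[of "t i" x "v i"])
      (simp add: triple_def inner_commute)
  show "N \<bullet> c i = 0" unfolding Nx
    by (simp add: t_via_c triple_add triple_scale)
  show "N \<bullet> d i = 0" unfolding Nx
    by (subst v_via_d) (simp add: triple_add triple_scale)
qed

lemma no_rotation:
  fixes \<sigma> :: real
  assumes \<sigma>: "\<bar>\<sigma>\<bar> = 1"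
    and cz: "\<And>j. c i \<bullet> v j = 0 \<Longrightarrow> 0 \<le> \<sigma> * triple (v i) (t i) (v j)"
    and dz: "\<And>j. d i \<bullet> v j = 0 \<Longrightarrow> \<sigma> * triple (v i) (t i) (v j) \<le> 0"
  shows False
proof -
  define N where "N = (\<sigma> / s) *\<^sub>R cross3 (v i) (t i)"
  note N = chord_normal[OF \<sigma>, of i, folded N_def]
  show False
  proof (rule no_opposite_rotation[OF finite_range_v _ _ c_unit d_unit cd \<kappa>(2) N(1,2,3)])
    fix x assume "x \<in> range v"
    then obtain j where x: "x = v j" by auto
    show "0 < c i \<bullet> x \<or> c i \<bullet> x = 0 \<and> 0 \<le> N \<bullet> x"
      using c_nonneg[of i j] cz[of j] s(1) unfolding x N(4) by (auto simp: less_le)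
    show "0 < d i \<bullet> x \<or> d i \<bullet> x = 0 \<and> N \<bullet> x \<le> 0"
      using d_nonneg[of i j] dz[of j] s(1) unfolding x N(4) by (auto simp: less_le divide_nonpos_pos)
  next
    fix c' d' :: "real^3"
    assume "\<And>x. x \<in> range v \<Longrightarrow> 0 \<le> c' \<bullet> x" "\<And>x. x \<in> range v \<Longrightarrow> 0 \<le> d' \<bullet> x"
    then show "- \<kappa> * (norm c' * norm d') \<le> c' \<bullet> d'" by (intro least) auto
  qed
qed

lemma c_d_nonzero: "c i \<noteq> 0" "d i \<noteq> 0"
  using c_unit[of i] d_unit[of i] by auto

text \<open>
  Since \<open>d i\<close> is nonnegative on the vertices and vanishes at \<open>t i\<close>, only vertices where it
  vanishes contribute to \<open>t i\<close>.
\<close>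

lemma foot_on_zeros:
  assumes A: "A \<subseteq> range v" "\<And>j. d i \<bullet> v j = 0 \<Longrightarrow> v j \<in> A"
  shows "\<exists>f. (\<forall>x\<in>A. 0 \<le> f x) \<and> t i = (\<Sum>x\<in>A. f x *\<^sub>R x)"
proof -
  obtain f where f: "\<forall>x\<in>range v. 0 \<le> f x" "t i = (\<Sum>x\<in>range v. f x *\<^sub>R x)"
    using t_cone by blast
  have "0 = (\<Sum>x\<in>range v. f x * (d i \<bullet> x))"
    using d_t[of i] by (simp add: f(2) inner_sum_right)
  then have "\<forall>x\<in>range v. f x * (d i \<bullet> x) = 0"
    using f(1) d_nonneg by (subst sum_nonneg_eq_0_iff[symmetric]) (auto simp: finite_range_v)
  then have "\<forall>x\<in>range v - A. f x = 0" using A by auto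
  then have "(\<Sum>x\<in>range v. f x *\<^sub>R x) = (\<Sum>x\<in>A. f x *\<^sub>R x)"
    using A by (intro sum.mono_neutral_right finite_range_v) auto
  then show ?thesis using f A by (metis subsetD)
qed

text \<open>
  If \<open>d i\<close> vanished at a single vertex, this vertex would be \<open>t i\<close>, and \<open>d i\<close> could be rotated in
  both directions. There is at most one vertex besides \<open>v i\<close> where \<open>c i\<close> vanishes, so \<open>c i\<close> can be
  rotated in at least one direction, and this contradicts \<open>no_rotation\<close>.
\<close>

lemma side_exists:
  "\<exists>m. i < m \<and> m < i + n - 1 \<and> d i \<bullet> v m = 0 \<and> d i \<bullet> v (m + 1) = 0"
proof (rule ccontr)
  assume no: "\<not> ?thesis"
  have vi: "d i \<bullet> v i \<noteq> 0" using d_v s by simp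
  have two: False if ab: "i \<le> a" "a < b" "b < i + n" "d i \<bullet> v a = 0" "d i \<bullet> v b = 0" for a b
  proof -
    have "i < a" using ab vi by (cases "i = a") auto
    then have "b = a + 1 \<or> b = a + n - 1"
      using zeros_adjacent[OF c_d_nonzero(2) d_nonneg, of a b i] ab by auto
    then have "b = a + 1" using ab \<open>i < a\<close> by auto
    then show False using no ab \<open>i < a\<close> by auto
  qed
  show False
  proof (cases "\<exists>a. i \<le> a \<and> a < i + n \<and> d i \<bullet> v a = 0")
    case False
    then have "\<And>j. d i \<bullet> v j \<noteq> 0" using v_window by metis
    then have "t i = 0" using foot_on_zeros[of "{}" i] by auto
    then show False using t_unit[of i] by simp
  next
    case True
    then obtain a where a: "i \<le> a" "a < i + n" "d i \<bullet> v a = 0" by blast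
    have only: "v j = v a" if "d i \<bullet> v j = 0" for j
    proof -
      obtain m where m: "i \<le> m" "m < i + n" "v j = v m" using v_window by blast
      then show ?thesis using two[of a m] two[of m a] a that by (metis linorder_less_linear)
    qed
    then obtain f where "0 \<le> f (v a)" "t i = f (v a) *\<^sub>R v a"
      using foot_on_zeros[of "{v a}" i] by auto
    then have ta: "t i = v a" using t_unit[of i] v_unit[of a] by auto
    have dz: "triple (v i) (t i) (v j) = 0" if "d i \<bullet> v j = 0" for j
      using only[OF that] ta by simp
    show False
    proof (cases "\<exists>b. i < b \<and> b < i + n \<and> c i \<bullet> v b = 0")
      case False
      have "triple (v i) (t i) (v j) = 0" if "c i \<bullet> v j = 0" for j
      proof -
        obtain m where m: "i \<le> m" "m < i + n" "v j = v m" using v_window by blast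
        then have "m = i" using False that by force
        then show ?thesis using m by simp
      qed
      then show False using no_rotation[of 1 i] dz by simp
    next
      case True
      then obtain b where b: "i < b" "b < i + n" "c i \<bullet> v b = 0" by blast
      have cz: "v j = v i \<or> v j = v b" if "c i \<bullet> v j = 0" for j
      proof -
        obtain m where m: "i \<le> m" "m < i + n" "v j = v m" using v_window by blast
        have "\<not> (i < m \<and> m < b)" "\<not> b < m"
          using zeros_at_most_two[of "c i" i m b] zeros_at_most_two[of "c i" i b m] c_d_nonzero c_v b m that
          by auto
        then have "m = i \<or> m = b" using m by auto
        then show ?thesis using m by auto
      qed
      define \<sigma> :: real where "\<sigma> = (if 0 \<le> triple (v i) (t i) (v b) then 1 else -1)"
      show False
      proof (rule no_rotation[of \<sigma> i])
        show "\<bar>\<sigma>\<bar> = 1" by (simp add: \<sigma>_def)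
        show "0 \<le> \<sigma> * triple (v i) (t i) (v j)" if "c i \<bullet> v j = 0" for j
          using cz[OF that] by (auto simp: \<sigma>_def)
        show "\<sigma> * triple (v i) (t i) (v j) \<le> 0" if "d i \<bullet> v j = 0" for j
          using dz[OF that] by simp
      qed
    qed
  qed
qed

text \<open>
  The offset from \<open>i\<close> is chosen rather than the side itself, so that the choice is periodic.
\<close>

definition side :: "int \<Rightarrow> int" where
  "side i = i + (SOME m. 0 < m \<and> m < n - 1 \<and> d i \<bullet> v (i + m) = 0 \<and> d i \<bullet> v (i + m + 1) = 0)"

lemma side: "i < side i" "side i < i + n - 1" "d i \<bullet> v (side i) = 0" "d i \<bullet> v (side i + 1) = 0"
proof -
  obtain m where m: "i < m" "m < i + n - 1" "d i \<bullet> v m = 0" "d i \<bullet> v (m + 1) = 0"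
    using side_exists by blast
  have "\<exists>m. 0 < m \<and> m < n - 1 \<and> d i \<bullet> v (i + m) = 0 \<and> d i \<bullet> v (i + m + 1) = 0"
    using m by (intro exI[of _ "m - i"]) auto
  from someI_ex[OF this, folded side_def]
  show "i < side i" "side i < i + n - 1" "d i \<bullet> v (side i) = 0" "d i \<bullet> v (side i + 1) = 0"
    by (auto simp: side_def)
qed

lemma side_period: "side (i + n) = side i + n"
proof -
  have "v (i + n + m) = v (i + m)" for m using v_period[of "i + m"] by (simp add: ac_simps)
  moreover have "v (i + n + m + 1) = v (i + m + 1)" for m
    using v_period[of "i + m + 1"] by (simp add: ac_simps)
  ultimately show ?thesis by (simp add: side_def per)
qed

end

text \<open>
  The foot \<open>t i\<close> is on the side from \<open>v (S i)\<close> to \<open>v (S i + 1)\<close>, possibly at one of its end points.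
  In either case \<open>d i\<close> vanishes on the whole side, and this determines \<open>S i\<close> up to multiples of \<open>n\<close>
  even if \<open>t i\<close> is a vertex.
\<close>

locale sided_polygon = chorded_polygon +
  fixes S :: "int \<Rightarrow> int"
  assumes S: "i < S i" "S i < i + n - 1" and S_zero: "d i \<bullet> v (S i) = 0" "d i \<bullet> v (S i + 1) = 0"
    and S_period: "S (i + n) = S i + n"
begin

lemma S_period': "S (i - n) = S i - n"
  using S_period[of "i - n"] by simp

lemma foot_on_side: "\<exists>\<alpha> \<beta>. 0 \<le> \<alpha> \<and> 0 \<le> \<beta> \<and> t i = \<alpha> *\<^sub>R v (S i) + \<beta> *\<^sub>R v (S i + 1)"
proof -
  have A: "v j \<in> {v (S i), v (S i + 1)}" if "d i \<bullet> v j = 0" for j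
    using pos_off_side[OF c_d_nonzero(2) d_nonneg S_zero, of j i] that by force
  have ne: "v (S i) \<noteq> v (S i + 1)" using v_distinct[of "S i" "S i + 1"] n3 by simp
  obtain f where "\<forall>x\<in>{v (S i), v (S i + 1)}. 0 \<le> f x"
     "t i = (\<Sum>x\<in>{v (S i), v (S i + 1)}. f x *\<^sub>R x)"
    using foot_on_zeros[of "{v (S i), v (S i + 1)}" i] A by auto
  then show ?thesis using ne by auto
qed

text \<open>
  Two chords with feet on the same side would be perpendicular to it and of equal length. Then
  \<open>v l\<close> would lie outside the hemisphere with center \<open>c i\<close>, unless the feet coincide.
\<close>

lemma same_side_imp_eq:
  assumes "d i \<bullet> v m = 0" "d i \<bullet> v (m + 1) = 0" "d l \<bullet> v m = 0" "d l \<bullet> v (m + 1) = 0"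
  shows "v i = v l"
proof -
  define T where "T = triple (v m) (v (m+1)) (v i)"
  have ne: "v i \<noteq> v m" "v i \<noteq> v (m+1)" using assms d_v s by (metis less_irrefl)+
  obtain k where k: "m \<le> k" "k < m + n" "v i = v k" using v_window by blast
  then have "m + 1 < k" using ne by (smt (verit))
  then have T: "0 < T" using v_pos[of m "m+1" k] k by (simp add: T_def)
  define w where "w = (1 / T) *\<^sub>R cross3 (v m) (v (m+1))"
  have para: "u = (u \<bullet> v i) *\<^sub>R w" if "u \<bullet> v m = 0" "u \<bullet> v (m+1) = 0" for u
  proof -
    have "T *\<^sub>R u = (u \<bullet> v i) *\<^sub>R cross3 (v m) (v (m+1))"
      unfolding T_def using that by (subst cramer_inner) simp
    then have "(1 / T) *\<^sub>R (T *\<^sub>R u) = (u \<bullet> v i) *\<^sub>R w" by (simp add: w_def)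
    then show ?thesis using T by simp
  qed
  have "norm (d i) = (d i \<bullet> v i) * norm w" "norm (d l) = (d l \<bullet> v i) * norm w"
    using para[OF assms(1,2)] para[OF assms(3,4)] d_nonneg
    by (metis abs_of_nonneg norm_scaleR)+
  then have "d i \<bullet> v i = d l \<bullet> v i" using d_unit by (metis mult_cancel_right mult_zero_right zero_neq_one)
  then have d: "d i = d l" using para[OF assms(1,2)] para[OF assms(3,4)] by simp
  have "0 \<le> c i \<bullet> v l" by (rule c_nonneg)
  also have "c i \<bullet> v l = \<kappa> * s * (t i \<bullet> t l - 1)"
  proof -
    have 1: "d i \<bullet> t l = 0" "t i \<bullet> d l = 0" "d i \<bullet> d l = 1"
      using d d_t[of i] d_t[of l] unit_sq by (simp_all add: inner_commute)
    show ?thesis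
      by (subst v_via_d, subst c_via_t) (simp add: inner_add inner_diff 1 algebra_simps)
  qed
  finally have "1 \<le> t i \<bullet> t l"
    using mult_pos_pos[OF \<kappa>(1) s(1)] by (simp add: zero_le_mult_iff)
  then have "t i = t l" using unit_inner_eq_1[of "t i" "t l"] unit_inner_bounds[of "t i" "t l"] t_unit by force
  then show ?thesis using d by (metis v_via_d)
qed

lemma foot_nonneg: "0 \<le> d i \<bullet> t j" "0 \<le> c i \<bullet> t j"
proof -
  obtain \<alpha> \<beta> where "0 \<le> \<alpha>" "0 \<le> \<beta>" "t j = \<alpha> *\<^sub>R v (S j) + \<beta> *\<^sub>R v (S j + 1)"
    using foot_on_side by blast
  then show "0 \<le> d i \<bullet> t j" "0 \<le> c i \<bullet> t j" using d_nonneg c_nonneg by (simp_all add: inner_add)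
qed

text \<open>
  The assumption \<open>eq\<close> holds with nonnegative coefficients when the boundary points come in the
  order \<open>v i\<close>, \<open>v l\<close>, \<open>t l\<close>, \<open>t i\<close>, so that the chords do not cross. The functionals \<open>d i\<close> and
  \<open>d l\<close> are largest at \<open>v i\<close> and \<open>v l\<close>, and evaluating them leads to \<open>A \<le> B r\<close> and \<open>B \<le> A r\<close>
  with \<open>r = v i \<bullet> v l < 1\<close>.
\<close>

lemma parallel_chords:
  assumes "v i \<noteq> v l" and nonneg: "0 \<le> A" "0 \<le> B" "0 \<le> C" "0 \<le> E"
    and eq: "A *\<^sub>R v i + C *\<^sub>R t l = B *\<^sub>R v l + E *\<^sub>R t i"
  shows "A = 0" "B = 0"
proof -
  define r where "r = v i \<bullet> v l"
  have r: "r < 1" using unit_inner_eq_1[of "v i" "v l"] unit_inner_bounds[of "v i" "v l"] v_unit assms(1)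
    unfolding r_def by force
  have "d i \<bullet> (A *\<^sub>R v i + C *\<^sub>R t l) = d i \<bullet> (B *\<^sub>R v l + E *\<^sub>R t i)" by (simp only: eq)
  then have "A * s + C * (d i \<bullet> t l) = B * (d i \<bullet> v l)" by (simp add: inner_add d_v d_t)
  moreover have "B * (d i \<bullet> v l) \<le> B * (s * r)"
    using inner_d_le[of "v l" i] c_nonneg[of i l] nonneg
    by (intro mult_left_mono) (auto simp: inner_commute r_def)
  ultimately have "A * s \<le> B * (s * r)" using foot_nonneg(1)[of i l] nonneg by (smt (verit) mult_nonneg_nonneg)
  then have "s * A \<le> s * (B * r)" by (simp add: algebra_simps)
  then have 1: "A \<le> B * r" using s(1) by simp
  have "d l \<bullet> (A *\<^sub>R v i + C *\<^sub>R t l) = d l \<bullet> (B *\<^sub>R v l + E *\<^sub>R t i)" by (simp only: eq)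
  then have "A * (d l \<bullet> v i) = B * s + E * (d l \<bullet> t i)" by (simp add: inner_add d_v d_t)
  moreover have "A * (d l \<bullet> v i) \<le> A * (s * r)"
    using inner_d_le[of "v i" l] c_nonneg[of l i] nonneg
    by (intro mult_left_mono) (auto simp: inner_commute r_def)
  ultimately have "B * s \<le> A * (s * r)" using foot_nonneg(1)[of l i] nonneg by (smt (verit) mult_nonneg_nonneg)
  then have "s * B \<le> s * (A * r)" by (simp add: algebra_simps)
  then have 2: "B \<le> A * r" using s(1) by simp
  have "A + B \<le> (A + B) * r" using 1 2 by (simp add: algebra_simps)
  then have "(A + B) * (1 - r) \<le> 0" by (simp add: algebra_simps)
  then have "A + B \<le> 0" using r by (simp add: mult_le_0_iff)
  then show "A = 0" "B = 0" using nonneg by auto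
qed

text \<open>
  This is the other order in which two chords do not cross: \<open>v i\<close>, \<open>t l\<close>, \<open>v l\<close>, \<open>t i\<close>. Here \<open>d i\<close>
  is largest at \<open>v i\<close> and \<open>c l\<close> is largest at \<open>t l\<close>, and evaluating them shows that the
  coefficients agree and that the points coincide unless their coefficients vanish.
\<close>

lemma antiparallel_chords:
  assumes nonneg: "0 \<le> A" "0 \<le> B" "0 \<le> C" "0 \<le> E"
    and eq: "A *\<^sub>R v i + B *\<^sub>R v l = C *\<^sub>R t l + E *\<^sub>R t i"
  shows "A = C" "B = E" "A \<noteq> 0 \<Longrightarrow> t l = v i" "B \<noteq> 0 \<Longrightarrow> t i = v l"
proof -
  have *: "A = C \<and> (A \<noteq> 0 \<longrightarrow> t l = v i)"
    if nonneg: "0 \<le> A" "0 \<le> B" "0 \<le> C" "0 \<le> E"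
    and eq: "A *\<^sub>R v i + B *\<^sub>R v l = C *\<^sub>R t l + E *\<^sub>R t i" for A B C E i l
  proof -
    define r where "r = v i \<bullet> t l"
    have r: "r \<le> 1" using unit_inner_bounds[of "v i" "t l"] v_unit t_unit by (simp add: r_def)
    have "d i \<bullet> (A *\<^sub>R v i + B *\<^sub>R v l) = d i \<bullet> (C *\<^sub>R t l + E *\<^sub>R t i)" by (simp only: eq)
    then have "A * s + B * (d i \<bullet> v l) = C * (d i \<bullet> t l)" by (simp add: inner_add d_v d_t)
    moreover have "C * (d i \<bullet> t l) \<le> C * (s * r)"
      using inner_d_le[of "t l" i] foot_nonneg(2)[of i l] nonneg
      by (intro mult_left_mono) (auto simp: inner_commute r_def)
    ultimately have "A * s \<le> C * (s * r)"
      using d_nonneg[of i l] nonneg by (smt (verit) mult_nonneg_nonneg)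
    then have "s * A \<le> s * (C * r)" by (simp add: algebra_simps)
    then have 1: "A \<le> C * r" using s(1) by simp
    have "c l \<bullet> (A *\<^sub>R v i + B *\<^sub>R v l) = c l \<bullet> (C *\<^sub>R t l + E *\<^sub>R t i)" by (simp only: eq)
    then have "A * (c l \<bullet> v i) = C * s + E * (c l \<bullet> t i)" by (simp add: inner_add c_v c_t)
    moreover have "A * (c l \<bullet> v i) \<le> A * (s * r)"
      using inner_c_le[of "v i" l] d_nonneg[of l i] nonneg
      by (intro mult_left_mono) (auto simp: inner_commute r_def)
    ultimately have "C * s \<le> A * (s * r)" using foot_nonneg(2)[of l i] nonneg by (smt (verit) mult_nonneg_nonneg)
    then have "s * C \<le> s * (A * r)" by (simp add: algebra_simps)
    then have 2: "C \<le> A * r" using s(1) by simp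
    have "A * r \<le> A" "C * r \<le> C" using r nonneg by (simp_all add: mult_left_le)
    then have "A = C" using 1 2 by linarith
    moreover have "t l = v i" if "A \<noteq> 0"
    proof -
      have "A * 1 \<le> A * r" using 1 \<open>A = C\<close> by simp
      then have "r = 1" using that nonneg r by (simp add: mult_le_cancel_left)
      then show ?thesis using unit_inner_eq_1[of "v i" "t l"] v_unit t_unit by (simp add: r_def)
    qed
    ultimately show ?thesis by simp
  qed
  show "A = C" "A \<noteq> 0 \<Longrightarrow> t l = v i" using *[OF assms] by auto
  have eq': "B *\<^sub>R v l + A *\<^sub>R v i = E *\<^sub>R t i + C *\<^sub>R t l" using eq by (simp add: add.commute)
  show "B = E" "B \<noteq> 0 \<Longrightarrow> t i = v l" using *[OF nonneg(2,1,4,3) eq'] by auto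
qed

text \<open>
  Otherwise the chords of \<open>v i\<close> and \<open>v (i + 1)\<close> end on the same side of the polygon or do not cross,
  and the previous lemmas leave only the case of a common foot at a vertex. Then \<open>d i\<close> and \<open>d (i + 1)\<close> are the normals of the two sides
  at this vertex, and their order is opposite to the order of \<open>v i\<close> and \<open>v (i + 1)\<close>.
\<close>

lemma S_less_next: "S i < S (i + 1)"
proof (rule ccontr)
  assume less: "\<not> S i < S (i + 1)"
  define l where "l = i + 1"
  define a where "a = S l"
  define b where "b = S i"
  have ne: "v i \<noteq> v l" using v_distinct[of i l] n3 by (simp add: l_def)
  have "a \<noteq> b"
    using same_side_imp_eq[of i b l] S_zero[of i] S_zero[of l] ne by (auto simp: a_def b_def)
  then have ab: "i + 2 \<le> a" "a + 1 \<le> b" "b + 1 < i + n"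
    using less S[of l] S[of i] by (auto simp: a_def b_def l_def)
  obtain \<alpha> \<beta> where t: "0 \<le> \<alpha>" "0 \<le> \<beta>" "t i = \<alpha> *\<^sub>R v b + \<beta> *\<^sub>R v (b + 1)"
    using foot_on_side[of i] unfolding b_def by blast
  obtain \<alpha>' \<beta>' where t': "0 \<le> \<alpha>'" "0 \<le> \<beta>'" "t l = \<alpha>' *\<^sub>R v a + \<beta>' *\<^sub>R v (a + 1)"
    using foot_on_side[of l] unfolding a_def by blast
  have t'nz: "0 < \<alpha>' \<or> 0 < \<beta>'" using t' t_unit[of l] by (auto simp: less_le)
  have nn: "0 \<le> triple (v x) (t l) (v y)"
    if "x = i \<or> x = l" "y = b \<or> y = b + 1" for x y
  proof -
    have "x \<le> a" "x \<le> a + 1" "a \<le> y" "a + 1 \<le> y" "y \<le> x + n"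
      using that ab by (auto simp: l_def)
    then show ?thesis using t' by (simp add: triple_add triple_scale v_nonneg)
  qed
  have nn2: "0 \<le> triple (v x) (t l) (t i)" if "x = i \<or> x = l" for x
    using nn[OF that] t by (simp add: t(3) triple_add triple_scale)
  have C: "0 < triple (v i) (v l) (v b)" using v_pos[of i l b] ab by (simp add: l_def)
  have C1: "0 < triple (v i) (v l) (v (b+1))" using v_pos[of i l "b+1"] ab by (simp add: l_def)
  have nn3: "0 \<le> triple (v i) (v l) (t i)"
    using C C1 t by (simp add: triple_add triple_scale)
  have "0 < triple (v i) (v l) (v a)" "0 < triple (v i) (v l) (v (a+1))"
    using v_pos[of i l a] v_pos[of i l "a+1"] ab by (simp_all add: l_def)
  then have nn4: "0 \<le> triple (v i) (v l) (t l)" using t' by (simp add: triple_add triple_scale)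
  \<comment> \<open>\<open>v i\<close>, \<open>v l\<close>, \<open>t l\<close>, \<open>t i\<close> come in this cyclic order\<close>
  note AB = parallel_chords[OF ne nn2[of l] nn2[of i] nn3 nn4 triple_dependency, simplified]
  have "0 < triple (v l) (v a) (v (b+1))" "0 < triple (v l) (v (a+1)) (v (b+1))"
    using v_pos[of l a "b+1"] v_pos[of l "a+1" "b+1"] ab by (simp_all add: l_def)
  then have "0 < triple (v l) (t l) (v (b+1))"
    using t' t'nz by (auto simp: triple_add triple_scale intro: add_pos_nonneg add_nonneg_pos)
  moreover have "\<alpha> * triple (v l) (t l) (v b) + \<beta> * triple (v l) (t l) (v (b+1)) = 0"
    using AB(1) by (simp add: t(3) triple_add triple_scale)
  moreover have "0 \<le> \<alpha> * triple (v l) (t l) (v b)" using nn[of l b] t by simp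
  moreover have "0 \<le> \<beta> * triple (v l) (t l) (v (b+1))" using nn[of l "b+1"] t by simp
  ultimately have "\<beta> = 0" by (smt (verit) mult_eq_0_iff)
  then have ti: "t i = v b" using t unit_scale_eq[OF t_unit v_unit, of i \<alpha> b] by simp
  have "triple (v i) (v l) (t i) *\<^sub>R t l = triple (v i) (v l) (t l) *\<^sub>R t i"
    using triple_dependency[of "v l" "t l" "t i" "v i"] AB by simp
  then have "(1 / triple (v i) (v l) (t i)) *\<^sub>R (triple (v i) (v l) (t i) *\<^sub>R t l)
      = (triple (v i) (v l) (t l) / triple (v i) (v l) (t i)) *\<^sub>R t i" by simp
  then have "t l = (triple (v i) (v l) (t l) / triple (v i) (v l) (t i)) *\<^sub>R t i"
    using C by (simp add: ti)
  from unit_scale_eq[OF t_unit t_unit this divide_nonneg_nonneg[OF nn4 nn3]]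
  have tl: "t l = v b" by (simp add: ti)
  have "0 < triple (v a) (v b) (v (b+1))" using v_pos[of a b "b+1"] ab by simp
  moreover have "triple (d i) (d l) (v b) * triple (v a) (v b) (v (b+1)) = - ((d i \<bullet> v a) * (d l \<bullet> v (b+1)))"
    using S_zero[of i] d_t[of l] tl unit_sq
    by (simp add: triple_mult b_def[symmetric])
  moreover have "0 \<le> (d i \<bullet> v a) * (d l \<bullet> v (b+1))" using d_nonneg by simp
  ultimately have "triple (d i) (d l) (v b) \<le> 0"
    by (smt (verit) mult_pos_pos)
  moreover have "triple (v i) (v l) (v b) = s * s * triple (d i) (d l) (v b)"
    by (subst v_via_d[of i], subst v_via_d[of l]) (simp add: ti tl triple_add triple_scale)
  ultimately show False using C s(1) by (simp add: mult_le_0_iff zero_less_mult_iff)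
qed

text \<open>
  Let \<open>l = S i\<close>. The vertex \<open>v l\<close> is on the boundary part from \<open>v i\<close> to \<open>t i\<close>. If \<open>t l\<close> were on the
  same part, then the two chords would not cross, so they would have a common end point. The
  determinants of inner products at this point exclude all cases except \<open>t l = v i\<close> and \<open>t i = v l\<close>, and there \<open>c i\<close> and \<open>d i\<close> can be
  rotated in opposite directions.
\<close>

lemma S_S_less: "S (S i) < i + n"
proof (rule ccontr)
  assume "\<not> ?thesis"
  define l where "l = S i"
  define b where "b = S l - n"
  have ib: "i \<le> b" "b + 2 \<le> l" "i < l" "l + 1 < i + n"
    using \<open>\<not> _\<close> S[of i] S[of l] by (auto simp: l_def b_def)
  have vb: "v (S l) = v b" "v (S l + 1) = v (b + 1)"
    using v_period[of b] v_period[of "b+1"] by (simp_all add: b_def algebra_simps)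
  obtain \<alpha> \<beta> where t: "0 \<le> \<alpha>" "0 \<le> \<beta>" "t i = \<alpha> *\<^sub>R v l + \<beta> *\<^sub>R v (l + 1)"
    using foot_on_side[of i] unfolding l_def by blast
  obtain \<alpha>' \<beta>' where t': "0 \<le> \<alpha>'" "0 \<le> \<beta>'" "t l = \<alpha>' *\<^sub>R v b + \<beta>' *\<^sub>R v (b + 1)"
    using foot_on_side[of l] unfolding vb by blast
  have vpos: "0 < triple (v i) (v l) (v (l+1))" "0 < triple (v i) (v (b+1)) (v l)"
    "0 < triple (v l) (v (l+1)) (v i)"
    using v_pos[of i l "l+1"] v_pos[of i "b+1" l] v_pos[of l "l+1" "i+n"] ib v_period[of i] by simp_all
  define A B C E where "A = triple (t l) (v l) (t i)" and "B = triple (v i) (t l) (t i)"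
    and "C = triple (v i) (v l) (t i)" and "E = triple (v i) (t l) (v l)"
  have C: "C = \<beta> * triple (v i) (v l) (v (l+1))"
    by (simp add: C_def t(3) triple_add triple_scale)
  have E: "E = \<alpha>' * triple (v i) (v b) (v l) + \<beta>' * triple (v i) (v (b+1)) (v l)"
    by (simp add: E_def t'(3) triple_add triple_scale)
  have "0 \<le> triple (v b) (v l) (v (l+1))" "0 \<le> triple (v (b+1)) (v l) (v (l+1))"
    by (rule v_nonneg; use ib in simp)+
  then have nnA: "0 \<le> A" using t t' by (simp add: A_def triple_add triple_scale)
  have "0 \<le> triple (v i) (v b) (v l)" "0 \<le> triple (v i) (v (b+1)) (v l)"
     "0 \<le> triple (v i) (v b) (v (l+1))" "0 \<le> triple (v i) (v (b+1)) (v (l+1))"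
    by (rule v_nonneg; use ib in simp)+
  then have nnB: "0 \<le> B" and nnE: "0 \<le> E"
    using t t' by (simp_all add: B_def E_def triple_add triple_scale)
  have nnC: "0 \<le> C" using t vpos by (simp add: C)
  have "A *\<^sub>R v i + B *\<^sub>R v l = C *\<^sub>R t l + E *\<^sub>R t i"
    unfolding A_def B_def C_def E_def by (rule triple_dependency)
  note chords = antiparallel_chords[OF nnA nnB nnC nnE this]
  have "E = 0"
  proof (rule ccontr)
    assume "E \<noteq> 0"
    then have ti: "t i = v l" using chords by simp
    have "triple (d i) (c l) (v l) * triple (v l) (v (l+1)) (v i) = - (s * (c l \<bullet> v (l+1)))"
      using S_zero[of i] c_v[of l] d_v[of i] unit_sq[of l]
      by (simp add: triple_mult l_def[symmetric])
    moreover have "0 \<le> s * (c l \<bullet> v (l+1))" using s c_nonneg by simp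
    ultimately have "triple (d i) (c l) (v l) \<le> 0"
      using vpos(3) by (smt (verit) mult_pos_pos)
    moreover have "E = s * s * triple (d i) (c l) (v l)"
      unfolding E_def
      by (subst v_via_d, subst t_via_c) (simp add: ti triple_add triple_scale)
    ultimately have "E \<le> 0" using s(1) by (simp add: mult_nonneg_nonpos)
    then show False using \<open>E \<noteq> 0\<close> nnE by simp
  qed
  moreover have "0 \<le> \<alpha>' * triple (v i) (v b) (v l)"
    using t' v_nonneg[of i b l] ib by simp
  moreover have "0 \<le> \<beta>' * triple (v i) (v (b+1)) (v l)" using t' vpos by simp
  ultimately have z: "\<alpha>' * triple (v i) (v b) (v l) = 0" "\<beta>' * triple (v i) (v (b+1)) (v l) = 0"
    unfolding E by linarith+
  then have "\<beta>' = 0" using vpos by simp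
  then have tl: "t l = v b" "\<alpha>' \<noteq> 0"
    using t' unit_scale_eq[OF t_unit v_unit, of l \<alpha>' b] t_unit[of l] by auto
  have "b = i" using z(1) tl(2) v_pos[of i b l] ib by (cases "b = i") auto
  have tl: "t l = v i" using tl \<open>b = i\<close> by simp
  have dl: "d l \<bullet> v i = 0" "d l \<bullet> v (i+1) = 0" using S_zero[of l] \<open>b = i\<close> vb by simp_all
  have pos: "0 < triple (v i) (v (i+1)) (v l)" using vpos(2) \<open>b = i\<close> by simp
  have gram: "triple (v i) (c i) (d l) * triple (v i) (v (i+1)) (v l) = (c i \<bullet> v (i+1)) * s"
    using dl c_v[of i] d_v[of l] unit_sq[of i] by (simp add: triple_mult)
  moreover have "0 \<le> (c i \<bullet> v (i+1)) * s" using s c_nonneg by simp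
  ultimately have "0 \<le> triple (v i) (c i) (d l)" using pos by (smt (verit) mult_neg_pos)
  moreover have C2: "C = - (s * s * triple (v i) (c i) (d l))"
    unfolding C_def t_via_c by (subst v_via_d[of l]) (simp add: tl triple_add triple_scale triple_swap'[of _ "d l"])
  ultimately have "C \<le> 0" by simp
  then have "C = 0" using nnC by simp
  then have "\<beta> = 0" using C vpos by simp
  then have ti: "t i = v l" using t unit_scale_eq[OF t_unit v_unit, of i \<alpha> l] by simp
  have "triple (v i) (c i) (d l) = 0" using C2 \<open>C = 0\<close> s(1) by simp
  then have ci: "c i \<bullet> v (i+1) = 0" using gram s(1) by simp
  show False
  proof (rule no_rotation[of "-1" i])
    show "0 \<le> - 1 * triple (v i) (t i) (v j)" if "c i \<bullet> v j = 0" for j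
    proof -
      have "v j = v i \<or> v j = v (i+1)"
        using pos_off_side[OF c_d_nonzero(1) c_nonneg c_v ci, of j] that by force
      then show ?thesis using pos triple_swap'[of "v i" "v l" "v (i+1)"] by (auto simp: ti)
    qed
    show "- 1 * triple (v i) (t i) (v j) \<le> 0" if "d i \<bullet> v j = 0" for j
    proof -
      have "v j = v l \<or> v j = v (l+1)"
        using pos_off_side[OF c_d_nonzero(2) d_nonneg S_zero, of j i] that by (force simp: l_def)
      then show ?thesis using vpos(1) by (auto simp: ti)
    qed
  qed simp
qed

text \<open>
  Negating all vectors preserves the inner products and reverses the sign of the triple products,
  which the reversal of the indices compensates. The side from \<open>v (S i)\<close> to \<open>v (S i + 1)\<close> is then
  traversed in the opposite direction, which explains the shift of \<open>S\<close>.
\<close>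

lemma mirror:
  "sided_polygon n (\<lambda>j. - v (- j)) \<kappa> s (\<lambda>j. - c (- j)) (\<lambda>j. - d (- j)) (\<lambda>j. - t (- j))
     (\<lambda>j. n - 1 - S (- j))"
proof unfold_locales
  fix i j k :: int
  show "3 \<le> n" by (rule n3)
  show "- v (- (j + n)) = - v (- j)" using v_period'[of "- j"] by simp
  show "norm (- v (- j)) = 1" using v_unit by simp
  assume "i < j" "j < k" "k < i + n"
  then show "0 < triple (- v (- i)) (- v (- j)) (- v (- k))"
    using v_pos[of "- k" "- j" "- i"] triple_swap[of "v (- j)" "v (- k)" "v (- i)"]
      triple_rotate[of "v (- i)" "v (- j)" "v (- k)"] by (simp add: triple_minus)
next
  show "0 < \<kappa>" "\<kappa> < 1" "0 < s" "s\<^sup>2 = 1 - \<kappa>\<^sup>2" by (fact \<kappa> s)+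
next
  fix i j :: int
  show "- c (- (j + n)) = - c (- j)" "- d (- (j + n)) = - d (- j)" "- t (- (j + n)) = - t (- j)"
    using per(1)[of "- j - n"] per(2)[of "- j - n"] per(3)[of "- j - n"] by simp_all
  show "norm (- c (- i)) = 1" "norm (- d (- i)) = 1" "- c (- i) \<bullet> - d (- i) = - \<kappa>"
    by (simp_all add: c_unit d_unit cd)
  show "s *\<^sub>R - v (- i) = - d (- i) + \<kappa> *\<^sub>R - c (- i)" "s *\<^sub>R - t (- i) = - c (- i) + \<kappa> *\<^sub>R - d (- i)"
    by (simp_all add: v_eq t_eq)
  show "0 \<le> - c (- i) \<bullet> - v (- j)" "0 \<le> - d (- i) \<bullet> - v (- j)"
    by (simp_all add: c_nonneg d_nonneg)
  have rng: "range (\<lambda>j. - v (- j)) = uminus ` range v"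
    by (force simp: image_iff intro: exI[of _ "- _"])
  obtain f where f: "\<forall>x\<in>range v. 0 \<le> f x" "t (- i) = (\<Sum>x\<in>range v. f x *\<^sub>R x)"
    using t_cone by blast
  show "\<exists>f. (\<forall>x\<in>range (\<lambda>j. - v (- j)). 0 \<le> f x) \<and> - t (- i) = (\<Sum>x\<in>range (\<lambda>j. - v (- j)). f x *\<^sub>R x)"
    unfolding rng using f
    by (intro exI[of _ "\<lambda>x. f (- x)"]) (auto simp: sum.reindex sum_negf)
next
  fix c' d' :: "real^3"
  assume *: "\<And>j. 0 \<le> c' \<bullet> - v (- j)" "\<And>j. 0 \<le> d' \<bullet> - v (- j)"
  have "0 \<le> (- c') \<bullet> v j" "0 \<le> (- d') \<bullet> v j" for j using *[of "- j"] by simp_all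
  from least[OF this] show "- \<kappa> * (norm c' * norm d') \<le> c' \<bullet> d'" by simp
next
  fix i :: int
  show "i < n - 1 - S (- i)" "n - 1 - S (- i) < i + n - 1" using S[of "- i"] by auto
  have "v (- (n - 1 - S (- i))) = v (S (- i) + 1)" "v (- (n - 1 - S (- i) + 1)) = v (S (- i))"
    using v_period'[of "S (- i) + 1"] v_period'[of "S (- i)"] by (simp_all add: algebra_simps)
  then show "- d (- i) \<bullet> - v (- (n - 1 - S (- i))) = 0" "- d (- i) \<bullet> - v (- (n - 1 - S (- i) + 1)) = 0"
    using S_zero[of "- i"] by simp_all
  show "n - 1 - S (- (i + n)) = n - 1 - S (- i) + n"
    using S_period'[of "- i"] by simp
qed

lemma S_S_ge: "i + n \<le> S (S i + 1)"
proof -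
  have "n - 1 - S (- (n - 1 - S (- (- i)))) < - i + n"
    by (rule sided_polygon.S_S_less[OF mirror])
  then have "n - 1 - S (S i + 1 - n) < - i + n" by (simp add: algebra_simps)
  then show ?thesis using S_period'[of "S i + 1"] by simp
qed

text \<open>
  The function \<open>S\<close> is strictly increasing and commutes with the shift by \<open>n\<close>, so it is a
  translation by some \<open>k\<close>. The inequalities for \<open>S (S i)\<close> and \<open>S (S i + 1)\<close> say that neither side
  of a chord contains more vertices than the other.
\<close>

theorem opposite_side: obtains k where "n = 2 * k + 1" "1 \<le> k" "\<And>i. S i = i + k"
proof -
  have ge: "S j + int m \<le> S (j + int m)" for j m
  proof (induction m)
    case (Suc m)
    then show ?case using S_less_next[of "j + int m"] by (simp add: algebra_simps)
  qed simp
  have step: "S (i + 1) = S i + 1" for i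
  proof -
    have "S (i + 1) + (n - 1) \<le> S (i + n)" using ge[of "i + 1" "nat (n - 1)"] n3 by simp
    then show ?thesis using S_period[of i] S_less_next[of i] by simp
  qed
  have up: "S (int m) = S 0 + int m" for m
  proof (induction m)
    case (Suc m)
    then show ?case using step[of "int m"] by (simp add: algebra_simps)
  qed simp
  have down: "S (- int m) = S 0 - int m" for m
  proof (induction m)
    case (Suc m)
    then show ?case using step[of "- 1 - int m"] by (simp add: algebra_simps)
  qed simp
  have Sk: "S i = i + S 0" for i
    using up[of "nat i"] down[of "nat (- i)"] by (cases "0 \<le> i") auto
  have "2 * S 0 < n" using S_S_less[of 0] Sk[of "S 0"] by simp
  moreover have "n \<le> 2 * S 0 + 1" using S_S_ge[of 0] Sk[of "S 0 + 1"] by simp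
  ultimately have "n = 2 * S 0 + 1" by simp
  moreover have "1 \<le> S 0" using S(1)[of 0] by simp
  ultimately show ?thesis using Sk by (rule that)
qed

end

section \<open>Covering by a disk\<close>

text \<open>
  The potential is the sum of the increments from \<open>0\<close>, and it is periodic as the increments
  of a period sum up to \<open>0\<close>. So it takes only finitely many values.
\<close>

lemma periodic_potential_max:
  fixes a :: "int \<Rightarrow> real" and n :: int
  assumes n: "0 < n" and per: "\<And>j. a (j + n) = a j" and sum0: "(\<Sum>j\<in>{0..<n}. a j) = 0"
  obtains P i where "\<And>j. P (j + 1) - P j = a j" "\<And>j. P j \<le> (P i :: real)"
proof -
  define P where "P j = (if 0 \<le> j then (\<Sum>l\<in>{0..<j}. a l) else - (\<Sum>l\<in>{j..<0}. a l))" for j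
  have step: "P (j + 1) - P j = a j" for j
  proof (cases "0 \<le> j")
    case True
    then have "{0..<j + 1} = insert j {0..<j}" by auto
    then show ?thesis using True by (simp add: P_def)
  next
    case False
    then have "{j..<0} = insert j {j + 1..<0}" by auto
    then show ?thesis using False by (auto simp: P_def)
  qed
  have "P (j + n) - P j = 0" for j
  proof -
    define D where "D j = P (j + n) - P j" for j
    have Ds: "D (j + 1) = D j" for j
      using step[of "j + n"] step[of j] per[of j] by (simp add: D_def algebra_simps)
    have "D j = D 0" using periodic_int_mult[of D 1 0 j] Ds by simp
    also have "D 0 = 0" using sum0 n by (simp add: D_def P_def)
    finally show ?thesis by (simp add: D_def)
  qed
  then have Pper: "P (j + n) = P j" for j by simp
  have "finite (P ` {0..<n})" "P ` {0..<n} \<noteq> {}" using n by auto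
  then have "Max (P ` {0..<n}) \<in> P ` {0..<n}" by (rule Max_in)
  then obtain i where "i \<in> {0..<n}" "P i = Max (P ` {0..<n})" by force
  then have i: "P j \<le> P i" if "j \<in> {0..<n}" for j
    using that by simp
  have "P j \<le> P i" for j
  proof -
    have "P j = P (j mod n)" using periodic_int_mult[of P n "j mod n" "j div n"] Pper
      by (simp add: algebra_simps)
    then show ?thesis using i[of "j mod n"] n by simp
  qed
  then show ?thesis using step that by blast
qed

lemma sum_periodic_shift:
  fixes g :: "int \<Rightarrow> real" and n :: int
  assumes n: "0 < n" and per: "\<And>j. g (j + n) = g j"
  shows "(\<Sum>j\<in>{0..<n}. g (j + m)) = (\<Sum>j\<in>{0..<n}. g j)"
proof (rule sum.reindex_bij_witness[where j = "\<lambda>j. (j + m) mod n" and i = "\<lambda>j. (j - m) mod n"])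
  fix j assume "j \<in> {0..<n}"
  then show "((j + m) mod n - m) mod n = j" "((j - m) mod n + m) mod n = j"
    by (simp_all add: mod_simps)
  show "(j + m) mod n \<in> {0..<n}" "(j - m) mod n \<in> {0..<n}" using n by auto
  show "g ((j + m) mod n) = g (j + m)"
    using periodic_int_mult[of g n "(j + m) mod n" "(j + m) div n"] per by (simp add: algebra_simps)
qed

context sided_polygon begin

text \<open>
  For \<open>j\<close> from \<open>i\<close> to \<open>i + k\<close> and from \<open>i\<close> down to \<open>i - k\<close> the distance from \<open>t i\<close> to \<open>v j\<close> exceeds
  its initial value \<open>arccos \<kappa>\<close> by at most \<open>P j - P i\<close>. These indices form a full period.
\<close>

theorem foot_within_width:
  assumes h: "\<And>j. 0 < h \<bullet> v j"
  obtains i where "\<And>j. sdist (t i) (v j) \<le> arccos \<kappa>"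
proof -
  obtain k where k: "n = 2 * k + 1" "1 \<le> k" "\<And>i. S i = i + k"
    using opposite_side by metis
  define g where "g j = sdist (v j) (v (j + k))" for j
  have gper: "g (j + n) = g j" for j
    using v_period[of j] v_period[of "j + k"] by (simp add: g_def algebra_simps)
  \<comment> \<open>\<open>n = 2 k + 1\<close>, so the vertex \<open>k\<close> steps after \<open>v (j + k + 1)\<close> is \<open>v j\<close>\<close>
  have g_back: "sdist (v j) (v (j + k + 1)) = g (j + k + 1)" for j
  proof -
    have "v (j + k + 1 + k) = v j" using v_period[of j] k(1) by (simp add: algebra_simps)
    then show ?thesis by (simp add: g_def sdist_def inner_commute)
  qed
  define a where "a j = g (j + 1) - g (j + k + 1)" for j
  have aper: "a (j + n) = a j" for j
    using gper[of "j + 1"] gper[of "j + k + 1"] by (simp add: a_def algebra_simps)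
  have "(\<Sum>j\<in>{0..<n}. g (j + 1)) = (\<Sum>j\<in>{0..<n}. g (j + (k + 1)))"
    using sum_periodic_shift[of n g] gper n3 by simp
  then have "(\<Sum>j\<in>{0..<n}. a j) = 0" by (simp add: a_def sum_subtractf add.assoc)
  then obtain P i where P: "\<And>j. P (j + 1) - P j = a j" "\<And>j. P j \<le> P i"
    using periodic_potential_max[of n a] n3 aper by (metis less_le_trans zero_less_numeral)
  obtain \<alpha> \<beta> where t: "0 \<le> \<alpha>" "0 \<le> \<beta>" "t i = \<alpha> *\<^sub>R v (i + k) + \<beta> *\<^sub>R v (i + k + 1)"
    using foot_on_side[of i] k by auto
  have tnz: "0 < \<alpha> \<or> 0 < \<beta>" using t t_unit[of i] by (auto simp: less_le)
  have ht: "0 < h \<bullet> t i"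
    using t tnz h[of "i + k"] h[of "i + k + 1"]
    by (auto simp: inner_add less_imp_le intro: add_pos_nonneg add_nonneg_pos)
  have comm: "sdist x y = sdist y x" for x y by (simp add: sdist_def inner_commute)
  have start: "sdist (t i) (v i) = arccos \<kappa>" by (simp add: sdist_def t_v)
  have right: "sdist (t i) (v (j + 1)) \<le> sdist (t i) (v j) + a j" if j: "i \<le> j" "j < i + k" for j
  proof -
    have "sdist (v j) (v (j + k + 1)) + sdist (v (j + 1)) (t i)
       \<le> sdist (v j) (t i) + sdist (v (j + 1)) (v (j + k + 1))"
    proof (rule crossing_arcs_sdist[OF v_unit v_unit t_unit v_unit h h ht h])
      have le: "0 \<le> triple (v (j+1)) (v (i+k)) (v (j+k+1))" "0 \<le> triple (v (j+1)) (v (i+k+1)) (v (j+k+1))"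
        "0 \<le> triple (v j) (v (i+k)) (v (j+k+1))" "0 \<le> triple (v j) (v (i+k+1)) (v (j+k+1))"
        "0 \<le> triple (v j) (v (j+1)) (v (i+k))" "0 \<le> triple (v j) (v (j+1)) (v (i+k+1))"
        by (rule v_nonneg; use j k in simp)+
      show "0 \<le> triple (v (j+1)) (t i) (v (j+k+1))" "0 \<le> triple (v j) (t i) (v (j+k+1))"
        "0 \<le> triple (v j) (v (j+1)) (t i)"
        using le t by (simp_all add: triple_add triple_scale)
      have "0 < triple (v j) (v (j+1)) (v (j+k+1))" by (rule v_pos) (use k in simp_all)
      then show "0 \<le> triple (v j) (v (j+1)) (v (j+k+1))"
        "0 < triple (v (j+1)) (t i) (v (j+k+1)) \<or> 0 < triple (v j) (v (j+1)) (v (j+k+1))" by simp_all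
    qed
    then show ?thesis
      using g_back[of j] unfolding a_def g_def
      by (simp add: comm[of "t i"] algebra_simps)
  qed
  have left: "sdist (t i) (v (j - 1)) \<le> sdist (t i) (v j) - a (j - 1)" if j: "i - k < j" "j \<le> i" for j
  proof -
    have "sdist (v (j - 1)) (t i) + sdist (v j) (v (j + k))
       \<le> sdist (v (j - 1)) (v (j + k)) + sdist (v j) (t i)"
    proof (rule crossing_arcs_sdist[OF v_unit v_unit v_unit t_unit h h h ht])
      have le: "0 \<le> triple (v j) (v (j+k)) (v (i+k))" "0 \<le> triple (v j) (v (j+k)) (v (i+k+1))"
        "0 \<le> triple (v (j-1)) (v j) (v (i+k))" "0 \<le> triple (v (j-1)) (v j) (v (i+k+1))"
        "0 \<le> triple (v (j-1)) (v (j+k)) (v (i+k))" "0 \<le> triple (v (j-1)) (v (j+k)) (v (i+k+1))"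
        by (rule v_nonneg; use j k in simp)+
      show "0 \<le> triple (v j) (v (j+k)) (t i)" "0 \<le> triple (v (j-1)) (v j) (t i)"
        "0 \<le> triple (v (j-1)) (v (j+k)) (t i)"
        using le t by (simp_all add: triple_add triple_scale)
      show "0 \<le> triple (v (j-1)) (v j) (v (j+k))" by (rule v_nonneg; use j k in simp)
      have p: "0 < triple (v (j-1)) (v j) (v (i+k))" "0 < triple (v j) (v (j+k)) (v (i+k+1))"
        by (rule v_pos; use j k in simp)+
      show "0 < triple (v j) (v (j+k)) (t i) \<or> 0 < triple (v (j-1)) (v j) (t i)"
        using tnz
      proof
        assume "0 < \<alpha>"
        then have "0 < \<alpha> * triple (v (j-1)) (v j) (v (i+k)) + \<beta> * triple (v (j-1)) (v j) (v (i+k+1))"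
          using p le t by (intro add_pos_nonneg) auto
        then show ?thesis by (simp add: t(3) triple_add triple_scale)
      next
        assume "0 < \<beta>"
        then have "0 < \<alpha> * triple (v j) (v (j+k)) (v (i+k)) + \<beta> * triple (v j) (v (j+k)) (v (i+k+1))"
          using p le t by (intro add_nonneg_pos) auto
        then show ?thesis by (simp add: t(3) triple_add triple_scale)
      qed
    qed
    then show ?thesis
      using g_back[of "j - 1"] unfolding a_def g_def
      by (simp add: comm[of "t i"] algebra_simps)
  qed
  have R: "sdist (t i) (v (i + int m)) \<le> arccos \<kappa> + (P (i + int m) - P i)" if "int m \<le> k" for m
    using that
  proof (induction m)
    case (Suc m)
    then show ?case using right[of "i + int m"] P(1)[of "i + int m"] by (simp add: algebra_simps)
  qed (simp add: start)
  have L: "sdist (t i) (v (i - int m)) \<le> arccos \<kappa> + (P (i - int m) - P i)" if "int m \<le> k" for m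
    using that
  proof (induction m)
    case (Suc m)
    then show ?case using left[of "i - int m"] P(1)[of "i - int m - 1"] by (simp add: algebra_simps)
  qed (simp add: start)
  have "sdist (t i) (v j) \<le> arccos \<kappa>" for j
  proof -
    obtain m where m: "i - k \<le> m" "m < i - k + n" "v j = v m" using v_window by blast
    show ?thesis
    proof (cases "i \<le> m")
      case True
      then show ?thesis using R[of "nat (m - i)"] P(2)[of m] m k by simp
    next
      case False
      then show ?thesis using L[of "nat (i - m)"] P(2)[of m] m k by simp
    qed
  qed
  then show ?thesis by (rule that)
qed

end

text \<open>
  The inner normals of the two sides that meet at \<open>v i\<close>.
\<close>

lemma (in cyclic_polygon) two_side_normals:
  obtains a b where "norm a = 1" "norm b = 1" "a \<noteq> b" "a \<bullet> v i = 0" "b \<bullet> v i = 0"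
    "\<And>j. 0 \<le> a \<bullet> v j" "\<And>j. 0 \<le> b \<bullet> v j"
proof -
  define f where "f i = sgn (cross3 (v i) (v (i+1)))" for i
  have f: "f i \<bullet> x = triple (v i) (v (i+1)) x / norm (cross3 (v i) (v (i+1)))" for i x
    using triple_rotate[of x "v i" "v (i+1)"] by (simp add: f_def inner_commute[of _ x] inner_sgn triple_def)
  have nz: "cross3 (v i) (v (i+1)) \<noteq> 0" for i
  proof
    assume "cross3 (v i) (v (i+1)) = 0"
    then have "triple (v i) (v (i+1)) (v (i+2)) = 0"
      using triple_rotate[of "v (i+2)" "v i" "v (i+1)"] by (simp add: triple_def)
    then show False using v_pos[of i "i+1" "i+2"] n3 by simp
  qed
  have pos: "0 \<le> f i \<bullet> v j" for i j
  proof -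
    obtain m where m: "i \<le> m" "m < i + n" "v j = v m" using v_window by blast
    have "0 \<le> triple (v i) (v (i+1)) (v m)"
      using v_nonneg[of i "i+1" m] m by (cases "m = i") auto
    then show ?thesis by (simp add: f m)
  qed
  have "norm (f i) = 1" for i using nz by (simp add: f_def norm_sgn)
  moreover have "f i \<noteq> f (i - 1)"
  proof
    assume eq: "f i = f (i - 1)"
    have "f i \<bullet> v (i+1) = 0" by (simp add: f)
    then have "triple (v (i-1)) (v i) (v (i+1)) = 0" using nz[of "i-1"] by (simp add: eq f)
    then show False using v_pos[of "i-1" i "i+1"] n3 by simp
  qed
  moreover have "f i \<bullet> v i = 0" "f (i - 1) \<bullet> v i = 0" by (simp_all add: f)
  ultimately show ?thesis using pos that by blast
qed

text \<open>
  For \<open>\<kappa> < 0\<close> all unit vectors of the dual cone are in a disk around \<open>d\<close> of radius less than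
  \<open>\<pi> / 2\<close>. The great circle with pole \<open>v\<close> touches this disk in \<open>c\<close>.
\<close>

lemma vertex_dual_unique:
  assumes far: "farthest_pair C \<kappa> c d" and v: "r *\<^sub>R v = d + \<kappa> *\<^sub>R c" and \<kappa>: "\<kappa> < 0"
    and a: "a \<in> dual_cone C" "norm a = 1" "a \<bullet> v = 0"
  shows "a = c"
proof -
  have cd: "norm c = 1" "norm d = 1" "d \<in> dual_cone C" using far by (auto simp: farthest_pair_def)
  have "- \<kappa> * (norm a * norm d) \<le> a \<bullet> d"
    using far a(1) cd(3) unfolding farthest_pair_def by blast
  moreover have "a \<bullet> (r *\<^sub>R v) = a \<bullet> d + \<kappa> * (a \<bullet> c)" unfolding v by (simp add: inner_add_right)
  ultimately have "\<kappa> * (a \<bullet> c) \<le> \<kappa> * 1" using a cd by simp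
  then have "1 \<le> a \<bullet> c" using \<kappa> by simp
  then show ?thesis using unit_inner_eq_1[OF a(2) cd(1)] unit_inner_bounds[OF a(2) cd(1)] by simp
qed

theorem theorem6p1:
  fixes V :: "(real^3) set"
  assumes "reduced_polygon V"
  shows "\<exists>c \<in> sbd V. V \<subseteq> sdisk c (thickness V)"
proof -
  have R: "reduced V" and poly: "spolygon V" using assms by (auto simp: reduced_polygon_def)
  have body: "sconvex_body V" using R by (simp add: reduced_def)
  note D = sconvex_bodyD[OF body]
  obtain \<kappa> c0 d0 where far: "farthest_pair V \<kappa> c0 d0" and \<kappa>: "-1 < \<kappa>" "\<kappa> < 1"
    using farthest_pair_exists[OF body] by blast
  have thick: "thickness V = arccos \<kappa>" by (rule thickness_eq[OF body far \<kappa>])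
  define s where "s = sqrt (1 - \<kappa>\<^sup>2)"
  have k2: "\<kappa>\<^sup>2 < 1" using \<kappa> by (simp add: abs_square_less_1 abs_less_iff)
  then have s: "0 < s" "s\<^sup>2 = 1 - \<kappa>\<^sup>2" by (simp_all add: s_def)
  obtain o' where o: "o' \<in> sinterior V" using D(8) by blast
  obtain E h where E: "finite E" "E \<subseteq> V" "V = S2 \<inter> nonneg_combs E" "\<And>x. x \<in> E \<Longrightarrow> 0 < h \<bullet> x"
    "\<And>v. v \<in> E \<Longrightarrow> \<exists>u. u \<bullet> v = 0 \<and> (\<forall>x\<in>E - {v}. 0 < u \<bullet> x)"
    using spolygon_vertices[OF poly] by metis
  have E1: "norm x = 1" if "x \<in> E" for x using that E(2) D(5) by blast
  have comb: "\<exists>f. (\<forall>x\<in>E. 0 \<le> f x) \<and> z = (\<Sum>x\<in>E. f x *\<^sub>R x)" if "z \<in> V" for z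
    using that E(3) by (auto simp: nonneg_combs_def)
  have dualI: "u \<in> dual_cone V" if u: "\<And>x. x \<in> E \<Longrightarrow> 0 \<le> u \<bullet> x" for u
    unfolding dual_cone_def
  proof (intro CollectI ballI)
    fix z assume "z \<in> V"
    then obtain f where "\<forall>x\<in>E. 0 \<le> f x" "z = (\<Sum>x\<in>E. f x *\<^sub>R x)" using comb by blast
    then show "0 \<le> u \<bullet> z" using u by (auto simp: inner_sum_right intro!: sum_nonneg)
  qed
  have card: "3 \<le> card E"
  proof (rule ccontr)
    assume "\<not> 3 \<le> card E"
    then have "dim E < DIM(real^3)" using dim_le_card'[OF E(1)] by simp
    then obtain x where x: "x \<noteq> 0" "\<And>y. y \<in> span E \<Longrightarrow> orthogonal x y"
      using orthogonal_to_subspace_exists by blast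
    then have "x \<bullet> y = 0" if "y \<in> E" for y using that by (simp add: span_base orthogonal_def)
    then have "x \<in> dual_cone V" "- x \<in> dual_cone V" by (auto intro: dualI)
    then show False using sinterior_dual_pos[OF o, of x] sinterior_dual_pos[OF o, of "- x"] x(1) by simp
  qed
  have chord: "\<exists>c d. farthest_pair V \<kappa> c d \<and> s *\<^sub>R v = d + \<kappa> *\<^sub>R c" if v: "v \<in> E" for v
  proof -
    obtain u where u: "u \<bullet> v = 0" "\<And>x. x \<in> E - {v} \<Longrightarrow> 0 < u \<bullet> x" using E(5)[OF v] by blast
    have pos: "0 < u \<bullet> z" if z: "z \<in> V" "z \<noteq> v" for z
    proof -
      obtain f where f: "\<forall>x\<in>E. 0 \<le> f x" "z = (\<Sum>x\<in>E. f x *\<^sub>R x)" using comb z by blast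
      have z': "z = f v *\<^sub>R v + (\<Sum>x\<in>E - {v}. f x *\<^sub>R x)" using f(2) v E(1) by (simp add: sum.remove)
      have "\<exists>y\<in>E - {v}. f y \<noteq> 0"
      proof (rule ccontr)
        assume "\<not> ?thesis"
        then have "z = f v *\<^sub>R v" using z' by simp
        then show False using unit_scale_eq[OF D(5)[OF z(1)] E1[OF v]] f(1) v z(2) by blast
      qed
      then obtain y where y: "y \<in> E - {v}" "f y \<noteq> 0" by blast
      have fy: "0 < f y" using y f(1) by (auto simp: less_le)
      have nn: "0 \<le> f x * (u \<bullet> x)" if "x \<in> E - {v}" for x using that f(1) u(2)[OF that] by simp
      have "0 < (\<Sum>x\<in>E - {v}. f x * (u \<bullet> x))"
        using E(1) fy u(2)[OF y(1)] by (intro sum_pos2[OF _ y(1) _ nn]) auto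
      then show ?thesis by (subst z') (simp add: inner_add_right inner_sum_right u(1))
    qed
    have "v \<in> V" using v E(2) by blast
    from reduced_vertex_chord[OF R far \<kappa> this u(1) pos]
    obtain c d where "farthest_pair V \<kappa> c d" "sqrt (1 - \<kappa>\<^sup>2) *\<^sub>R v = d + \<kappa> *\<^sub>R c" by blast
    then show ?thesis unfolding s_def by blast
  qed
  obtain v where cyc: "cyclic_polygon (int (card E)) v" and rng: "range v = E"
    using cyclic_labelling[OF E(1) E1 E(4) E(5) card] by blast
  interpret cyclic_polygon "int (card E)" v by (rule cyc)
  have vE: "v j \<in> E" for j using rng by blast
  have dual_v: "u \<in> dual_cone V" if "\<And>j. 0 \<le> u \<bullet> v j" for u
    using that rng by (intro dualI) auto
  have foot: "(1 / s) *\<^sub>R (c + \<kappa> *\<^sub>R d) \<in> V" "(1 / s) *\<^sub>R (c + \<kappa> *\<^sub>R d) \<in> sbd V"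
    if "farthest_pair V \<kappa> c d" for c d
  proof -
    have "norm d = 1" using that by (simp add: farthest_pair_def)
    then have d: "d \<in> dual_cone V" "d \<noteq> 0" using that by (auto simp: farthest_pair_def)
    note f = farthest_pair_foot[OF body farthest_pair_commute[OF that] \<kappa>, folded s_def]
    then show "(1 / s) *\<^sub>R (c + \<kappa> *\<^sub>R d) \<in> V" by blast
    show "(1 / s) *\<^sub>R (c + \<kappa> *\<^sub>R d) \<in> sbd V" by (rule dual_zero_in_sbd[OF body d f])
  qed
  have disk: "V \<subseteq> sdisk t (arccos \<kappa>)" if t: "t \<in> V" "\<And>z. z \<in> V \<Longrightarrow> \<kappa> \<le> t \<bullet> z" for t
  proof
    fix z assume z: "z \<in> V"
    have "arccos (t \<bullet> z) \<le> arccos \<kappa>"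
      using \<kappa> t(2)[OF z] unit_inner_bounds[OF D(5)[OF t(1)] D(5)[OF z]] by (intro arccos_le_arccos) auto
    then show "z \<in> sdisk t (arccos \<kappa>)" using D(5)[OF z] by (simp add: sdisk_def sdist_def)
  qed
  consider "\<kappa> < 0" | "\<kappa> = 0" | "0 < \<kappa>" by linarith
  then show ?thesis
  proof cases
    case 1
    obtain c d where cd: "farthest_pair V \<kappa> c d" "s *\<^sub>R v 0 = d + \<kappa> *\<^sub>R c" using chord[OF vE] by blast
    obtain a b where ab: "norm a = 1" "norm b = 1" "a \<noteq> b" "a \<bullet> v 0 = 0" "b \<bullet> v 0 = 0"
      "\<And>j. 0 \<le> a \<bullet> v j" "\<And>j. 0 \<le> b \<bullet> v j" using two_side_normals by metis
    \<comment> \<open>a vertex has two different side normals\<close>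
    have "a = c" "b = c"
      using vertex_dual_unique[OF cd 1] ab dual_v by blast+
    then show ?thesis using ab(3) by simp
  next
    case 2
    define t where "t = (1 / s) *\<^sub>R (c0 + \<kappa> *\<^sub>R d0)"
    \<comment> \<open>for \<open>\<kappa> = 0\<close> the foot is itself the center of a hemisphere that contains \<open>V\<close>\<close>
    have "t = c0" using 2 by (simp add: t_def s_def)
    then have "\<kappa> \<le> t \<bullet> z" if "z \<in> V" for z using far that 2 by (auto simp: farthest_pair_def dual_cone_def)
    then show ?thesis unfolding thick using disk[of t] foot[OF far] unfolding t_def by blast
  next
    case 3
    obtain cc dd where cd: "\<And>x. x \<in> E \<Longrightarrow> farthest_pair V \<kappa> (cc x) (dd x)"
      "\<And>x. x \<in> E \<Longrightarrow> s *\<^sub>R x = dd x + \<kappa> *\<^sub>R cc x" using chord by metis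
    define t where "t j = (1 / s) *\<^sub>R (cc (v j) + \<kappa> *\<^sub>R dd (v j))" for j
    have tV: "t j \<in> V" "t j \<in> sbd V" for j unfolding t_def using foot cd(1)[OF vE] by blast+
    have fp: "cc (v j) \<in> dual_cone V" "dd (v j) \<in> dual_cone V" "norm (cc (v j)) = 1" "norm (dd (v j)) = 1"
      "cc (v j) \<bullet> dd (v j) = - \<kappa>" for j
      using cd(1)[OF vE] by (auto simp: farthest_pair_def)
    have nonneg: "0 \<le> u \<bullet> v j" if "u \<in> dual_cone V" for u j
      using that vE E(2) by (auto simp: dual_cone_def)
    interpret chorded_polygon "int (card E)" v \<kappa> s "\<lambda>j. cc (v j)" "\<lambda>j. dd (v j)" t
    proof
      show "\<exists>f. (\<forall>x\<in>range v. 0 \<le> f x) \<and> t i = (\<Sum>x\<in>range v. f x *\<^sub>R x)" for i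
        unfolding rng by (rule comb[OF tV(1)])
      show "s *\<^sub>R t i = cc (v i) + \<kappa> *\<^sub>R dd (v i)" for i using s(1) by (simp add: t_def)
      show "s *\<^sub>R v i = dd (v i) + \<kappa> *\<^sub>R cc (v i)" for i by (rule cd(2)[OF vE])
      show "cc (v (j + int (card E))) = cc (v j)" "dd (v (j + int (card E))) = dd (v j)"
        "t (j + int (card E)) = t j" for j
        using v_period[of j] by (simp_all add: t_def)
      show "- \<kappa> * (norm c' * norm d') \<le> c' \<bullet> d'"
        if "\<And>j. 0 \<le> c' \<bullet> v j" "\<And>j. 0 \<le> d' \<bullet> v j" for c' d'
        using far dual_v that by (auto simp: farthest_pair_def)
    qed (use 3 \<kappa> s fp nonneg in auto)
    interpret sided_polygon "int (card E)" v \<kappa> s "\<lambda>j. cc (v j)" "\<lambda>j. dd (v j)" t side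
      by unfold_locales (use side side_period in auto)
    obtain i where i: "\<And>j. sdist (t i) (v j) \<le> arccos \<kappa>"
      using foot_within_width[of h] E(4) vE by blast
    have iE: "\<kappa> \<le> t i \<bullet> x" if x: "x \<in> E" for x
    proof -
      obtain j where "x = v j" using x rng by blast
      then have "arccos (t i \<bullet> x) \<le> arccos \<kappa>" using i by (simp add: sdist_def)
      then show ?thesis
        using arccos_le_mono[of "t i \<bullet> x" \<kappa>] \<kappa> unit_inner_bounds[OF t_unit E1[OF x], of i]
        by (simp add: abs_le_iff)
    qed
    have "\<kappa> \<le> t i \<bullet> z" if z: "z \<in> V" for z
    proof -
      obtain f where f: "\<forall>x\<in>E. 0 \<le> f x" "z = (\<Sum>x\<in>E. f x *\<^sub>R x)" using comb z by blast
      have "norm z \<le> (\<Sum>x\<in>E. norm (f x *\<^sub>R x))" unfolding f(2) by (rule norm_sum)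
      also have "\<dots> = (\<Sum>x\<in>E. f x)" using f(1) E1 by (intro sum.cong) auto
      finally have "1 \<le> (\<Sum>x\<in>E. f x)" using D(5)[OF z] by simp
      then have "\<kappa> * 1 \<le> \<kappa> * (\<Sum>x\<in>E. f x)" using 3 by (intro mult_left_mono) auto
      also have "\<dots> = (\<Sum>x\<in>E. f x * \<kappa>)" by (simp add: sum_distrib_left mult.commute)
      also have "\<dots> \<le> (\<Sum>x\<in>E. f x * (t i \<bullet> x))" using f(1) iE by (intro sum_mono mult_left_mono) auto
      also have "\<dots> = t i \<bullet> z" by (simp add: f(2) inner_sum_right)
      finally show ?thesis by simp
    qed
    then show ?thesis unfolding thick using disk[OF tV(1)] tV(2) by blast
  qed
qed

end
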